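(* Let $q\in L^1(0,\pi)$ be real-valued with Dirichlet-Dirichlet spectrum $\sigma_{DD}=\{a_n\}_{n\in\mathbb{N}}$ and Neumann-Dirichlet spectrum $\sigma_{ND}=\{b_n\}_{n\in\mathbb{N}}$, both contained in $(0,\infty)$, and let $\mu_{0,0}=\sum_{n\in\mathbb{N}}\gamma_n\delta_{a_n}$ be its spectral measure. Let $\{a_{k_n}\}_{n\in\mathbb{N}}\subset\sigma_{DD}$ and $\{b_{l_n}\}_{n\in\mathbb{N}}\subset\sigma_{ND}$ be subsequences (with $k_n$ and $l_n$ strictly increasing) such that, with $$A_{k_n,m}:=\frac{a_{k_n}}{b_{l_n}}(a_{k_n}-b_{l_n})\prod_{1\le j\le m,\ j\ne n}\frac{a_{k_j}}{b_{l_j}}\,\frac{a_{k_n}-b_{l_j}}{a_{k_n}-a_{k_j}},\qquad A_{k_n}:=\frac{a_{k_n}}{b_{l_n}}(a_{k_n}-b_{l_n})\prod_{j\in\mathbb{N},\ j\ne n}\frac{a_{k_j}}{b_{l_j}}\,\frac{a_{k_n}-b_{l_j}}{a_{k_n}-a_{k_j}},$$ the following hold: (1) $\displaystyle\lim_{m\to\infty}\sum_{n=1}^m\frac{|A_{k_n,m}-A_{k_n}|}{a_{k_n}^2}<\infty$; (2) $\{A_{k_n}/a_{k_n}^2\}_{n\in\mathbb{N}}\in\ell^1$. Then for any $s\in\mathbb{N}$, the data $\{a_n\}_{n\in\mathbb{N}}$, $\{b_n\}_{n\in\mathbb{N}}\setminus\{b_{l_n}\}_{n\in\mathbb{N}\setminus\{s\}}$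 and $\{\gamma_{k_n}\}_{n\in\mathbb{N}}$ determine the potential $q$. That is: if $\widetilde q\in L^1(0,\pi)$ is real-valued, with corresponding quantities $\widetilde a_n,\widetilde b_n,\widetilde\gamma_n$, and $\widetilde a_n=a_n$ for all $n\in\mathbb{N}$, $\widetilde b_j=b_j$ for all $j\in\mathbb{N}\setminus\{l_n:n\in\mathbb{N},\,n\ne s\}$, and $\widetilde\gamma_{k_n}=\gamma_{k_n}$ for all $n\in\mathbb{N}$, then $\widetilde q=q$ almost everywhere on $(0,\pi)$.
   Context: $\mathbb{N}=\{1,2,3,\dots\}$. For a real-valued potential $q\in L^1(0,\pi)$ consider the Schrödinger equation $-u''+qu=zu$ on $(0,\pi)$. The Dirichlet-Dirichlet spectrum $\sigma_{DD}=\{a_n\}_{n\in\mathbb{N}}$ is the set of eigenvalues for the boundary conditions $u(0)=0$, $u(\pi)=0$; the Neumann-Dirichlet spectrum $\sigma_{ND}=\{b_n\}_{n\in\mathbb{N}}$ is the set of eigenvalues for the boundary conditions $u'(0)=0$, $u(\pi)=0$. Both are discrete subsets of $\mathbb{R}$, bounded below, and are enumerated in increasing order. For each $n$ let $s_{a_n}$ be the solution of $-u''+qu=a_nu$ with $s_{a_n}(0)=0$, $s_{a_n}'(0)=1$; the point masses of the spectral measure $\mu_{0,0}=\sum_{n}\gamma_n\delta_{a_n}$ are $\gamma_n=\left(\int_0^\pi|s_{a_n}(t)|^2\,dt\right)^{-1}$. Equivalently, $\gamma_n=-\operatorname{Res}(m,a_n)$, where $m(z)=u_z'(0)/u_z(0)$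 and $u_z$ is the solution of $-u''+qu=zu$ with $u_z(\pi)=0$, $u_z'(\pi)=-1$. The number $A_{k_n,m}$ is the residue at $a_{k_n}$ of $G_m(z)=\prod_{n=1}^m\left(\frac{z}{b_{l_n}}-1\right)\left(\frac{z}{a_{k_n}}-1\right)^{-1}$ (for $n\le m$), and $A_{k_n}$ is the residue at $a_{k_n}$ of $G(z)=\prod_{n\in\mathbb{N}}\left(\frac{z}{b_{l_n}}-1\right)\left(\frac{z}{a_{k_n}}-1\right)^{-1}$. *)

theory Defs
  imports "HOL-Analysis.Analysis"
begin

(* All sequences are indexed from 0: entry n here is entry n + 1 of the usual enumeration
   by 1, 2, 3, ..., so sums over 1 <= n <= m become sums over n < m. *)

(* f is absolutely continuous on [0, pi] with derivative g, i.e. f is the indefinite Lebesgue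
   integral of the integrable function g.  If g is itself continuous, then f is C^1 and g is
   its (at the endpoints one-sided) derivative everywhere on [0, pi]. *)
definition has_ac_derivative :: "(real \<Rightarrow> complex) \<Rightarrow> (real \<Rightarrow> complex) \<Rightarrow> bool" where
  "has_ac_derivative f g \<longleftrightarrow>
     g absolutely_integrable_on {0..pi} \<and>
     (\<forall>x\<in>{0..pi}. (g has_integral (f x - f 0)) {0..x})"

(* The pair (u, u') is a Caratheodory solution: u and u' are absolutely continuous and
   the equation holds almost everywhere. *)
definition schrodinger_solution ::
    "(real \<Rightarrow> real) \<Rightarrow> complex \<Rightarrow> (real \<Rightarrow> complex) \<Rightarrow> (real \<Rightarrow> complex) \<Rightarrow> bool" where
  "schrodinger_solution q z u u' \<longleftrightarrow>
     has_ac_derivative u u' \<and>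
     (\<exists>u''. has_ac_derivative u' u'' \<and>
        (AE t in lebesgue. t \<in> {0<..<pi} \<longrightarrow>
           - u'' t + of_real (q t) * u t = z * u t))"

definition dirichlet_dirichlet_spectrum :: "(real \<Rightarrow> real) \<Rightarrow> complex set" where
  "dirichlet_dirichlet_spectrum q =
     {z. \<exists>u u'. schrodinger_solution q z u u' \<and> u 0 = 0 \<and> u pi = 0 \<and> (\<exists>x\<in>{0..pi}. u x \<noteq> 0)}"

definition neumann_dirichlet_spectrum :: "(real \<Rightarrow> real) \<Rightarrow> complex set" where
  "neumann_dirichlet_spectrum q =
     {z. \<exists>u u'. schrodinger_solution q z u u' \<and> u' 0 = 0 \<and> u pi = 0 \<and> (\<exists>x\<in>{0..pi}. u x \<noteq> 0)}"

definition increasing_enumeration :: "(nat \<Rightarrow> real) \<Rightarrow> complex set \<Rightarrow> bool" where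
  "increasing_enumeration a S \<longleftrightarrow> strict_mono a \<and> range (\<lambda>n. complex_of_real (a n)) = S"

definition point_mass :: "(real \<Rightarrow> real) \<Rightarrow> real \<Rightarrow> real \<Rightarrow> bool" where
  "point_mass q x \<gamma> \<longleftrightarrow>
     (\<exists>s s'. schrodinger_solution q (of_real x) s s' \<and> s 0 = 0 \<and> s' 0 = 1 \<and>
        \<gamma> = inverse (integral {0..pi} (\<lambda>t. (norm (s t))\<^sup>2)))"

(* q is an integrable potential with Dirichlet-Dirichlet spectrum a, Neumann-Dirichlet
   spectrum b and spectral measure given by the masses g n at the points a n. *)
definition spectral_data ::
    "(real \<Rightarrow> real) \<Rightarrow> (nat \<Rightarrow> real) \<Rightarrow> (nat \<Rightarrow> real) \<Rightarrow> (nat \<Rightarrow> real) \<Rightarrow> bool" where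
  "spectral_data q a b g \<longleftrightarrow>
     q absolutely_integrable_on {0<..<pi} \<and>
     increasing_enumeration a (dirichlet_dirichlet_spectrum q) \<and>
     increasing_enumeration b (neumann_dirichlet_spectrum q) \<and>
     (\<forall>n. point_mass q (a n) (g n))"

(* Residues at a (k n) of the products of (z / b (l j) - 1) / (z / a (k j) - 1) over j < m,
   respectively over all j. *)
definition partial_residue ::
    "(nat \<Rightarrow> real) \<Rightarrow> (nat \<Rightarrow> real) \<Rightarrow> (nat \<Rightarrow> nat) \<Rightarrow> (nat \<Rightarrow> nat) \<Rightarrow> nat \<Rightarrow> nat \<Rightarrow> real" where
  "partial_residue a b k l m n =
     a (k n) / b (l n) * (a (k n) - b (l n)) *
     (\<Prod>j\<in>{..<m} - {n}. a (k j) / b (l j) * ((a (k n) - b (l j)) / (a (k n) - a (k j))))"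

definition full_residue ::
    "(nat \<Rightarrow> real) \<Rightarrow> (nat \<Rightarrow> real) \<Rightarrow> (nat \<Rightarrow> nat) \<Rightarrow> (nat \<Rightarrow> nat) \<Rightarrow> nat \<Rightarrow> real" where
  "full_residue a b k l n =
     a (k n) / b (l n) * (a (k n) - b (l n)) *
     (\<Prod>j. if j = n then 1
           else a (k j) / b (l j) * ((a (k n) - b (l j)) / (a (k n) - a (k j))))"

end

theory Submission
  imports Defs "HOL-Complex_Analysis.Complex_Analysis" "HOL-Real_Asymp.Real_Asymp"
begin

text \<open>Let \<open>\<phi>\<close>, \<open>\<theta>\<close> be the solutions with initial values \<open>(0, 1)\<close> and \<open>(1, 0)\<close> at \<open>0\<close>. At the endpoint
  \<open>\<pi>\<close> they are entire functions \<open>P\<close>, \<open>Q\<close> of the spectral parameter with zero sets \<open>{a\<^sub>n}\<close> and \<open>{b\<^sub>n}\<close>, and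
  the Weyl function is \<open>m = - Q / P\<close> with residue \<open>- \<gamma>\<^sub>n\<close> at \<open>a\<^sub>n\<close>. Put
  \<open>G(z) = \<Prod>n. (z / b\<^bsub>l\<^sub>n\<^esub> - 1) / (z / a\<^bsub>k\<^sub>n\<^esub> - 1)\<close>. For two potentials with the given common data,
  \<open>H = G (1 - m~ / m)\<close> is entire: at the poles \<open>a\<^bsub>k\<^sub>n\<^esub>\<close> of \<open>G\<close> the residues of \<open>m\<close> and \<open>m~\<close>
  agree, and the poles of \<open>1 / m\<close> at \<open>b\<^bsub>l\<^sub>n\<^esub>\<close> are cancelled by zeros of \<open>G\<close>; moreover \<open>H\<close> vanishes at
  \<open>b\<^bsub>l\<^sub>s\<^esub>\<close>. The two conditions on the residues bound the partial fraction expansion of the partial products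
  of \<open>G\<close>, so \<open>G\<close> grows at most like \<open>\<bar>z\<bar>\<^sup>2 / \<bar>Im z\<bar>\<close>. As \<open>m~ / m\<close> is bounded on a sequence of circles and
  tends to \<open>1\<close> along the negative axis, \<open>H\<close> grows at most linearly and is \<open>o(\<bar>z\<bar>)\<close> on that axis, hence
  constant, hence zero. So \<open>m~ = m\<close>.

  By the Borg-Marchenko argument this implies equality of the potentials: \<open>\<phi>~ \<theta> - \<phi> \<theta>~\<close> at a fixed point
  \<open>x\<close> is entire in the spectral parameter and tends to \<open>0\<close> on the same circles, so it vanishes; together
  with the Wronskian identities this yields \<open>\<phi>~\<^sup>2 = \<phi>\<^sup>2\<close>.\<close>

section \<open>Calculus of absolutely continuous functions\<close>

text \<open>The potential is only integrable, so a solution has no pointwise second derivative; all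
  comparisons of solutions therefore go through one integrated Lagrange identity for two potentials
  and two spectral parameters. The product G is accessible only through its partial products:
  condition (2) controls the limiting residues, condition (1) transfers this to the residues of the
  partial products, uniformly in the number of factors, and the resulting bound survives the limit.
  The weight \<open>1 / a^2\<close> is what remains once the constant term of the partial fractions
  has been eliminated by means of G(0) = 1. Poles are never handled directly: G is a quotient
  \<open>h / f\<close> of canonical products, and H arises by successive division of entire
  functions at simple zeros, with \<open>H * (f * P' * Q) = h * (Q * P' - Q' * P)\<close>, where the
  primes mark the second potential. The canonical products need summable reciprocals of the
  eigenvalues; these come from growth of order 1/2 and zero counting rather than from eigenvalue
  asymptotics.\<close>

lemma has_ac_derivative_diff:
  assumes "has_ac_derivative f g" "0 \<le> u" "u \<le> v" "v \<le> pi"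
  shows "(g has_integral (f v - f u)) {u..v}"
proof -
  have v: "(g has_integral (f v - f 0)) {0..v}" and u: "(g has_integral (f u - f 0)) {0..u}"
    using assms by (auto simp: has_ac_derivative_def)
  have int: "g integrable_on {0..v}" using v by blast
  have "integral {0..u} g + integral {u..v} g = integral {0..v} g"
    using Henstock_Kurzweil_Integration.integral_combine[OF assms(2,3) int] .
  then have "integral {u..v} g = f v - f u"
    using u v by (simp add: integral_unique algebra_simps)
  moreover have "g integrable_on {u..v}"
    using integrable_on_subinterval[OF int, of u v] assms by auto
  ultimately show ?thesis by (metis integrable_integral)
qed

lemma has_ac_derivative_integrable:
  assumes "has_ac_derivative f g"
  shows "g absolutely_integrable_on {0..pi}"
  using assms by (auto simp: has_ac_derivative_def)

lemma has_ac_derivative_continuous: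
  assumes "has_ac_derivative f g"
  shows "continuous_on {0..pi} f"
proof -
  have "g integrable_on {0..pi}"
    using assms absolutely_integrable_on_def by (auto simp: has_ac_derivative_def)
  then have "continuous_on {0..pi} (\<lambda>x. f 0 + integral {0..x} g)"
    by (intro continuous_intros indefinite_integral_continuous_1)
  then show ?thesis
  proof (rule continuous_on_eq)
    fix x assume "x \<in> {0..pi}"
    then have "(g has_integral f x - f 0) {0..x}"
      using assms by (auto simp: has_ac_derivative_def)
    then show "f 0 + integral {0..x} g = f x"
      by (simp add: integral_unique)
  qed
qed

lemma absolutely_integrable_continuous_mult:
  fixes f g :: "real \<Rightarrow> complex"
  assumes "continuous_on {a..b} f" "g absolutely_integrable_on {a..b}"
  shows "(\<lambda>x. f x * g x) absolutely_integrable_on {a..b}"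
proof (rule absolutely_integrable_bounded_measurable_product[where h = "(*)", OF _ _ _ _ assms(2)])
  show "bilinear ((*) :: complex \<Rightarrow> complex \<Rightarrow> complex)"
    by (simp add: bilinear_times)
  show "f \<in> borel_measurable (lebesgue_on {a..b})"
    using assms(1) by (intro continuous_imp_measurable_on_sets_lebesgue) auto
  show "bounded (f ` {a..b})"
    using assms(1) compact_continuous_image compact_imp_bounded by blast
qed auto

text \<open>Since \<open>f'\<close> and \<open>g'\<close> are merely integrable, there is no
  pointwise product rule to integrate. Instead the formula is tested on the cells of a uniform
  subdivision so fine that \<open>f\<close> and \<open>g\<close> oscillate by at most
  \<open>\<epsilon>\<close> on each; the total error \<open>\<epsilon> * integral {0..x} e\<close>
  vanishes with \<open>\<epsilon>\<close>.\<close>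

lemma has_ac_derivative_mult:
  assumes f: "has_ac_derivative f f'" and g: "has_ac_derivative g g'"
  shows "has_ac_derivative (\<lambda>x. f x * g x) (\<lambda>x. f' x * g x + f x * g' x)"
proof -
  note cf = has_ac_derivative_continuous[OF f] and cg = has_ac_derivative_continuous[OF g]
  note if' = has_ac_derivative_integrable[OF f] and ig' = has_ac_derivative_integrable[OF g]
  define k where "k = (\<lambda>x. f' x * g x + f x * g' x)"
  have k: "k absolutely_integrable_on {0..pi}"
    unfolding k_def
    using absolutely_integrable_continuous_mult[OF cg if'] absolutely_integrable_continuous_mult[OF cf ig']
    by (intro set_integral_add) (simp_all add: mult.commute)
  define e where "e = (\<lambda>x. norm (f' x) + norm (g' x))"
  have e: "e absolutely_integrable_on {0..pi}"
    unfolding e_def using if' ig' by (intro set_integral_add set_integrable_norm)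
  have sub: "h integrable_on {u..v}" if "h absolutely_integrable_on {0..pi}" "0 \<le> u" "v \<le> pi"
    for h :: "real \<Rightarrow> 'b::euclidean_space" and u v
  proof -
    have "h integrable_on {0..pi}" using that absolutely_integrable_on_def by blast
    then show ?thesis by (rule integrable_on_subinterval) (use that in auto)
  qed
  \<comment> \<open>the defect of the product formula is at most the oscillation of \<open>f\<close> and \<open>g\<close> times \<open>\<integral>e\<close>, which is additive over a subdivision\<close>
  have step: "norm (f v * g v - f u * g u - integral {u..v} k) \<le> \<epsilon> * integral {u..v} e"
    if uv: "0 \<le> u" "u \<le> v" "v \<le> pi" and eps: "\<And>s t. \<lbrakk>s \<in> {u..v}; t \<in> {u..v}\<rbrakk> \<Longrightarrow> norm (f s - f t) \<le> \<epsilon> \<and> norm (g s - g t) \<le> \<epsilon>"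
    for u v \<epsilon>
  proof -
    \<comment> \<open>The increment of the product is
      \<open>(f v - f u) * g v + f u * (g v - g u)\<close>. With the endpoint values frozen this is
      an integral, and subtracting \<open>k\<close> leaves only differences of values of
      \<open>f\<close> and \<open>g\<close> within the cell.\<close>
    have 1: "((\<lambda>t. f' t * g v + f u * g' t) has_integral ((f v - f u) * g v + f u * (g v - g u))) {u..v}"
      using has_ac_derivative_diff[OF f uv] has_ac_derivative_diff[OF g uv]
      by (intro has_integral_add has_integral_mult_left has_integral_mult_right)
    have 2: "(k has_integral integral {u..v} k) {u..v}"
      using sub[OF k] uv by (simp add: integrable_integral)
    have "((\<lambda>t. f' t * (g v - g t) + (f u - f t) * g' t) has_integral (f v * g v - f u * g u - integral {u..v} k)) {u..v}"
      using has_integral_diff[OF 1 2] by (simp add: k_def algebra_simps)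
    moreover have "((\<lambda>t. \<epsilon> * e t) has_integral (\<epsilon> * integral {u..v} e)) {u..v}"
      using sub[OF e] uv by (intro has_integral_mult_right) (simp add: integrable_integral)
    moreover have "norm (f' t * (g v - g t) + (f u - f t) * g' t) \<le> \<epsilon> * e t" if "t \<in> {u..v}" for t
    proof -
      have "norm (f' t * (g v - g t) + (f u - f t) * g' t) \<le> norm (f' t) * norm (g v - g t) + norm (f u - f t) * norm (g' t)"
        by (metis norm_mult norm_triangle_ineq)
      also have "\<dots> \<le> norm (f' t) * \<epsilon> + \<epsilon> * norm (g' t)"
        using eps[of v t] eps[of u t] that by (intro add_mono mult_left_mono mult_right_mono) auto
      finally show ?thesis by (simp add: e_def algebra_simps)
    qed
    ultimately show ?thesis
      using integral_norm_bound_integral[of "\<lambda>t. f' t * (g v - g t) + (f u - f t) * g' t" "{u..v}" "\<lambda>t. \<epsilon> * e t"]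
      by (simp add: has_integral_iff)
  qed
  have main: "f x * g x - f 0 * g 0 = integral {0..x} k" if x: "x \<in> {0..pi}" for x
  proof -
    have le: "norm (f x * g x - f 0 * g 0 - integral {0..x} k) \<le> \<epsilon> * integral {0..x} e" if "\<epsilon> > 0" for \<epsilon>
    proof -
      obtain d1 where d1: "d1 > 0" "\<And>s t. \<lbrakk>s \<in> {0..pi}; t \<in> {0..pi}; dist s t < d1\<rbrakk> \<Longrightarrow> dist (f s) (f t) < \<epsilon>"
        using compact_uniformly_continuous[OF cf] \<open>\<epsilon> > 0\<close> unfolding uniformly_continuous_on_def by (metis compact_Icc)
      obtain d2 where d2: "d2 > 0" "\<And>s t. \<lbrakk>s \<in> {0..pi}; t \<in> {0..pi}; dist s t < d2\<rbrakk> \<Longrightarrow> dist (g s) (g t) < \<epsilon>"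
        using compact_uniformly_continuous[OF cg] \<open>\<epsilon> > 0\<close> unfolding uniformly_continuous_on_def by (metis compact_Icc)
      obtain N :: nat where N: "N > 0" "x < min d1 d2 * real N"
      proof -
        obtain N :: nat where "real N > x / min d1 d2" using reals_Archimedean2 by blast
        then have "x < real N * min d1 d2"
          using d1(1) d2(1) by (simp only: pos_divide_less_eq min_less_iff_conj)
        also have "\<dots> \<le> min d1 d2 * real (Suc N)"
          using d1(1) d2(1) by (simp add: algebra_simps)
        finally have "x < min d1 d2 * real (Suc N)" .
        then show ?thesis by (intro that[of "Suc N"]) auto
      qed
      define p where "p = (\<lambda>i. real i * x / real N)"
      have "norm (f (p i) * g (p i) - f 0 * g 0 - integral {0..p i} k) \<le> \<epsilon> * integral {0..p i} e" if "i \<le> N" for i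
        using that
      proof (induction i)
        case 0
        then show ?case by (simp add: p_def)
      next
        case (Suc i)
        have pi0: "0 \<le> p i" using x by (simp add: p_def)
        have mono: "p i \<le> p (Suc i)" using x by (simp add: p_def divide_right_mono mult_right_mono)
        have "p (Suc i) \<le> x"
          using Suc.prems x N(1) by (simp add: p_def pos_divide_le_eq) (metis mult.commute mult_left_mono of_nat_Suc of_nat_le_iff)
        then have pp: "p (Suc i) \<le> pi" using x by auto
        have "p (Suc i) - p i = x / real N"
          by (simp add: p_def distrib_right add_divide_distrib)
        then have len: "p (Suc i) - p i < min d1 d2"
          using N by (simp only: pos_divide_less_eq of_nat_0_less_iff)
        have "norm (f (p (Suc i)) * g (p (Suc i)) - f (p i) * g (p i) - integral {p i..p (Suc i)} k)
              \<le> \<epsilon> * integral {p i..p (Suc i)} e"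
        proof (rule step[OF pi0 mono pp])
          fix s t assume st: "s \<in> {p i..p (Suc i)}" "t \<in> {p i..p (Suc i)}"
          have "dist s t < min d1 d2"
            using st len unfolding dist_real_def atLeastAtMost_iff by linarith
          then show "norm (f s - f t) \<le> \<epsilon> \<and> norm (g s - g t) \<le> \<epsilon>"
            using d1(2)[of s t] d2(2)[of s t] st pi0 pp by (simp add: dist_norm less_imp_le)
        qed
        moreover have "integral {0..p i} k + integral {p i..p (Suc i)} k = integral {0..p (Suc i)} k"
          "integral {0..p i} e + integral {p i..p (Suc i)} e = integral {0..p (Suc i)} e"
          by (intro Henstock_Kurzweil_Integration.integral_combine pi0 mono sub[OF k] sub[OF e] pp order_refl)+
        moreover have "norm (f (p i) * g (p i) - f 0 * g 0 - integral {0..p i} k) \<le> \<epsilon> * integral {0..p i} e"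
          using Suc by simp
        ultimately show ?case
          using norm_triangle_ineq[of "f (p (Suc i)) * g (p (Suc i)) - f (p i) * g (p i) - integral {p i..p (Suc i)} k"
             "f (p i) * g (p i) - f 0 * g 0 - integral {0..p i} k"]
          by (simp add: algebra_simps flip: \<open>integral {0..p i} k + integral {p i..p (Suc i)} k = integral {0..p (Suc i)} k\<close>
             \<open>integral {0..p i} e + integral {p i..p (Suc i)} e = integral {0..p (Suc i)} e\<close>)
      qed
      from this[of N] show ?thesis using N(1) by (simp add: p_def)
    qed
    show ?thesis
    proof (rule ccontr)
      assume "\<not> ?thesis"
      then have pos: "norm (f x * g x - f 0 * g 0 - integral {0..x} k) > 0" (is "?n > 0") by simp
      have E: "integral {0..x} e \<ge> 0"
        using sub[OF e, of 0 x] x by (intro integral_nonneg) (auto simp: e_def)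
      have "?n \<le> (?n / (2 * (integral {0..x} e + 1))) * integral {0..x} e"
        by (rule le) (use pos E in simp)
      also have "\<dots> \<le> ?n / 2" using pos E by (simp add: field_simps)
      finally show False using pos by simp
    qed
  qed
  show ?thesis
    unfolding has_ac_derivative_def
  proof (intro conjI ballI)
    show "(\<lambda>x. f' x * g x + f x * g' x) absolutely_integrable_on {0..pi}"
      using k by (simp add: k_def)
    fix x :: real assume x: "x \<in> {0..pi}"
    have "(k has_integral integral {0..x} k) {0..x}"
      using sub[OF k, of 0 x] x by (simp add: integrable_integral)
    then show "((\<lambda>x. f' x * g x + f x * g' x) has_integral (f x * g x - f 0 * g 0)) {0..x}"
      using main[OF x] by (simp add: k_def)
  qed
qed

section \<open>The initial value problem by Picard iteration\<close>

lemma absolutely_integrable_on_complex_of_real: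
  assumes "q absolutely_integrable_on S"
  shows "(\<lambda>x. complex_of_real (q x)) absolutely_integrable_on S"
  using absolutely_integrable_linear[OF assms bounded_linear_of_real] by (simp add: o_def)

lemma absolutely_integrable_imp_integrable_on_subinterval:
  fixes f :: "real \<Rightarrow> 'b::euclidean_space"
  assumes "f absolutely_integrable_on {a..b}" "a \<le> u" "v \<le> b"
  shows "f integrable_on {u..v}"
proof -
  have "f integrable_on {a..b}" using assms(1) absolutely_integrable_on_def by blast
  then show ?thesis by (rule integrable_on_subinterval) (use assms in auto)
qed

lemma integrable_on_continuous_mult:
  fixes k f :: "real \<Rightarrow> complex"
  assumes "k absolutely_integrable_on {0..pi}" "continuous_on {0..pi} f" "0 \<le> u" "v \<le> pi"
  shows "(\<lambda>t. k t * f t) integrable_on {u..v}"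
  using absolutely_integrable_imp_integrable_on_subinterval[OF
      absolutely_integrable_continuous_mult[OF assms(2,1)] assms(3,4)]
  by (simp add: mult.commute)

text \<open>Finite sums of terms \<open>c(x) z\<^sup>j\<close> with continuous \<open>c\<close>, up to equality on \<open>[0, \<pi>]\<close>. The Picard iterates are of this
  form, which makes their joint continuity and their holomorphy in \<open>z\<close> stable under integration in \<open>x\<close> against an
  integrable potential.\<close>

inductive polynomial_family :: "(real \<Rightarrow> complex \<Rightarrow> complex) \<Rightarrow> bool" where
  const: "continuous_on {0..pi} c \<Longrightarrow> polynomial_family (\<lambda>x z. c x)"
| add: "polynomial_family F \<Longrightarrow> polynomial_family G \<Longrightarrow> polynomial_family (\<lambda>x z. F x z + G x z)"
| mult: "polynomial_family F \<Longrightarrow> polynomial_family (\<lambda>x z. z * F x z)"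
| cong: "polynomial_family F \<Longrightarrow> (\<And>x z. x \<in> {0..pi} \<Longrightarrow> G x z = F x z) \<Longrightarrow> polynomial_family G"

lemma polynomial_family_continuous:
  "polynomial_family F \<Longrightarrow> continuous_on ({0..pi} \<times> UNIV) (\<lambda>(x, z). F x z)"
proof (induction rule: polynomial_family.induct)
  case (const c)
  then have "continuous_on ({0..pi} \<times> (UNIV :: complex set)) (\<lambda>p. c (fst p))"
    by (rule continuous_on_compose2) (auto intro!: continuous_intros)
  then show ?case by (simp add: case_prod_beta)
next
  case (add F G)
  then show ?case by (auto simp: case_prod_beta intro!: continuous_intros)
next
  case (mult F)
  then show ?case by (auto simp: case_prod_beta intro!: continuous_intros)
next
  case (cong F G)
  show ?case by (rule continuous_on_eq[OF cong.IH]) (use cong.hyps in auto)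
qed

lemma polynomial_family_continuous_slice:
  assumes "polynomial_family F"
  shows "continuous_on {0..pi} (\<lambda>x. F x z)"
proof -
  have "continuous_on {0..pi} (\<lambda>x. case (x, z) of (x, z) \<Rightarrow> F x z)"
    by (rule continuous_on_compose2[OF polynomial_family_continuous[OF assms]]) (auto intro!: continuous_intros)
  then show ?thesis by simp
qed

lemma polynomial_family_holomorphic:
  "polynomial_family F \<Longrightarrow> x \<in> {0..pi} \<Longrightarrow> F x holomorphic_on UNIV"
proof (induction rule: polynomial_family.induct)
  case (cong F G)
  then show ?case by (metis holomorphic_cong)
qed (auto intro!: holomorphic_intros)

lemma polynomial_family_integral:
  assumes k: "k absolutely_integrable_on {0..pi}"
  shows "polynomial_family F \<Longrightarrow> polynomial_family (\<lambda>x z. integral {0..x} (\<lambda>t. k t * F t z))"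
proof (induction rule: polynomial_family.induct)
  case (const c)
  show ?case
    by (intro polynomial_family.const indefinite_integral_continuous_1 integrable_on_continuous_mult k const) auto
next
  case (add F G)
  show ?case
  proof (rule polynomial_family.cong[OF polynomial_family.add[OF add.IH]])
    fix x z assume "x \<in> {0..pi}"
    then have "(\<lambda>t. k t * F t z) integrable_on {0..x}" "(\<lambda>t. k t * G t z) integrable_on {0..x}"
      using add.hyps by (auto intro!: integrable_on_continuous_mult k polynomial_family_continuous_slice)
    then show "integral {0..x} (\<lambda>t. k t * (F t z + G t z)) =
       integral {0..x} (\<lambda>t. k t * F t z) + integral {0..x} (\<lambda>t. k t * G t z)"
      by (simp add: distrib_left Henstock_Kurzweil_Integration.integral_add)
  qed
next
  case (mult F)
  show ?case
  proof (rule polynomial_family.cong[OF polynomial_family.mult[OF mult.IH]])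
    fix x :: real and z assume "x \<in> {0..pi}"
    then show "integral {0..x} (\<lambda>t. k t * (z * F t z)) = z * integral {0..x} (\<lambda>t. k t * F t z)"
      by (simp add: mult.left_commute flip: integral_mult_right)
  qed
next
  case (cong F G)
  show ?case
  proof (rule polynomial_family.cong[OF cong.IH])
    fix x :: real and z assume "x \<in> {0..pi}"
    then show "integral {0..x} (\<lambda>t. k t * G t z) = integral {0..x} (\<lambda>t. k t * F t z)"
      using cong.hyps by (intro integral_cong) auto
  qed
qed

text \<open>Substitution in \<open>\<rho>\<close>, which need not be differentiable everywhere: the
  product rule for absolutely continuous functions is iterated on powers of \<open>\<rho>\<close>,
  with a detour through complex values, for which that rule is stated. The divisor
  \<open>Suc n\<close> is the source of the factorial in the Picard bound.\<close>

lemma has_integral_power_indefinite: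
  fixes k :: "real \<Rightarrow> real"
  assumes k: "k absolutely_integrable_on {0..pi}" and x: "x \<in> {0..pi}"
  defines "\<rho> \<equiv> \<lambda>x. integral {0..x} k"
  shows "((\<lambda>t. \<rho> t ^ n * k t) has_integral (\<rho> x ^ Suc n / Suc n)) {0..x}"
proof -
  have sub: "k integrable_on {0..x}" if "x \<in> {0..pi}" for x
    using absolutely_integrable_imp_integrable_on_subinterval[OF k] that by auto
  have 0: "has_ac_derivative (\<lambda>x. of_real (\<rho> x)) (\<lambda>x. of_real (k x))"
    unfolding has_ac_derivative_def
    using absolutely_integrable_on_complex_of_real[OF k] sub
    by (auto simp: \<rho>_def intro!: has_integral_of_real simp flip: has_integral_iff)
  have pow: "has_ac_derivative (\<lambda>x. of_real (\<rho> x) ^ Suc n) (\<lambda>x. of_nat (Suc n) * of_real (\<rho> x) ^ n * of_real (k x))"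
  proof (induction n)
    case 0
    then show ?case using \<open>has_ac_derivative (\<lambda>x. of_real (\<rho> x)) _\<close> by simp
  next
    case (Suc n)
    from has_ac_derivative_mult[OF this 0] show ?case
      by (simp add: algebra_simps)
  qed
  have "((\<lambda>t. of_real (of_nat (Suc n) * (\<rho> t ^ n * k t))) has_integral (complex_of_real (\<rho> x ^ Suc n))) {0..x}"
    using pow x by (auto simp: has_ac_derivative_def \<rho>_def mult.assoc)
  from has_integral_Re[OF this] have "((\<lambda>t. of_nat (Suc n) * (\<rho> t ^ n * k t)) has_integral (\<rho> x ^ Suc n)) {0..x}"
    unfolding Re_complex_of_real .
  from has_integral_mult_right[OF this, of "1 / of_nat (Suc n)"] show ?thesis
    by (simp del: of_nat_Suc)
qed

lemma integral_tendsto_uniform: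
  fixes k f :: "real \<Rightarrow> complex"
  assumes k: "k absolutely_integrable_on {0..pi}"
    and F: "uniform_limit {0..pi} F f sequentially"
    and c: "\<And>n. continuous_on {0..pi} (F n)"
    and x: "x \<in> {0..pi}"
  shows "(\<lambda>n. integral {0..x} (\<lambda>t. k t * F n t)) \<longlonglongrightarrow> integral {0..x} (\<lambda>t. k t * f t)"
proof (rule LIMSEQ_I)
  fix r :: real assume r: "r > 0"
  have cf: "continuous_on {0..pi} f"
    using uniform_limit_theorem[OF _ F] c by auto
  define I where "I = integral {0..x} (\<lambda>t. norm (k t))"
  have nk: "(\<lambda>t. norm (k t)) integrable_on {0..x}"
    using absolutely_integrable_imp_integrable_on_subinterval[OF set_integrable_norm[OF k], of 0 x] x by auto
  have I: "I \<ge> 0" unfolding I_def by (intro integral_nonneg nk) auto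
  have "\<forall>\<^sub>F n in sequentially. \<forall>t\<in>{0..pi}. dist (F n t) (f t) < r / (I + 1)"
    using F r I unfolding uniform_limit_iff by auto
  then obtain N where N: "\<And>n t. n \<ge> N \<Longrightarrow> t \<in> {0..pi} \<Longrightarrow> dist (F n t) (f t) < r / (I + 1)"
    unfolding eventually_sequentially by blast
  show "\<exists>N. \<forall>n\<ge>N. norm (integral {0..x} (\<lambda>t. k t * F n t) - integral {0..x} (\<lambda>t. k t * f t)) < r"
  proof (intro exI allI impI)
    fix n assume n: "n \<ge> N"
    have i1: "(\<lambda>t. k t * F n t) integrable_on {0..x}" and i2: "(\<lambda>t. k t * f t) integrable_on {0..x}"
      using x by (auto intro!: integrable_on_continuous_mult k c cf)
    have nk': "(\<lambda>t. norm (k t) * (r / (I + 1))) integrable_on {0..x}"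
      by (rule integrable_on_mult_left[OF nk])
    have "norm (integral {0..x} (\<lambda>t. k t * F n t) - integral {0..x} (\<lambda>t. k t * f t))
      = norm (integral {0..x} (\<lambda>t. k t * F n t - k t * f t))"
      by (simp add: Henstock_Kurzweil_Integration.integral_diff i1 i2)
    also have "\<dots> \<le> integral {0..x} (\<lambda>t. norm (k t) * (r / (I + 1)))"
    proof (rule integral_norm_bound_integral)
      fix t assume "t \<in> {0..x}"
      then have "norm (F n t - f t) \<le> r / (I + 1)" using N[OF n, of t] x by (auto simp: dist_norm)
      then show "norm (k t * F n t - k t * f t) \<le> norm (k t) * (r / (I + 1))"
        by (metis mult_left_mono norm_ge_zero norm_mult right_diff_distrib)
    qed (intro integrable_diff i1 i2 nk')+
    also have "\<dots> = I * (r / (I + 1))" by (simp add: I_def)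
    also have "\<dots> < r" using I r by (simp add: field_simps)
    finally show "norm (integral {0..x} (\<lambda>t. k t * F n t) - integral {0..x} (\<lambda>t. k t * f t)) < r" .
  qed
qed

text \<open>These are the terms of the Picard series, not its partial sums; \<open>\<alpha>\<close>
  and \<open>\<beta>\<close> are the initial values of the solution and of its derivative. The
  factor \<open>1 *\<close> gives both recursions the form of a kernel integrated against the other
  component, so that the same lemmas apply with kernel 1 and with kernel
  \<open>q - z\<close>.\<close>

fun picard :: "(real \<Rightarrow> real) \<Rightarrow> complex \<Rightarrow> complex \<Rightarrow> nat \<Rightarrow> real \<Rightarrow> complex \<Rightarrow> complex"
  and picard' :: "(real \<Rightarrow> real) \<Rightarrow> complex \<Rightarrow> complex \<Rightarrow> nat \<Rightarrow> real \<Rightarrow> complex \<Rightarrow> complex" where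
  "picard q \<alpha> \<beta> 0 x z = \<alpha>"
| "picard q \<alpha> \<beta> (Suc n) x z = integral {0..x} (\<lambda>t. 1 * picard' q \<alpha> \<beta> n t z)"
| "picard' q \<alpha> \<beta> 0 x z = \<beta>"
| "picard' q \<alpha> \<beta> (Suc n) x z = integral {0..x} (\<lambda>t. (of_real (q t) - z) * picard q \<alpha> \<beta> n t z)"

definition ivp :: "(real \<Rightarrow> real) \<Rightarrow> complex \<Rightarrow> complex \<Rightarrow> real \<Rightarrow> complex \<Rightarrow> complex" where
  "ivp q \<alpha> \<beta> x z = (\<Sum>n. picard q \<alpha> \<beta> n x z)"

definition ivp' :: "(real \<Rightarrow> real) \<Rightarrow> complex \<Rightarrow> complex \<Rightarrow> real \<Rightarrow> complex \<Rightarrow> complex" where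
  "ivp' q \<alpha> \<beta> x z = (\<Sum>n. picard' q \<alpha> \<beta> n x z)"

context
  fixes q :: "real \<Rightarrow> real"
  assumes q: "q absolutely_integrable_on {0..pi}"
begin

lemma potential_minus_absolutely_integrable:
  "(\<lambda>t. complex_of_real (q t) - z) absolutely_integrable_on {0..pi}"
  by (intro set_integral_diff absolutely_integrable_on_complex_of_real q absolutely_integrable_continuous_real) auto

text \<open>The second derivative in the definition is fixed only up to null sets. Replacing it by
  \<open>(q - z) * u\<close>, which may differ from it on a null set and at the endpoints, alters no
  integral, so a concrete function takes the place of the existential quantifier.\<close>

lemma schrodinger_solution_iff:
  "schrodinger_solution q z u u' \<longleftrightarrow>
     has_ac_derivative u u' \<and> has_ac_derivative u' (\<lambda>t. (of_real (q t) - z) * u t)"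
proof
  assume L: "schrodinger_solution q z u u'"
  then obtain u'' where u'': "has_ac_derivative u' u''"
    and ae: "AE t in lebesgue. t \<in> {0<..<pi} \<longrightarrow> - u'' t + of_real (q t) * u t = z * u t"
    and u: "has_ac_derivative u u'"
    by (auto simp: schrodinger_solution_def)
  obtain N where N: "N \<in> null_sets lebesgue"
    "\<And>t. t \<notin> N \<Longrightarrow> t \<in> {0<..<pi} \<Longrightarrow> - u'' t + of_real (q t) * u t = z * u t"
    using ae by (auto elim!: AE_E3)
  have neg: "negligible (N \<union> {0, pi})"
    using N(1) by (simp add: negligible_iff_null_sets)
  have eq: "(of_real (q t) - z) * u t = u'' t" if "t \<in> {0..pi} - (N \<union> {0, pi})" for t
    using N(2)[of t] that by (auto simp: algebra_simps)
  have "has_ac_derivative u' (\<lambda>t. (of_real (q t) - z) * u t)"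
    unfolding has_ac_derivative_def
  proof (intro conjI ballI)
    show "(\<lambda>t. (of_real (q t) - z) * u t) absolutely_integrable_on {0..pi}"
      using absolutely_integrable_continuous_mult[OF has_ac_derivative_continuous[OF u] potential_minus_absolutely_integrable]
      by (simp add: mult.commute)
    fix x assume x: "x \<in> {0..pi}"
    then have "(u'' has_integral u' x - u' 0) {0..x}"
      using u'' by (auto simp: has_ac_derivative_def)
    then show "((\<lambda>t. (of_real (q t) - z) * u t) has_integral u' x - u' 0) {0..x}"
      by (rule has_integral_spike[OF neg, rotated]) (use eq x in auto)
  qed
  with u show "has_ac_derivative u u' \<and> has_ac_derivative u' (\<lambda>t. (of_real (q t) - z) * u t)" by simp
next
  assume "has_ac_derivative u u' \<and> has_ac_derivative u' (\<lambda>t. (of_real (q t) - z) * u t)"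
  then show "schrodinger_solution q z u u'"
    unfolding schrodinger_solution_def by (auto intro!: exI[of _ "\<lambda>t. (of_real (q t) - z) * u t"] simp: algebra_simps)
qed

lemma picard_polynomial_family:
  "polynomial_family (picard q \<alpha> \<beta> n) \<and> polynomial_family (picard' q \<alpha> \<beta> n)"
proof (induction n)
  case 0
  have "picard q \<alpha> \<beta> 0 = (\<lambda>x z. \<alpha>)" "picard' q \<alpha> \<beta> 0 = (\<lambda>x z. \<beta>)"
    by (intro ext; simp)+
  then show ?case
    using polynomial_family.const[of "\<lambda>_. \<alpha>"] polynomial_family.const[of "\<lambda>_. \<beta>"] by simp
next
  case (Suc n)
  have one: "(\<lambda>t. 1 :: complex) absolutely_integrable_on {0..pi}"
    by (intro absolutely_integrable_continuous_real) auto
  have 1: "polynomial_family (picard q \<alpha> \<beta> (Suc n))"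
    by (rule polynomial_family.cong[OF polynomial_family_integral[OF one conjunct2[OF Suc]]]) simp
  have q0: "(\<lambda>t. complex_of_real (q t)) absolutely_integrable_on {0..pi}"
    using potential_minus_absolutely_integrable[of 0] by simp
  have n1: "(\<lambda>t. - 1 :: complex) absolutely_integrable_on {0..pi}"
    by (intro absolutely_integrable_continuous_real) auto
  \<comment> \<open>The kernel \<open>q - z\<close> depends on the parameter, which
    \<open>polynomial_family_integral\<close> does not allow; the integral is split into one with
    kernel \<open>q\<close> and \<open>z\<close> times one with kernel -1.\<close>
  have "polynomial_family (\<lambda>x z. integral {0..x} (\<lambda>t. of_real (q t) * picard q \<alpha> \<beta> n t z)
          + z * integral {0..x} (\<lambda>t. (- 1) * picard q \<alpha> \<beta> n t z))"
    using Suc by (intro polynomial_family.add polynomial_family.mult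
      polynomial_family_integral[OF q0] polynomial_family_integral[OF n1]) auto
  then have 2: "polynomial_family (picard' q \<alpha> \<beta> (Suc n))"
  proof (rule polynomial_family.cong)
    fix x z assume x: "x \<in> {0..pi}"
    have "(\<lambda>t. of_real (q t) * picard q \<alpha> \<beta> n t z) integrable_on {0..x}"
      by (intro integrable_on_continuous_mult q0 polynomial_family_continuous_slice conjunct1[OF Suc])
         (use x in auto)
    moreover have "(\<lambda>t. z * picard q \<alpha> \<beta> n t z) integrable_on {0..x}"
      by (intro integrable_on_continuous_mult absolutely_integrable_continuous_real continuous_on_const
          polynomial_family_continuous_slice conjunct1[OF Suc]) (use x in auto)
    ultimately show "picard' q \<alpha> \<beta> (Suc n) x z = integral {0..x} (\<lambda>t. of_real (q t) * picard q \<alpha> \<beta> n t z)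
          + z * integral {0..x} (\<lambda>t. (- 1) * picard q \<alpha> \<beta> n t z)"
      by (simp add: left_diff_distrib Henstock_Kurzweil_Integration.integral_diff)
  qed
  from 1 2 show ?case ..
qed

text \<open>The kernel \<open>1 + \<bar>q t\<bar> + R\<close> dominates both kernels, 1 and
  \<open>q - z\<close>, so a single induction bounds both components. Integrating
  \<open>\<rho>^n / n!\<close> against this kernel produces the next term of the exponential series
  in \<open>\<rho>\<close>.\<close>

lemma picard_bound:
  fixes \<alpha> \<beta> :: complex
  assumes z: "norm z \<le> R" and x: "x \<in> {0..pi}"
  defines "\<rho> \<equiv> \<lambda>x. integral {0..x} (\<lambda>t. 1 + \<bar>q t\<bar> + R)"
  defines "M \<equiv> max (norm \<alpha>) (norm \<beta>)"
  shows "norm (picard q \<alpha> \<beta> n x z) \<le> M * \<rho> x ^ n / fact n \<and>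
         norm (picard' q \<alpha> \<beta> n x z) \<le> M * \<rho> x ^ n / fact n"
  using x
proof (induction n arbitrary: x)
  case 0
  then show ?case by (simp add: M_def)
next
  case (Suc n)
  define k where "k = (\<lambda>t. 1 + \<bar>q t\<bar> + R)"
  have R: "R \<ge> 0" using z norm_ge_zero order_trans by blast
  have k: "k absolutely_integrable_on {0..pi}"
    unfolding k_def
    by (intro set_integral_add absolutely_integrable_continuous_real set_integrable_abs q) auto
  have \<rho>0: "\<rho> t \<ge> 0" if "t \<in> {0..pi}" for t
    unfolding \<rho>_def using absolutely_integrable_imp_integrable_on_subinterval[OF k, of 0 t] that R
    by (intro integral_nonneg) (auto simp: k_def)
  have M: "M \<ge> 0" by (simp add: M_def le_max_iff_disj)
  have hi: "((\<lambda>t. M / fact n * (\<rho> t ^ n * k t)) has_integral (M / fact n * (\<rho> x ^ Suc n / Suc n))) {0..x}"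
    unfolding \<rho>_def
    by (rule has_integral_mult_right, fold k_def, rule has_integral_power_indefinite[OF k Suc.prems])
  have eq: "M / fact n * (\<rho> x ^ Suc n / Suc n) = M * \<rho> x ^ Suc n / fact (Suc n)"
    by (simp add: field_simps)
  have gen: "norm (integral {0..x} (\<lambda>t. w t * F t)) \<le> M * \<rho> x ^ Suc n / fact (Suc n)"
    if w: "w absolutely_integrable_on {0..pi}" "\<And>t. norm (w t) \<le> k t"
      and F: "continuous_on {0..pi} F" "\<And>t. t \<in> {0..pi} \<Longrightarrow> norm (F t) \<le> M * \<rho> t ^ n / fact n"
    for w F :: "real \<Rightarrow> complex"
  proof -
    have "norm (integral {0..x} (\<lambda>t. w t * F t)) \<le> integral {0..x} (\<lambda>t. M / fact n * (\<rho> t ^ n * k t))"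
    proof (rule integral_norm_bound_integral)
      show "(\<lambda>t. w t * F t) integrable_on {0..x}"
        by (intro integrable_on_continuous_mult w(1) F(1)) (use Suc.prems in auto)
      show "(\<lambda>t. M / fact n * (\<rho> t ^ n * k t)) integrable_on {0..x}" using hi by blast
      fix t assume t: "t \<in> {0..x}"
      then have tp: "t \<in> {0..pi}" using Suc.prems by auto
      have "norm (w t * F t) \<le> k t * (M * \<rho> t ^ n / fact n)"
        unfolding norm_mult using w(2)[of t] F(2)[OF tp] \<rho>0[OF tp] M by (intro mult_mono) (auto simp: order_trans[OF norm_ge_zero w(2)])
      then show "norm (w t * F t) \<le> M / fact n * (\<rho> t ^ n * k t)"
        by (simp add: field_simps)
    qed
    then show ?thesis unfolding integral_unique[OF hi] eq .
  qed
  have kge: "1 \<le> k t" "norm (complex_of_real (q t) - z) \<le> k t" for t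
    using norm_triangle_ineq4[of "complex_of_real (q t)" z] z R by (auto simp: k_def)
  have IH: "norm (picard q \<alpha> \<beta> n t z) \<le> M * \<rho> t ^ n / fact n" "norm (picard' q \<alpha> \<beta> n t z) \<le> M * \<rho> t ^ n / fact n"
    if "t \<in> {0..pi}" for t using Suc.IH that by auto
  have one: "(\<lambda>t. 1 :: complex) absolutely_integrable_on {0..pi}"
    by (intro absolutely_integrable_continuous_real) auto
  note fam = picard_polynomial_family[of \<alpha> \<beta> n]
  have "norm (integral {0..x} (\<lambda>t. 1 * picard' q \<alpha> \<beta> n t z)) \<le> M * \<rho> x ^ Suc n / fact (Suc n)"
    by (rule gen[OF one _ polynomial_family_continuous_slice[OF conjunct2[OF fam]] IH(2)]) (simp_all add: kge)
  moreover have "norm (integral {0..x} (\<lambda>t. (of_real (q t) - z) * picard q \<alpha> \<beta> n t z)) \<le> M * \<rho> x ^ Suc n / fact (Suc n)"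
    by (rule gen[OF potential_minus_absolutely_integrable kge(2) polynomial_family_continuous_slice[OF conjunct1[OF fam]] IH(1)])
  ultimately show ?case
    unfolding picard.simps picard'.simps ..
qed


text \<open>The majorant is the exponential series at \<open>\<rho> pi\<close>. Convergence that is
  uniform jointly in \<open>x\<close> and in a disc of parameters is what later yields continuity,
  holomorphy and the integral equations at once.\<close>

lemma picard_uniform_limit:
  fixes R :: real and \<alpha> \<beta> :: complex
  defines "S \<equiv> {0..pi} \<times> cball (0 :: complex) R"
  shows "uniform_limit S (\<lambda>n (x, z). \<Sum>i<n. picard q \<alpha> \<beta> i x z) (\<lambda>(x, z). ivp q \<alpha> \<beta> x z) sequentially"
    and "uniform_limit S (\<lambda>n (x, z). \<Sum>i<n. picard' q \<alpha> \<beta> i x z) (\<lambda>(x, z). ivp' q \<alpha> \<beta> x z) sequentially"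
proof -
  define k where "k = (\<lambda>t. 1 + \<bar>q t\<bar> + R)"
  define \<rho> where "\<rho> = (\<lambda>x. integral {0..x} k)"
  define M where "M = max (norm \<alpha>) (norm \<beta>)"
  define c where "c = (\<lambda>n. M * \<rho> pi ^ n / fact n)"
  have bd: "norm (picard q \<alpha> \<beta> n x z) \<le> c n \<and> norm (picard' q \<alpha> \<beta> n x z) \<le> c n"
    if xz: "(x, z) \<in> S" for n x z
  proof -
    have z: "norm z \<le> R" and x: "x \<in> {0..pi}" using xz by (auto simp: S_def)
    have R: "R \<ge> 0" using z norm_ge_zero order_trans by blast
    have k: "k absolutely_integrable_on {0..pi}"
      unfolding k_def
      by (intro set_integral_add absolutely_integrable_continuous_real set_integrable_abs q) auto
    have ki: "k integrable_on {u..v}" if "0 \<le> u" "v \<le> pi" for u v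
      using absolutely_integrable_imp_integrable_on_subinterval[OF k that] .
    have kpos: "k t \<ge> 0" for t using R by (simp add: k_def)
    have "\<rho> x \<ge> 0" unfolding \<rho>_def
      using x ki kpos by (intro integral_nonneg) auto
    moreover have "\<rho> x \<le> \<rho> pi" unfolding \<rho>_def
      using x ki kpos by (intro integral_subset_le) auto
    ultimately have "M * \<rho> x ^ n / fact n \<le> c n"
      unfolding c_def by (intro divide_right_mono mult_left_mono power_mono) (auto simp: M_def le_max_iff_disj)
    then show ?thesis
      using picard_bound[OF z x, of \<alpha> \<beta> n] unfolding \<rho>_def k_def M_def by linarith
  qed
  have "summable (\<lambda>n. M * (inverse (fact n) * \<rho> pi ^ n))"
    by (intro summable_mult summable_exp)
  then have sc: "summable c" by (simp add: c_def field_simps)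
  have "uniform_limit S (\<lambda>n p. \<Sum>i<n. picard q \<alpha> \<beta> i (fst p) (snd p)) (\<lambda>p. \<Sum>i. picard q \<alpha> \<beta> i (fst p) (snd p)) sequentially"
    by (rule Weierstrass_m_test[OF _ sc]) (use bd in auto)
  then show "uniform_limit S (\<lambda>n (x, z). \<Sum>i<n. picard q \<alpha> \<beta> i x z) (\<lambda>(x, z). ivp q \<alpha> \<beta> x z) sequentially"
    by (simp add: ivp_def case_prod_unfold)
  have "uniform_limit S (\<lambda>n p. \<Sum>i<n. picard' q \<alpha> \<beta> i (fst p) (snd p)) (\<lambda>p. \<Sum>i. picard' q \<alpha> \<beta> i (fst p) (snd p)) sequentially"
    by (rule Weierstrass_m_test[OF _ sc]) (use bd in auto)
  then show "uniform_limit S (\<lambda>n (x, z). \<Sum>i<n. picard' q \<alpha> \<beta> i x z) (\<lambda>(x, z). ivp' q \<alpha> \<beta> x z) sequentially"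
    by (simp add: ivp'_def case_prod_unfold)
qed

lemma picard_sum_polynomial_family:
  "polynomial_family (\<lambda>x z. \<Sum>i<n. picard q \<alpha> \<beta> i x z)"
  "polynomial_family (\<lambda>x z. \<Sum>i<n. picard' q \<alpha> \<beta> i x z)"
proof -
  have "polynomial_family (\<lambda>x z. \<Sum>i<n. F i x z)" if "\<And>i. polynomial_family (F i)" for F
  proof (induction n)
    case 0
    then show ?case using polynomial_family.const[of "\<lambda>_. 0"] by simp
  next
    case (Suc n)
    then show ?case using polynomial_family.add[OF Suc that] by simp
  qed
  then show "polynomial_family (\<lambda>x z. \<Sum>i<n. picard q \<alpha> \<beta> i x z)"
    "polynomial_family (\<lambda>x z. \<Sum>i<n. picard' q \<alpha> \<beta> i x z)"
    using picard_polynomial_family by auto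
qed

lemma picard_uniform_limit_slice:
  "uniform_limit {0..pi} (\<lambda>n x. \<Sum>i<n. picard q \<alpha> \<beta> i x z) (\<lambda>x. ivp q \<alpha> \<beta> x z) sequentially"
  "uniform_limit {0..pi} (\<lambda>n x. \<Sum>i<n. picard' q \<alpha> \<beta> i x z) (\<lambda>x. ivp' q \<alpha> \<beta> x z) sequentially"
proof -
  have "uniform_limit {0..pi} (\<lambda>n x. F n x z) (\<lambda>x. G x z) sequentially"
    if F: "uniform_limit ({0..pi} \<times> cball 0 (norm z)) (\<lambda>n (x, z). F n x z) (\<lambda>(x, z). G x z) sequentially"
    for F :: "nat \<Rightarrow> real \<Rightarrow> complex \<Rightarrow> complex" and G
    unfolding uniform_limit_iff
  proof (intro allI impI)
    fix e :: real assume "e > 0"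
    then have "\<forall>\<^sub>F n in sequentially. \<forall>p\<in>{0..pi} \<times> cball 0 (norm z).
        dist (case p of (x, z) \<Rightarrow> F n x z) (case p of (x, z) \<Rightarrow> G x z) < e"
      using F unfolding uniform_limit_iff by blast
    then show "\<forall>\<^sub>F n in sequentially. \<forall>x\<in>{0..pi}. dist (F n x z) (G x z) < e"
      by (rule eventually_mono) (auto dest: bspec[where x = "(_, z)"])
  qed
  from this[OF picard_uniform_limit(1)] this[OF picard_uniform_limit(2)]
  show "uniform_limit {0..pi} (\<lambda>n x. \<Sum>i<n. picard q \<alpha> \<beta> i x z) (\<lambda>x. ivp q \<alpha> \<beta> x z) sequentially"
    "uniform_limit {0..pi} (\<lambda>n x. \<Sum>i<n. picard' q \<alpha> \<beta> i x z) (\<lambda>x. ivp' q \<alpha> \<beta> x z) sequentially" .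
qed

lemma ivp_holomorphic:
  assumes x: "x \<in> {0..pi}"
  shows "(\<lambda>z. ivp q \<alpha> \<beta> x z) holomorphic_on UNIV"
proof (rule holomorphic_uniform_sequence[where f = "\<lambda>n z. \<Sum>i<n. picard q \<alpha> \<beta> i x z"])
  show "(\<lambda>z. \<Sum>i<n. picard q \<alpha> \<beta> i x z) holomorphic_on UNIV" for n
    using polynomial_family_holomorphic[OF picard_sum_polynomial_family(1) x] .
  fix w :: complex
  have sub: "cball w 1 \<subseteq> cball 0 (norm w + 1)"
  proof
    fix v assume "v \<in> cball w 1"
    then have "norm (v - w) \<le> 1" by (simp add: dist_norm norm_minus_commute)
    then show "v \<in> cball 0 (norm w + 1)" using norm_triangle_sub[of v w] by simp
  qed
  have "uniform_limit (cball w 1) (\<lambda>n z. \<Sum>i<n. picard q \<alpha> \<beta> i x z) (ivp q \<alpha> \<beta> x) sequentially"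
    unfolding uniform_limit_iff
  proof (intro allI impI)
    fix e :: real assume "e > 0"
    then have "\<forall>\<^sub>F n in sequentially. \<forall>p\<in>{0..pi} \<times> cball 0 (norm w + 1).
        dist (case p of (x, z) \<Rightarrow> \<Sum>i<n. picard q \<alpha> \<beta> i x z) (case p of (x, z) \<Rightarrow> ivp q \<alpha> \<beta> x z) < e"
      using picard_uniform_limit(1)[of \<alpha> \<beta> "norm w + 1"] unfolding uniform_limit_iff by blast
    then show "\<forall>\<^sub>F n in sequentially. \<forall>z\<in>cball w 1. dist (\<Sum>i<n. picard q \<alpha> \<beta> i x z) (ivp q \<alpha> \<beta> x z) < e"
    proof (rule eventually_mono, intro ballI)
      fix n z assume H: "\<forall>p\<in>{0..pi} \<times> cball 0 (norm w + 1).
        dist (case p of (x, z) \<Rightarrow> \<Sum>i<n. picard q \<alpha> \<beta> i x z) (case p of (x, z) \<Rightarrow> ivp q \<alpha> \<beta> x z) < e"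
        and z: "z \<in> cball w 1"
      show "dist (\<Sum>i<n. picard q \<alpha> \<beta> i x z) (ivp q \<alpha> \<beta> x z) < e"
        using H[THEN bspec, of "(x, z)"] x z sub by auto
    qed
  qed
  then show "\<exists>d>0. cball w d \<subseteq> UNIV \<and> uniform_limit (cball w d) (\<lambda>n z. \<Sum>i<n. picard q \<alpha> \<beta> i x z) (ivp q \<alpha> \<beta> x) sequentially"
    by (intro exI[of _ 1]) auto
qed auto

lemma ivp_continuous:
  "continuous_on ({0..pi} \<times> cball 0 R) (\<lambda>(x, z). ivp q \<alpha> \<beta> x z)"
proof (rule uniform_limit_theorem[OF _ picard_uniform_limit(1)])
  have "continuous_on ({0..pi} \<times> cball 0 R) (\<lambda>(x, z). \<Sum>i<n. picard q \<alpha> \<beta> i x z)" for n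
    by (rule continuous_on_subset[OF polynomial_family_continuous[OF picard_sum_polynomial_family(1)]]) auto
  then show "\<forall>\<^sub>F n in sequentially. continuous_on ({0..pi} \<times> cball 0 R) (\<lambda>(x, z). \<Sum>i<n. picard q \<alpha> \<beta> i x z)"
    by simp
qed auto

lemma picard_0: "picard q \<alpha> \<beta> n 0 z = (if n = 0 then \<alpha> else 0)" "picard' q \<alpha> \<beta> n 0 z = (if n = 0 then \<beta> else 0)"
  by (cases n; simp)+

lemma ivp_0: "ivp q \<alpha> \<beta> 0 z = \<alpha>" "ivp' q \<alpha> \<beta> 0 z = \<beta>"
  using suminf_finite[of "{0}" "\<lambda>n. picard q \<alpha> \<beta> n 0 z"] suminf_finite[of "{0}" "\<lambda>n. picard' q \<alpha> \<beta> n 0 z"]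
  by (simp_all add: ivp_def ivp'_def picard_0)

lemma ivp_solution: "schrodinger_solution q z (\<lambda>x. ivp q \<alpha> \<beta> x z) (\<lambda>x. ivp' q \<alpha> \<beta> x z)"
proof -
  define S where "S = (\<lambda>n x. \<Sum>i<n. picard q \<alpha> \<beta> i x z)"
  define S' where "S' = (\<lambda>n x. \<Sum>i<n. picard' q \<alpha> \<beta> i x z)"
  note lim = picard_uniform_limit_slice[of \<alpha> \<beta> z, folded S_def S'_def]
  have cS: "continuous_on {0..pi} (S n)" "continuous_on {0..pi} (S' n)" for n
    unfolding S_def S'_def
    using polynomial_family_continuous_slice[OF picard_sum_polynomial_family(1)]
      polynomial_family_continuous_slice[OF picard_sum_polynomial_family(2)] by auto
  have c: "continuous_on {0..pi} (\<lambda>x. ivp q \<alpha> \<beta> x z)" "continuous_on {0..pi} (\<lambda>x. ivp' q \<alpha> \<beta> x z)"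
    using uniform_limit_theorem[OF _ lim(1)] uniform_limit_theorem[OF _ lim(2)] cS by auto
  have one: "(\<lambda>t. 1 :: complex) absolutely_integrable_on {0..pi}"
    by (intro absolutely_integrable_continuous_real) auto
  note qz = potential_minus_absolutely_integrable[of z]
  \<comment> \<open>In both components \<open>Suc n\<close> terms of one series are an integral of
    \<open>n\<close> terms of the other, the first term contributing the constant \<open>c0\<close>.
    Uniform convergence turns this recursion into the integral equation for the sums.\<close>
  have gen: "has_ac_derivative F (\<lambda>t. k t * G t)"
    if k: "k absolutely_integrable_on {0..pi}" and G: "continuous_on {0..pi} G"
      and H: "uniform_limit {0..pi} H G sequentially" "\<And>n. continuous_on {0..pi} (H n)"
      and L: "uniform_limit {0..pi} L F sequentially"
      and eq: "\<And>n x. x \<in> {0..pi} \<Longrightarrow> L (Suc n) x = c0 + integral {0..x} (\<lambda>t. k t * H n t)"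
    for F G k :: "real \<Rightarrow> complex" and H L c0
  proof -
    have val: "F x = c0 + integral {0..x} (\<lambda>t. k t * G t)" if x: "x \<in> {0..pi}" for x
    proof (rule LIMSEQ_unique)
      show "(\<lambda>n. L (Suc n) x) \<longlonglongrightarrow> F x"
        using tendsto_uniform_limitI[OF L x] by (rule LIMSEQ_Suc)
      show "(\<lambda>n. L (Suc n) x) \<longlonglongrightarrow> c0 + integral {0..x} (\<lambda>t. k t * G t)"
        unfolding eq[OF x] by (intro tendsto_intros integral_tendsto_uniform[OF k H x])
    qed
    show ?thesis
      unfolding has_ac_derivative_def
    proof (intro conjI ballI)
      show "(\<lambda>t. k t * G t) absolutely_integrable_on {0..pi}"
        using absolutely_integrable_continuous_mult[OF G k] by (simp add: mult.commute)
      fix x assume x: "x \<in> {0..pi}"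
      have "F x - F 0 = integral {0..x} (\<lambda>t. k t * G t)"
        using val[OF x] val[of 0] by simp
      moreover have "(\<lambda>t. k t * G t) integrable_on {0..x}"
        using x by (intro integrable_on_continuous_mult[OF k G]) auto
      ultimately show "((\<lambda>t. k t * G t) has_integral F x - F 0) {0..x}"
        by (simp add: integrable_integral)
    qed
  qed
  have sum_int: "(\<Sum>i<n. integral {0..x} (\<lambda>t. k t * f i t)) = integral {0..x} (\<lambda>t. k t * (\<Sum>i<n. f i t))"
    if "k absolutely_integrable_on {0..pi}" "\<And>i. continuous_on {0..pi} (f i)" "x \<in> {0..pi}" for k and f :: "nat \<Rightarrow> real \<Rightarrow> complex" and n x
  proof -
    have "integral {0..x} (\<lambda>t. \<Sum>i<n. k t * f i t) = (\<Sum>i<n. integral {0..x} (\<lambda>t. k t * f i t))"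
      by (intro Henstock_Kurzweil_Integration.integral_sum integrable_on_continuous_mult that(1,2)) (use that(3) in auto)
    then show ?thesis by (simp add: sum_distrib_left)
  qed
  note cont = polynomial_family_continuous_slice[OF conjunct1[OF picard_polynomial_family]]
    polynomial_family_continuous_slice[OF conjunct2[OF picard_polynomial_family]]
  have "has_ac_derivative (\<lambda>x. ivp q \<alpha> \<beta> x z) (\<lambda>t. 1 * ivp' q \<alpha> \<beta> t z)"
  proof (rule gen[OF one c(2) lim(2) cS(2) lim(1)])
    fix n x assume x: "x \<in> {0..pi}"
    show "S (Suc n) x = \<alpha> + integral {0..x} (\<lambda>t. 1 * S' n t)"
      unfolding S_def S'_def sum.lessThan_Suc_shift picard.simps sum_int[OF one cont(2) x] by (rule refl)
  qed
  moreover have "has_ac_derivative (\<lambda>x. ivp' q \<alpha> \<beta> x z) (\<lambda>t. (of_real (q t) - z) * ivp q \<alpha> \<beta> t z)"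
  proof (rule gen[OF qz c(1) lim(1) cS(1) lim(2)])
    fix n x assume x: "x \<in> {0..pi}"
    show "S' (Suc n) x = \<beta> + integral {0..x} (\<lambda>t. (of_real (q t) - z) * S n t)"
      unfolding S_def S'_def sum.lessThan_Suc_shift picard'.simps sum_int[OF qz cont(1) x] by (rule refl)
  qed
  ultimately show ?thesis
    by (simp add: schrodinger_solution_iff)
qed

end

section \<open>Lagrange's identity and the two spectra\<close>

abbreviation phi :: "(real \<Rightarrow> real) \<Rightarrow> real \<Rightarrow> complex \<Rightarrow> complex" where "phi q \<equiv> ivp q 0 1"
abbreviation phi' :: "(real \<Rightarrow> real) \<Rightarrow> real \<Rightarrow> complex \<Rightarrow> complex" where "phi' q \<equiv> ivp' q 0 1"
abbreviation theta :: "(real \<Rightarrow> real) \<Rightarrow> real \<Rightarrow> complex \<Rightarrow> complex" where "theta q \<equiv> ivp q 1 0"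
abbreviation theta' :: "(real \<Rightarrow> real) \<Rightarrow> real \<Rightarrow> complex \<Rightarrow> complex" where "theta' q \<equiv> ivp' q 1 0"

lemma integral_of_real_complex:
  assumes "f integrable_on S"
  shows "integral S (\<lambda>x. complex_of_real (f x)) = of_real (integral S f)"
  using has_integral_of_real[OF integrable_integral[OF assms], where ?'b = complex] by (rule integral_unique)

lemma has_ac_derivative_lincomb:
  assumes "has_ac_derivative f f'" "has_ac_derivative g g'"
  shows "has_ac_derivative (\<lambda>x. c * f x + d * g x) (\<lambda>x. c * f' x + d * g' x)"
  unfolding has_ac_derivative_def
proof (intro conjI ballI)
  show "(\<lambda>x. c * f' x + d * g' x) absolutely_integrable_on {0..pi}"
    using assms by (intro set_integral_add set_integrable_mult_right) (auto simp: has_ac_derivative_def)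
  fix x assume "x \<in> {0..pi}"
  then have "(f' has_integral f x - f 0) {0..x}" "(g' has_integral g x - g 0) {0..x}"
    using assms by (auto simp: has_ac_derivative_def)
  from has_integral_add[OF has_integral_mult_right[OF this(1), of c] has_integral_mult_right[OF this(2), of d]]
  show "((\<lambda>x. c * f' x + d * g' x) has_integral c * f x + d * g x - (c * f 0 + d * g 0)) {0..x}"
    by (simp add: algebra_simps)
qed

lemma has_ac_derivative_cnj:
  assumes "has_ac_derivative f g"
  shows "has_ac_derivative (\<lambda>x. cnj (f x)) (\<lambda>x. cnj (g x))"
  unfolding has_ac_derivative_def
proof (intro conjI ballI)
  have "g absolutely_integrable_on {0..pi}" using assms by (simp add: has_ac_derivative_def)
  from absolutely_integrable_linear[OF this bounded_linear_cnj]
  show "(\<lambda>x. cnj (g x)) absolutely_integrable_on {0..pi}" by (simp add: o_def)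
  fix x assume "x \<in> {0..pi}"
  then have "(g has_integral f x - f 0) {0..x}" using assms by (simp add: has_ac_derivative_def)
  from has_integral_linear[OF this bounded_linear_cnj]
  show "((\<lambda>x. cnj (g x)) has_integral cnj (f x) - cnj (f 0)) {0..x}" by (simp add: o_def)
qed

lemma has_ac_derivative_C1:
  assumes "\<And>t. t \<in> {0..pi} \<Longrightarrow> (f has_vector_derivative g t) (at t within {0..pi})"
    and "continuous_on {0..pi} g"
  shows "has_ac_derivative f g"
  unfolding has_ac_derivative_def
proof (intro conjI ballI)
  show "g absolutely_integrable_on {0..pi}"
    by (intro absolutely_integrable_continuous_real assms)
  fix x assume x: "x \<in> {0..pi}"
  show "(g has_integral f x - f 0) {0..x}"
  proof (rule fundamental_theorem_of_calculus)
    show "0 \<le> x" using x by simp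
    fix t assume "t \<in> {0..x}"
    then show "(f has_vector_derivative g t) (at t within {0..x})"
      using x by (intro has_vector_derivative_within_subset[OF assms(1)]) auto
  qed
qed

text \<open>The free solution that vanishes at \<open>c\<close> with derivative -1 there. Against
  it, the boundary term of Lagrange's identity at \<open>c\<close> is exactly \<open>u c\<close>,
  which turns the identity into a Volterra equation.\<close>

lemma schrodinger_solution_free:
  assumes "l \<noteq> 0"
  shows "schrodinger_solution (\<lambda>_. 0) (l\<^sup>2) (\<lambda>t. sin (l * of_real (c - t)) / l) (\<lambda>t. - cos (l * of_real (c - t)))"
proof -
  have 0: "(\<lambda>_. 0 :: real) absolutely_integrable_on {0..pi}" by simp
  have 1: "has_ac_derivative (\<lambda>t. sin (l * of_real (c - t)) / l) (\<lambda>t. - cos (l * of_real (c - t)))"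
  proof (rule has_ac_derivative_C1)
    fix t
    have "((\<lambda>w. sin (l * (of_real c - w)) / l) has_field_derivative - cos (l * (of_real c - of_real t))) (at (of_real t))"
      using assms by (auto intro!: derivative_eq_intros)
    from has_vector_derivative_real_field[OF this, of "{0..pi}"]
    show "((\<lambda>t. sin (l * of_real (c - t)) / l) has_vector_derivative - cos (l * of_real (c - t))) (at t within {0..pi})"
      by simp
  qed (intro continuous_intros)
  have 2: "has_ac_derivative (\<lambda>t. - cos (l * of_real (c - t))) (\<lambda>t. (of_real 0 - l\<^sup>2) * (sin (l * of_real (c - t)) / l))"
  proof (rule has_ac_derivative_C1)
    fix t
    have "((\<lambda>w. - cos (l * (of_real c - w))) has_field_derivative - l * sin (l * (of_real c - of_real t))) (at (of_real t))"
      by (auto intro!: derivative_eq_intros)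
    from has_vector_derivative_real_field[OF this, of "{0..pi}"]
    show "((\<lambda>t. - cos (l * of_real (c - t))) has_vector_derivative (of_real 0 - l\<^sup>2) * (sin (l * of_real (c - t)) / l)) (at t within {0..pi})"
      using assms by (simp add: power2_eq_square)
  qed (use assms in \<open>intro continuous_intros; simp\<close>)
  from 1 2 show ?thesis by (simp add: schrodinger_solution_iff[OF 0])
qed

text \<open>Both potential and parameter may differ. Equal data give the constancy of the Wronskian,
  different parameters give derivatives in \<open>z\<close> and the absence of nonreal eigenvalues,
  and a zero second potential gives the Volterra equations.\<close>

lemma lagrange_identity:
  assumes q: "q absolutely_integrable_on {0..pi}" and r: "r absolutely_integrable_on {0..pi}"
    and u: "schrodinger_solution q z u u'" and v: "schrodinger_solution r w v v'"
    and c: "0 \<le> c" "c \<le> d" "d \<le> pi"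
  shows "((\<lambda>t. ((of_real (q t) - z) - (of_real (r t) - w)) * (u t * v t)) has_integral
           ((u' d * v d - u d * v' d) - (u' c * v c - u c * v' c))) {c..d}"
proof -
  have u': "has_ac_derivative u u'" "has_ac_derivative u' (\<lambda>t. (of_real (q t) - z) * u t)"
    using u by (auto simp: schrodinger_solution_iff[OF q])
  have v': "has_ac_derivative v v'" "has_ac_derivative v' (\<lambda>t. (of_real (r t) - w) * v t)"
    using v by (auto simp: schrodinger_solution_iff[OF r])
  from has_ac_derivative_diff[OF has_ac_derivative_lincomb[OF has_ac_derivative_mult[OF u'(2) v'(1)]
      has_ac_derivative_mult[OF u'(1) v'(2)], of 1 "-1"] c]
  show ?thesis by (simp add: algebra_simps)
qed

context
  fixes q :: "real \<Rightarrow> real"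
  assumes q: "q absolutely_integrable_on {0..pi}"
begin

lemma wronskian_constant:
  assumes "schrodinger_solution q z u u'" "schrodinger_solution q z v v'" "x \<in> {0..pi}"
  shows "u' x * v x - u x * v' x = u' 0 * v 0 - u 0 * v' 0"
proof -
  have "((\<lambda>_. 0) has_integral ((u' x * v x - u x * v' x) - (u' 0 * v 0 - u 0 * v' 0))) {0..x}"
    using lagrange_identity[OF q q assms(1,2), of 0 x] assms(3) by simp
  then show ?thesis using has_integral_unique[OF has_integral_0] by fastforce
qed

lemma wronskian_phi_theta:
  assumes "x \<in> {0..pi}"
  shows "theta q x z * phi' q x z - theta' q x z * phi q x z = 1"
  using wronskian_constant[OF ivp_solution[OF q, of z 0 1] ivp_solution[OF q, of z 1 0] assms]
  by (simp add: ivp_0[OF q] algebra_simps)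

text \<open>Cramer's rule: the constant Wronskians of \<open>u\<close> with \<open>phi\<close> and
  \<open>theta\<close> are two linear equations whose determinant is the Wronskian 1 of
  \<open>phi\<close> and \<open>theta\<close>. This contains uniqueness for the initial value
  problem.\<close>

lemma solution_eq_lincomb:
  assumes "schrodinger_solution q z u u'" "x \<in> {0..pi}"
  shows "u x = u 0 * theta q x z + u' 0 * phi q x z"
proof -
  have "u' x * phi q x z - u x * phi' q x z = - u 0"
    using wronskian_constant[OF assms(1) ivp_solution[OF q, of z 0 1] assms(2)] by (simp add: ivp_0[OF q])
  moreover have "u' x * theta q x z - u x * theta' q x z = u' 0"
    using wronskian_constant[OF assms(1) ivp_solution[OF q, of z 1 0] assms(2)] by (simp add: ivp_0[OF q])
  ultimately show ?thesis
    using wronskian_phi_theta[OF assms(2), of z] by algebra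
qed

lemma schrodinger_solution_lincomb:
  assumes "schrodinger_solution q z u u'" "schrodinger_solution q z v v'"
  shows "schrodinger_solution q z (\<lambda>x. c * u x + d * v x) (\<lambda>x. c * u' x + d * v' x)"
  using assms has_ac_derivative_lincomb[of u u' v v' c d] 
    has_ac_derivative_lincomb[of u' "\<lambda>t. (of_real (q t) - z) * u t" v' "\<lambda>t. (of_real (q t) - z) * v t" c d]
  by (simp add: schrodinger_solution_iff[OF q] algebra_simps)

lemma schrodinger_solution_cnj:
  assumes "schrodinger_solution q z u u'"
  shows "schrodinger_solution q (cnj z) (\<lambda>x. cnj (u x)) (\<lambda>x. cnj (u' x))"
  using assms has_ac_derivative_cnj[of u u'] has_ac_derivative_cnj[of u' "\<lambda>t. (of_real (q t) - z) * u t"]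
  by (simp add: schrodinger_solution_iff[OF q])

lemma ivp_cnj:
  assumes "x \<in> {0..pi}"
  shows "cnj (ivp q \<alpha> \<beta> x z) = ivp q (cnj \<alpha>) (cnj \<beta>) x (cnj z)"
  using solution_eq_lincomb[OF schrodinger_solution_cnj[OF ivp_solution[OF q, of z \<alpha> \<beta>]] assms]
    solution_eq_lincomb[OF ivp_solution[OF q, of "cnj z" "cnj \<alpha>" "cnj \<beta>"] assms]
  by (simp add: ivp_0[OF q])

lemma solution_zero_imp_derivative_zero:
  assumes u: "schrodinger_solution q z u u'" and "0 < c" "c \<le> pi" and 0: "\<And>x. x \<in> {0..c} \<Longrightarrow> u x = 0"
  shows "u' 0 = 0"
proof -
  have u': "has_ac_derivative u u'" "has_ac_derivative u' (\<lambda>t. (of_real (q t) - z) * u t)"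
    using u by (auto simp: schrodinger_solution_iff[OF q])
  have "continuous_on {0..c} u'"
    using has_ac_derivative_continuous[OF u'(2)] by (rule continuous_on_subset) (use assms in auto)
  then have "((\<lambda>x. integral {0..x} u') has_vector_derivative u' 0) (at 0 within {0..c})"
    by (rule integral_has_vector_derivative) (use assms in auto)
  moreover have "integral {0..x} u' = 0" if "x \<in> {0..c}" for x
  proof -
    have "(u' has_integral u x - u 0) {0..x}" using u'(1) that assms(2,3) by (simp add: has_ac_derivative_def)
    moreover have "u x = 0" "u 0 = 0" using 0[of x] 0[of 0] that assms(2) by auto
    ultimately show ?thesis by (simp add: integral_unique)
  qed
  then have "((\<lambda>x. integral {0..x} u') has_vector_derivative 0) (at 0 within {0..c})"
    by (intro has_vector_derivative_transform[OF _ _ has_vector_derivative_const[of 0]]) (use assms in auto)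
  ultimately show ?thesis
    using assms by (intro vector_derivative_unique_within[of 0 "{0..c}"]) (auto simp: trivial_limit_within islimpt_Icc)
qed

lemma phi_not_vanishing:
  assumes "0 < c" "c \<le> pi"
  shows "\<exists>x\<in>{0..c}. phi q x z \<noteq> 0"
proof (rule ccontr)
  assume "\<not> ?thesis"
  then have "phi' q 0 z = 0"
    by (intro solution_zero_imp_derivative_zero[OF ivp_solution[OF q, of z 0 1] assms]) auto
  then show False by (simp add: ivp_0[OF q])
qed

lemma dirichlet_dirichlet_spectrum_iff: "z \<in> dirichlet_dirichlet_spectrum q \<longleftrightarrow> phi q pi z = 0"
proof
  assume "z \<in> dirichlet_dirichlet_spectrum q"
  then obtain u u' x where u: "schrodinger_solution q z u u'" "u 0 = 0" "u pi = 0" "x \<in> {0..pi}" "u x \<noteq> 0"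
    by (auto simp: dirichlet_dirichlet_spectrum_def)
  from solution_eq_lincomb[OF u(1) u(4)] solution_eq_lincomb[OF u(1), of pi] u show "phi q pi z = 0" by auto
next
  assume "phi q pi z = 0"
  then show "z \<in> dirichlet_dirichlet_spectrum q"
    using ivp_solution[OF q, of z 0 1] ivp_0[OF q, of 0 1] phi_not_vanishing[of pi z]
    unfolding dirichlet_dirichlet_spectrum_def by auto
qed

lemma neumann_dirichlet_spectrum_iff: "z \<in> neumann_dirichlet_spectrum q \<longleftrightarrow> theta q pi z = 0"
proof
  assume "z \<in> neumann_dirichlet_spectrum q"
  then obtain u u' x where u: "schrodinger_solution q z u u'" "u' 0 = 0" "u pi = 0" "x \<in> {0..pi}" "u x \<noteq> 0"
    by (auto simp: neumann_dirichlet_spectrum_def)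
  from solution_eq_lincomb[OF u(1) u(4)] solution_eq_lincomb[OF u(1), of pi] u show "theta q pi z = 0" by auto
next
  assume "theta q pi z = 0"
  then show "z \<in> neumann_dirichlet_spectrum q"
    using ivp_solution[OF q, of z 1 0] ivp_0[OF q, of 1 0]
    unfolding neumann_dirichlet_spectrum_def
    by (intro CollectI exI[of _ "\<lambda>x. theta q x z"] exI[of _ "\<lambda>x. theta' q x z"])
       (auto intro!: bexI[of _ 0] simp: ivp_0[OF q])
qed

section \<open>Derivatives in the spectral parameter, norming constants and simple zeros\<close>

lemma ivp_continuous_slice: "continuous_on {0..pi} (\<lambda>x. ivp q \<alpha> \<beta> x z)"
  using ivp_solution[OF q, of z \<alpha> \<beta>] has_ac_derivative_continuous[of _ "\<lambda>x. ivp' q \<alpha> \<beta> x z"]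
  by (simp add: schrodinger_solution_iff[OF q])

text \<open>Lagrange's identity for the parameters \<open>z\<close> and \<open>a\<close> has no
  boundary term at 0, because both solutions share their initial values. It thus writes the
  difference quotient of the end value, times the end derivative at \<open>a\<close>, as an integral
  of the product of the two solutions; then \<open>z\<close> tends to \<open>a\<close>. For real
  data the integral is positive, which makes the zeros simple.\<close>

lemma ivp_deriv_at_zero:
  assumes "ivp q \<alpha> \<beta> pi a = 0"
  shows "deriv (ivp q \<alpha> \<beta> pi) a * ivp' q \<alpha> \<beta> pi a = integral {0..pi} (\<lambda>t. (ivp q \<alpha> \<beta> t a)\<^sup>2)"
proof -
  define u where "u = ivp q \<alpha> \<beta>"
  have "u pi field_differentiable at a"
    unfolding u_def using ivp_holomorphic[OF q, of pi \<alpha> \<beta>] holomorphic_on_imp_differentiable_at by auto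
  then have "((\<lambda>z. (u pi z - u pi a) / (z - a)) \<longlongrightarrow> deriv (u pi) a) (at a)"
    using field_differentiable_derivI has_field_derivative_iff by blast
  then have "((\<lambda>z. (u pi z - u pi a) / (z - a) * ivp' q \<alpha> \<beta> pi a) \<longlongrightarrow> deriv (u pi) a * ivp' q \<alpha> \<beta> pi a) (at a)"
    by (intro tendsto_mult tendsto_const)
  moreover have "\<forall>\<^sub>F z in at a. (u pi z - u pi a) / (z - a) * ivp' q \<alpha> \<beta> pi a = integral {0..pi} (\<lambda>t. u t z * u t a)"
    unfolding eventually_at_filter
  proof (intro always_eventually allI impI)
    fix z assume "z \<noteq> a"
    from lagrange_identity[OF q q ivp_solution[OF q, of z \<alpha> \<beta>] ivp_solution[OF q, of a \<alpha> \<beta>], of 0 pi]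
    have "((\<lambda>t. (a - z) * (u t z * u t a)) has_integral - (u pi z * ivp' q \<alpha> \<beta> pi a)) {0..pi}"
      using assms by (simp add: ivp_0[OF q] u_def mult.commute)
    then have "(a - z) * integral {0..pi} (\<lambda>t. u t z * u t a) = - (u pi z * ivp' q \<alpha> \<beta> pi a)"
      by (simp add: has_integral_iff)
    then show "(u pi z - u pi a) / (z - a) * ivp' q \<alpha> \<beta> pi a = integral {0..pi} (\<lambda>t. u t z * u t a)"
      using \<open>z \<noteq> a\<close> assms by (simp add: field_simps u_def)
  qed
  ultimately have "((\<lambda>z. integral {0..pi} (\<lambda>t. u t z * u t a)) \<longlongrightarrow> deriv (u pi) a * ivp' q \<alpha> \<beta> pi a) (at a)"
    using tendsto_cong by fast
  moreover have "((\<lambda>z. integral {0..pi} (\<lambda>t. u t z * u t a)) \<longlongrightarrow> integral {0..pi} (\<lambda>t. u t a * u t a)) (at a)"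
  proof -
    have "continuous_on (cball 0 (norm a + 1) \<times> {0..pi}) (\<lambda>p. case (snd p, fst p) of (x, z) \<Rightarrow> u x z)"
      unfolding u_def
      by (rule continuous_on_compose2[OF ivp_continuous[OF q, of "norm a + 1"]]) (auto intro!: continuous_intros)
    moreover have "continuous_on (cball 0 (norm a + 1) \<times> {0..pi}) (\<lambda>p. u (snd p) a)"
      unfolding u_def by (rule continuous_on_compose2[OF ivp_continuous_slice]) (auto intro!: continuous_intros)
    ultimately have "continuous_on (cball 0 (norm a + 1) \<times> cbox 0 pi) (\<lambda>(z, t). u t z * u t a)"
      unfolding case_prod_unfold cbox_interval fst_conv snd_conv by (intro continuous_on_mult)
    from integral_continuous_on_param[OF this]
    have "continuous_on (cball 0 (norm a + 1)) (\<lambda>z. integral {0..pi} (\<lambda>t. u t z * u t a))" by simp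
    then have "continuous (at a) (\<lambda>z. integral {0..pi} (\<lambda>t. u t z * u t a))"
      by (rule continuous_on_interior) (auto simp: interior_cball)
    then show ?thesis by (simp add: continuous_at)
  qed
  ultimately show ?thesis
    using tendsto_unique[OF trivial_limit_at] by (fastforce simp: u_def power2_eq_square)
qed

lemma integral_ivp_square:
  fixes \<alpha> \<beta> a :: real
  shows "integral {0..pi} (\<lambda>t. (ivp q \<alpha> \<beta> t a)\<^sup>2) = of_real (integral {0..pi} (\<lambda>t. (norm (ivp q \<alpha> \<beta> t a))\<^sup>2))"
proof -
  have "(ivp q \<alpha> \<beta> t a)\<^sup>2 = complex_of_real ((norm (ivp q \<alpha> \<beta> t a))\<^sup>2)" if "t \<in> {0..pi}" for t
    using ivp_cnj[OF that, of \<alpha> \<beta> a] complex_norm_square[of "ivp q \<alpha> \<beta> t a"] by (simp add: power2_eq_square)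
  then have "integral {0..pi} (\<lambda>t. (ivp q \<alpha> \<beta> t a)\<^sup>2) = integral {0..pi} (\<lambda>t. complex_of_real ((norm (ivp q \<alpha> \<beta> t a))\<^sup>2))"
    by (rule integral_cong)
  also have "\<dots> = of_real (integral {0..pi} (\<lambda>t. (norm (ivp q \<alpha> \<beta> t a))\<^sup>2))"
    by (intro integral_of_real_complex integrable_continuous_real continuous_intros ivp_continuous_slice)
  finally show ?thesis .
qed

lemma integral_ivp_pos:
  assumes "\<exists>x\<in>{0..c}. ivp q \<alpha> \<beta> x a \<noteq> 0" "0 < c" "c \<le> pi"
  shows "integral {0..c} (\<lambda>t. (norm (ivp q \<alpha> \<beta> t a))\<^sup>2) > 0"
proof -
  have c: "continuous_on {0..c} (\<lambda>t. (norm (ivp q \<alpha> \<beta> t a))\<^sup>2)"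
    using assms by (intro continuous_intros continuous_on_subset[OF ivp_continuous_slice]) auto
  have "integral {0..c} (\<lambda>t. (norm (ivp q \<alpha> \<beta> t a))\<^sup>2) \<ge> 0"
    by (intro integral_nonneg integrable_continuous_real c) auto
  moreover have "integral {0..c} (\<lambda>t. (norm (ivp q \<alpha> \<beta> t a))\<^sup>2) \<noteq> 0"
    using integral_eq_0_iff[OF c] assms by auto
  ultimately show ?thesis by simp
qed

text \<open>At \<open>a\<close> the Wronskian reduces to \<open>theta * phi' = 1\<close>, while the
  parameter derivative of \<open>phi\<close> times \<open>phi'\<close> is the integral of
  \<open>phi^2\<close>, that is \<open>1 / \<gamma>\<close>. Eliminating \<open>phi'\<close> gives
  the residue \<open>- \<gamma>\<close> of the Weyl function, the form in which the masses enter the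
  main argument.\<close>

lemma theta_eq_point_mass_mult_deriv_phi:
  assumes "phi q pi (of_real a) = 0" "point_mass q a \<gamma>"
  shows "deriv (phi q pi) (of_real a) \<noteq> 0" "theta q pi (of_real a) = of_real \<gamma> * deriv (phi q pi) (of_real a)"
proof -
  define I where "I = integral {0..pi} (\<lambda>t. (norm (phi q t a))\<^sup>2)"
  have I: "I > 0" unfolding I_def by (intro integral_ivp_pos phi_not_vanishing) auto
  have 1: "deriv (phi q pi) a * phi' q pi a = of_real I"
    using ivp_deriv_at_zero[OF assms(1)] integral_ivp_square[of 0 1 a] by (simp add: I_def)
  then show "deriv (phi q pi) (of_real a) \<noteq> 0" using I by auto
  have 2: "theta q pi a * phi' q pi a = 1"
    using wronskian_phi_theta[of pi "of_real a"] assms(1) by simp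
  obtain s s' where s: "schrodinger_solution q (of_real a) s s'" "s 0 = 0" "s' 0 = 1"
    "\<gamma> = inverse (integral {0..pi} (\<lambda>t. (norm (s t))\<^sup>2))"
    using assms(2) by (auto simp: point_mass_def)
  have "integral {0..pi} (\<lambda>t. (norm (s t))\<^sup>2) = I"
    unfolding I_def using solution_eq_lincomb[OF s(1)] s(2,3) by (intro integral_cong) simp
  then have "\<gamma> * I = 1" using s(4) I by simp
  then have "of_real \<gamma> * of_real I = (1 :: complex)"
    by (simp flip: of_real_mult)
  then show "theta q pi (of_real a) = of_real \<gamma> * deriv (phi q pi) (of_real a)"
    using 1 2 by algebra
qed

lemma deriv_theta_nonzero:
  assumes "theta q pi (of_real b) = 0"
  shows "deriv (theta q pi) (of_real b) \<noteq> 0"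
proof -
  have "integral {0..pi} (\<lambda>t. (norm (theta q t b))\<^sup>2) > 0"
    by (intro integral_ivp_pos bexI[of _ 0]) (auto simp: ivp_0[OF q])
  moreover have "deriv (theta q pi) b * theta' q pi b = of_real (integral {0..pi} (\<lambda>t. (norm (theta q t b))\<^sup>2))"
    using ivp_deriv_at_zero[OF assms] integral_ivp_square[of 1 0 b] by simp
  ultimately show ?thesis by auto
qed

text \<open>Otherwise \<open>z\<close> would be a nonreal Dirichlet eigenvalue of the self-adjoint
  problem on \<open>{0..x}\<close>: Lagrange's identity for \<open>z\<close> and
  \<open>cnj z\<close> would make the integral of the squared modulus of \<open>phi\<close>
  vanish.\<close>

lemma phi_nonzero_nonreal:
  assumes "0 < x" "x \<le> pi" "Im z \<noteq> 0"
  shows "phi q x z \<noteq> 0"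
proof
  assume 0: "phi q x z = 0"
  then have zc: "phi q x (cnj z) = 0" using ivp_cnj[of x 0 1 z] assms by simp
  have "((\<lambda>t. (cnj z - z) * (phi q t z * phi q t (cnj z))) has_integral 0) {0..x}"
    using lagrange_identity[OF q q ivp_solution[OF q, of z 0 1] ivp_solution[OF q, of "cnj z" 0 1], of 0 x] assms 0 zc
    by (simp add: ivp_0[OF q])
  then have "(cnj z - z) * integral {0..x} (\<lambda>t. phi q t z * phi q t (cnj z)) = 0"
    by (simp add: has_integral_iff)
  moreover have "integral {0..x} (\<lambda>t. phi q t z * phi q t (cnj z)) = integral {0..x} (\<lambda>t. complex_of_real ((norm (phi q t z))\<^sup>2))"
  proof (intro integral_cong)
    fix t assume "t \<in> {0..x}"
    then show "phi q t z * phi q t (cnj z) = complex_of_real ((norm (phi q t z))\<^sup>2)"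
      using ivp_cnj[of t 0 1 z] assms complex_norm_square[of "phi q t z"] by simp
  qed
  moreover have "integral {0..x} (\<lambda>t. complex_of_real ((norm (phi q t z))\<^sup>2)) = of_real (integral {0..x} (\<lambda>t. (norm (phi q t z))\<^sup>2))"
    using assms by (intro integral_of_real_complex integrable_continuous_real continuous_intros continuous_on_subset[OF ivp_continuous_slice]) auto
  moreover have "cnj z - z \<noteq> 0" using assms by (auto simp: complex_eq_iff)
  ultimately show False
    using integral_ivp_pos[OF phi_not_vanishing, of x z] assms by auto
qed

end

section \<open>Solutions at large spectral parameter\<close>

lemma norm_sin_cos_le_exp_Im:
  fixes z :: complex
  shows "norm (sin z) \<le> exp \<bar>Im z\<bar>" "norm (cos z) \<le> exp \<bar>Im z\<bar>"
proof -
  have e: "norm (exp (\<i> * z)) \<le> exp \<bar>Im z\<bar>" "norm (exp (- (\<i> * z))) \<le> exp \<bar>Im z\<bar>"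
    by (simp_all add: norm_exp_eq_Re)
  have avg: "x \<le> (a + b) / 2 \<Longrightarrow> a \<le> c \<Longrightarrow> b \<le> c \<Longrightarrow> x \<le> c" for x a b c :: real
    by (simp add: field_simps)
  have "norm (sin z) = norm (exp (\<i> * z) - exp (- (\<i> * z))) / 2"
    by (simp add: sin_exp_eq norm_divide norm_mult)
  also have "\<dots> \<le> (norm (exp (\<i> * z)) + norm (exp (- (\<i> * z)))) / 2"
    by (intro divide_right_mono norm_triangle_ineq4) simp
  finally show "norm (sin z) \<le> exp \<bar>Im z\<bar>" using e by (rule avg)
  have "norm (cos z) = norm (exp (\<i> * z) + exp (- (\<i> * z))) / 2"
    by (simp add: cos_exp_eq norm_divide)
  also have "\<dots> \<le> (norm (exp (\<i> * z)) + norm (exp (- (\<i> * z)))) / 2"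
    by (intro divide_right_mono norm_triangle_ineq) simp
  finally show "norm (cos z) \<le> exp \<bar>Im z\<bar>" using e by (rule avg)
qed

lemma mult_exp_minus_le_iff: "r * exp (- y) \<le> M \<longleftrightarrow> r \<le> M * exp (y :: real)"
  by (simp add: exp_minus pos_divide_le_eq flip: divide_inverse)

text \<open>By compactness the maximum of \<open>h\<close> is attained, so it may be inserted for
  \<open>M\<close> and half of it absorbed on the left.\<close>

lemma continuous_on_self_bound:
  fixes h :: "real \<Rightarrow> real"
  assumes c: "continuous_on {0..pi} h"
    and h: "\<And>M x. \<lbrakk>\<And>t. t \<in> {0..pi} \<Longrightarrow> h t \<le> M; x \<in> {0..pi}\<rbrakk> \<Longrightarrow> h x \<le> A + M / 2"
    and x: "x \<in> {0..pi}"
  shows "h x \<le> 2 * A"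
proof -
  obtain t0 where t0: "t0 \<in> {0..pi}" "\<And>t. t \<in> {0..pi} \<Longrightarrow> h t \<le> h t0"
    using continuous_attains_sup[OF compact_Icc _ c] by auto
  have "h t0 \<le> A + h t0 / 2" by (rule h) (use t0 in auto)
  with t0(2)[OF x] show ?thesis by simp
qed

text \<open>The left side is the integrand exactly as \<open>lagrange_identity\<close> produces it
  against the zero potential. The exponent \<open>a\<close> of \<open>u\<close> and the growth of
  the sine over the distance \<open>\<bar>s\<bar>\<close> add up to \<open>b\<close>, which in the
  applications does not depend on the integration variable.\<close>

lemma norm_mult_free_le:
  assumes "norm u \<le> M * exp a" "\<bar>Im l\<bar> * \<bar>s\<bar> + a = b" "l \<noteq> 0" "M \<ge> 0"
  shows "norm ((of_real (q t) - l\<^sup>2 - (of_real 0 - l\<^sup>2)) * (u * (sin (l * of_real s) / l))) \<le> \<bar>q t\<bar> * (M * exp b / norm l)"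
proof -
  have "norm (sin (l * of_real s)) \<le> exp (\<bar>Im l\<bar> * \<bar>s\<bar>)"
    using norm_sin_cos_le_exp_Im(1)[of "l * of_real s"] by (simp add: abs_mult)
  then have "norm u * norm (sin (l * of_real s)) \<le> (M * exp a) * exp (\<bar>Im l\<bar> * \<bar>s\<bar>)"
    using assms by (intro mult_mono) auto
  also have "\<dots> = M * exp b" using assms(2) by (simp add: exp_add[symmetric] add.commute)
  finally have "\<bar>q t\<bar> * (norm u * norm (sin (l * of_real s)) / norm l) \<le> \<bar>q t\<bar> * (M * exp b / norm l)"
    by (intro mult_left_mono divide_right_mono) auto
  then show ?thesis by (simp add: norm_mult norm_divide)
qed

section \<open>Comparison with the free equation\<close>

lemma zero_potential_integrable: "(\<lambda>_. 0 :: real) absolutely_integrable_on {0..pi}"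
  by simp

definition potential_norm :: "(real \<Rightarrow> real) \<Rightarrow> real" where
  "potential_norm q = integral {0..pi} (\<lambda>t. \<bar>q t\<bar>)"

context
  fixes q :: "real \<Rightarrow> real"
  assumes q: "q absolutely_integrable_on {0..pi}"
begin

lemma integrable_abs_potential:
  assumes "0 \<le> c" "d \<le> pi"
  shows "(\<lambda>t. \<bar>q t\<bar>) integrable_on {c..d}"
  using absolutely_integrable_imp_integrable_on_subinterval[OF set_integrable_abs[OF q] assms] .

lemma potential_norm_nonneg: "potential_norm q \<ge> 0"
  unfolding potential_norm_def by (intro integral_nonneg integrable_abs_potential) auto

lemma norm_has_integral_potential_le:
  fixes w :: "real \<Rightarrow> complex"
  assumes w: "(w has_integral I) {c..d}" and cd: "0 \<le> c" "d \<le> pi" and C: "0 \<le> C"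
    and le: "\<And>t. t \<in> {c..d} \<Longrightarrow> norm (w t) \<le> \<bar>q t\<bar> * C"
  shows "norm I \<le> potential_norm q * C"
proof -
  note i = integrable_abs_potential[OF cd]
  have "norm (integral {c..d} w) \<le> integral {c..d} (\<lambda>t. \<bar>q t\<bar> * C)"
    using w le by (intro integral_norm_bound_integral integrable_on_mult_left i) auto
  also have "\<dots> = integral {c..d} (\<lambda>t. \<bar>q t\<bar>) * C" by simp
  also have "\<dots> \<le> potential_norm q * C"
    unfolding potential_norm_def using cd
    by (intro mult_right_mono C integral_subset_le i integrable_abs_potential) auto
  finally show ?thesis using w by (simp add: integral_unique)
qed

text \<open>Lagrange's identity against the free solution that vanishes at \<open>x\<close> is the Volterra equation
  \<open>u(x) = u\<^sub>0(x) + \<integral>\<^sub>0\<^sup>x sin(l (x - t)) / l q(t) u(t) dt\<close>, a contraction with factor \<open>1/2\<close> in the sup norm weighted by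
  \<open>exp (- \<bar>Im l\<bar> x)\<close>.\<close>

lemma solution_near_free:
  assumes u: "schrodinger_solution q (l\<^sup>2) u u'" and l: "l \<noteq> 0" "2 * potential_norm q \<le> norm l"
    and A: "\<And>x. x \<in> {0..pi} \<Longrightarrow> norm (u' 0 * sin (l * of_real x) / l + u 0 * cos (l * of_real x)) \<le> A * exp (\<bar>Im l\<bar> * x)"
    and x: "x \<in> {0..pi}"
  shows "norm (u x) \<le> 2 * A * exp (\<bar>Im l\<bar> * x)"
    and "norm (u x - (u' 0 * sin (l * of_real x) / l + u 0 * cos (l * of_real x)))
           \<le> 2 * A * potential_norm q / norm l * exp (\<bar>Im l\<bar> * x)"
proof -
  define Y where "Y = \<bar>Im l\<bar>"
  define free where "free = (\<lambda>x. u' 0 * sin (l * of_real x) / l + u 0 * cos (l * of_real x))"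
  define h where "h = (\<lambda>x. norm (u x) * exp (- (Y * x)))"
  have hu: "norm (u x) \<le> M * exp (Y * x) \<longleftrightarrow> h x \<le> M" for x M
    by (simp only: h_def mult_exp_minus_le_iff)
  have diff: "norm (u x - free x) \<le> potential_norm q * (M * exp (Y * x) / norm l)"
    if M: "\<And>t. t \<in> {0..pi} \<Longrightarrow> h t \<le> M" and x: "x \<in> {0..pi}" for M x
  proof (rule norm_has_integral_potential_le)
    have "h 0 \<ge> 0" by (simp add: h_def)
    then have M0: "M \<ge> 0" using M[of 0] by simp
    show "((\<lambda>t. (of_real (q t) - l\<^sup>2 - (of_real 0 - l\<^sup>2)) * (u t * (sin (l * of_real (x - t)) / l))) has_integral (u x - free x)) {0..x}"
      using lagrange_identity[OF q zero_potential_integrable u schrodinger_solution_free[OF l(1), of x], of 0 x] x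
      by (simp add: free_def)
    show "0 \<le> M * exp (Y * x) / norm l" using M0 by simp
    fix t assume t: "t \<in> {0..x}"
    show "norm ((of_real (q t) - l\<^sup>2 - (of_real 0 - l\<^sup>2)) * (u t * (sin (l * of_real (x - t)) / l))) \<le> \<bar>q t\<bar> * (M * exp (Y * x) / norm l)"
      using t x M[of t] M0 l hu[of t M] by (intro norm_mult_free_le[where a = "Y * t"]) (auto simp: Y_def algebra_simps)
  qed (use x in auto)
  have cu: "continuous_on {0..pi} u"
    using u has_ac_derivative_continuous by (auto simp: schrodinger_solution_def)
  have 2: "h x \<le> 2 * A" if "x \<in> {0..pi}" for x
  proof (rule continuous_on_self_bound[OF _ _ that])
    show "continuous_on {0..pi} h"
      unfolding h_def by (intro continuous_intros cu)
    fix M x assume M: "\<And>t. t \<in> {0..pi} \<Longrightarrow> h t \<le> M" and x: "x \<in> {0..pi}"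
    have "h 0 \<ge> 0" by (simp add: h_def)
    then have M0: "M \<ge> 0" using M[of 0] by simp
    have "potential_norm q * (M * exp (Y * x) / norm l) = (potential_norm q / norm l) * (M * exp (Y * x))"
      by simp
    also have "\<dots> \<le> 1 / 2 * (M * exp (Y * x))"
      using l M0 by (intro mult_right_mono) (auto simp: field_simps)
    finally have le: "potential_norm q * (M * exp (Y * x) / norm l) \<le> 1 / 2 * (M * exp (Y * x))" .
    have "norm (free x) \<le> A * exp (Y * x)" using A[OF x] by (simp only: free_def Y_def)
    then have "norm (u x) \<le> A * exp (Y * x) + 1 / 2 * (M * exp (Y * x))"
      using diff[OF M x] le norm_triangle_sub[of "u x" "free x"] by linarith
    then show "h x \<le> A + M / 2" by (simp add: algebra_simps flip: hu)
  qed
  show "norm (u x) \<le> 2 * A * exp (\<bar>Im l\<bar> * x)"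
    using 2[OF x] by (simp add: Y_def flip: hu)
  show "norm (u x - (u' 0 * sin (l * of_real x) / l + u 0 * cos (l * of_real x)))
           \<le> 2 * A * potential_norm q / norm l * exp (\<bar>Im l\<bar> * x)"
    using diff[OF 2 x] by (simp add: free_def Y_def mult_ac)
qed

lemma phi_near_free:
  assumes l: "l \<noteq> 0" "2 * potential_norm q \<le> norm l" and x: "x \<in> {0..pi}"
  shows "norm (phi q x (l\<^sup>2)) \<le> 2 / norm l * exp (\<bar>Im l\<bar> * x)"
    and "norm (phi q x (l\<^sup>2) - sin (l * of_real x) / l) \<le> 2 * potential_norm q / (norm l)\<^sup>2 * exp (\<bar>Im l\<bar> * x)"
proof -
  have A: "norm (phi' q 0 (l\<^sup>2) * sin (l * of_real x) / l + phi q 0 (l\<^sup>2) * cos (l * of_real x)) \<le> 1 / norm l * exp (\<bar>Im l\<bar> * x)"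
    if "x \<in> {0..pi}" for x
    using norm_sin_cos_le_exp_Im(1)[of "l * of_real x"] that
    by (simp add: ivp_0[OF q] norm_divide abs_mult divide_right_mono)
  from solution_near_free[OF ivp_solution[OF q] l A x]
  show "norm (phi q x (l\<^sup>2)) \<le> 2 / norm l * exp (\<bar>Im l\<bar> * x)"
    "norm (phi q x (l\<^sup>2) - sin (l * of_real x) / l) \<le> 2 * potential_norm q / (norm l)\<^sup>2 * exp (\<bar>Im l\<bar> * x)"
    by (simp_all add: ivp_0[OF q] power2_eq_square)
qed

lemma theta_near_free:
  assumes l: "l \<noteq> 0" "2 * potential_norm q \<le> norm l" and x: "x \<in> {0..pi}"
  shows "norm (theta q x (l\<^sup>2)) \<le> 2 * exp (\<bar>Im l\<bar> * x)"
    and "norm (theta q x (l\<^sup>2) - cos (l * of_real x)) \<le> 2 * potential_norm q / norm l * exp (\<bar>Im l\<bar> * x)"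
proof -
  have A: "norm (theta' q 0 (l\<^sup>2) * sin (l * of_real x) / l + theta q 0 (l\<^sup>2) * cos (l * of_real x)) \<le> 1 * exp (\<bar>Im l\<bar> * x)"
    if "x \<in> {0..pi}" for x
    using norm_sin_cos_le_exp_Im(2)[of "l * of_real x"] that by (simp add: ivp_0[OF q] abs_mult)
  from solution_near_free[OF ivp_solution[OF q] l A x]
  show "norm (theta q x (l\<^sup>2)) \<le> 2 * exp (\<bar>Im l\<bar> * x)"
    "norm (theta q x (l\<^sup>2) - cos (l * of_real x)) \<le> 2 * potential_norm q / norm l * exp (\<bar>Im l\<bar> * x)"
    by (simp_all add: ivp_0[OF q])
qed

text \<open>Bounding the two products separately would give an exponent with \<open>pi + x\<close>.
  Their combination vanishes at \<open>pi\<close> with derivative -1 there, so the Volterra argument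
  is run backwards from \<open>pi\<close>, with the weight
  \<open>exp (- \<bar>Im l\<bar> * (pi - x))\<close>.\<close>

lemma weyl_solution_bound:
  assumes l: "l \<noteq> 0" "2 * potential_norm q \<le> norm l" and x: "x \<in> {0..pi}"
  shows "norm (phi q pi (l\<^sup>2) * theta q x (l\<^sup>2) - theta q pi (l\<^sup>2) * phi q x (l\<^sup>2)) \<le> 2 / norm l * exp (\<bar>Im l\<bar> * (pi - x))"
proof -
  define Y where "Y = \<bar>Im l\<bar>"
  define v where "v = (\<lambda>x. phi q pi (l\<^sup>2) * theta q x (l\<^sup>2) + - theta q pi (l\<^sup>2) * phi q x (l\<^sup>2))"
  define v' where "v' = (\<lambda>x. phi q pi (l\<^sup>2) * theta' q x (l\<^sup>2) + - theta q pi (l\<^sup>2) * phi' q x (l\<^sup>2))"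
  have v: "schrodinger_solution q (l\<^sup>2) v v'"
    unfolding v_def v'_def by (intro schrodinger_solution_lincomb[OF q] ivp_solution[OF q])
  have vpi: "v pi = 0" "v' pi = - 1"
    using wronskian_phi_theta[OF q, of pi "l\<^sup>2"] by (simp_all add: v_def v'_def algebra_simps)
  define h where "h = (\<lambda>x. norm (v x) * exp (- (Y * (pi - x))))"
  have hv: "norm (v x) \<le> M * exp (Y * (pi - x)) \<longleftrightarrow> h x \<le> M" for x M
    by (simp only: h_def mult_exp_minus_le_iff)
  have diff: "norm (sin (l * of_real (pi - x)) / l - v x) \<le> potential_norm q * (M * exp (Y * (pi - x)) / norm l)"
    if M: "\<And>t. t \<in> {0..pi} \<Longrightarrow> h t \<le> M" and x: "x \<in> {0..pi}" for M x
  proof (rule norm_has_integral_potential_le)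
    have "h 0 \<ge> 0" by (simp add: h_def)
    then have M0: "M \<ge> 0" using M[of 0] by simp
    have "sin (l * of_real (x - pi)) = - sin (l * of_real (pi - x))"
      by (simp add: right_diff_distrib flip: sin_minus)
    then show "((\<lambda>t. (of_real (q t) - l\<^sup>2 - (of_real 0 - l\<^sup>2)) * (v t * (sin (l * of_real (x - t)) / l))) has_integral
        (sin (l * of_real (pi - x)) / l - v x)) {x..pi}"
      using lagrange_identity[OF q zero_potential_integrable v schrodinger_solution_free[OF l(1), of x], of x pi] x vpi
      by simp
    show "0 \<le> M * exp (Y * (pi - x)) / norm l" using M0 by simp
    fix t assume t: "t \<in> {x..pi}"
    show "norm ((of_real (q t) - l\<^sup>2 - (of_real 0 - l\<^sup>2)) * (v t * (sin (l * of_real (x - t)) / l))) \<le> \<bar>q t\<bar> * (M * exp (Y * (pi - x)) / norm l)"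
      using t x M[of t] M0 l hv[of t M] by (intro norm_mult_free_le[where a = "Y * (pi - t)"]) (auto simp: Y_def algebra_simps)
  qed (use x in auto)
  have cv: "continuous_on {0..pi} v"
    using v has_ac_derivative_continuous by (auto simp: schrodinger_solution_def)
  have "h x \<le> 2 * (1 / norm l)"
  proof (rule continuous_on_self_bound[OF _ _ x])
    show "continuous_on {0..pi} h"
      unfolding h_def by (intro continuous_intros cv)
    fix M x assume M: "\<And>t. t \<in> {0..pi} \<Longrightarrow> h t \<le> M" and x: "x \<in> {0..pi}"
    have "h 0 \<ge> 0" by (simp add: h_def)
    then have M0: "M \<ge> 0" using M[of 0] by simp
    have "potential_norm q * (M * exp (Y * (pi - x)) / norm l) = (potential_norm q / norm l) * (M * exp (Y * (pi - x)))"
      by simp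
    also have "\<dots> \<le> 1 / 2 * (M * exp (Y * (pi - x)))"
      using l M0 by (intro mult_right_mono) (auto simp: field_simps)
    finally have le: "potential_norm q * (M * exp (Y * (pi - x)) / norm l) \<le> 1 / 2 * (M * exp (Y * (pi - x)))" .
    have "norm (sin (l * of_real (pi - x)) / l) \<le> 1 / norm l * exp (Y * (pi - x))"
      using norm_sin_cos_le_exp_Im(1)[of "l * of_real (pi - x)"] x
      by (simp add: norm_divide abs_mult Y_def divide_right_mono)
    then have "norm (v x) \<le> 1 / norm l * exp (Y * (pi - x)) + 1 / 2 * (M * exp (Y * (pi - x)))"
      using diff[OF M x] le norm_triangle_sub[of "v x" "sin (l * of_real (pi - x)) / l"]
        norm_minus_commute[of "v x" "sin (l * of_real (pi - x)) / l"] by linarith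
    also have "\<dots> = (1 / norm l + M / 2) * exp (Y * (pi - x))" by (simp add: distrib_right)
    finally show "h x \<le> 1 / norm l + M / 2" by (simp only: hv)
  qed
  then have "norm (v x) \<le> 2 * (1 / norm l) * exp (Y * (pi - x))" by (simp only: hv)
  then show ?thesis by (simp add: v_def Y_def)
qed


text \<open>Order of growth at most 1/2 is the input for counting eigenvalues. From \<open>R\<close>
  on the free comparison applies and \<open>norm l\<close> is at least 1; the remaining disc is
  compact, and \<open>max \<bar>B\<bar> 2\<close> covers both regions.\<close>

lemma phi_theta_square_root_growth:
  "\<exists>C. \<forall>z. norm (phi q pi z) \<le> C * exp (pi * sqrt (norm z))"
  "\<exists>C. \<forall>z. norm (theta q pi z) \<le> C * exp (pi * sqrt (norm z))"
proof -
  define R where "R = 1 + 2 * potential_norm q"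
  have R: "R \<ge> 1" using potential_norm_nonneg by (simp add: R_def)
  have gen: "\<exists>C. \<forall>z. norm (F z) \<le> C * exp (pi * sqrt (norm z))"
    if F: "continuous_on UNIV F"
      and l: "\<And>l. norm l \<ge> R \<Longrightarrow> norm (F (l\<^sup>2)) \<le> 2 * exp (\<bar>Im l\<bar> * pi)" for F :: "complex \<Rightarrow> complex"
  proof -
    have "compact (F ` cball 0 (R\<^sup>2))"
      using F by (intro compact_continuous_image continuous_on_subset[OF F]) auto
    then have "bounded (F ` cball 0 (R\<^sup>2))" by (rule compact_imp_bounded)
    then obtain B where "\<forall>y\<in>F ` cball 0 (R\<^sup>2). norm y \<le> B" unfolding bounded_iff by blast
    then have B: "norm (F z) \<le> B" if "norm z \<le> R\<^sup>2" for z using that by auto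
    show ?thesis
    proof (intro exI allI)
      fix z :: complex
      have e: "1 \<le> exp (pi * sqrt (norm z))" by simp
      show "norm (F z) \<le> max \<bar>B\<bar> 2 * exp (pi * sqrt (norm z))"
      proof (cases "norm z \<le> R\<^sup>2")
        case True
        have "norm (F z) \<le> max \<bar>B\<bar> 2 * 1" using B[OF True] by simp
        also have "\<dots> \<le> max \<bar>B\<bar> 2 * exp (pi * sqrt (norm z))" using e by (intro mult_left_mono) auto
        finally show ?thesis .
      next
        case False
        define l where "l = csqrt z"
        have nl: "norm l = sqrt (norm z)"
          by (metis l_def norm_power power2_csqrt real_sqrt_abs abs_norm_cancel)
        have "sqrt (norm z) \<ge> sqrt (R\<^sup>2)" using False by (intro real_sqrt_le_mono) simp
        then have "norm l \<ge> R" using nl R by simp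
        from l[OF this] have "norm (F z) \<le> 2 * exp (\<bar>Im l\<bar> * pi)" by (simp add: l_def)
        also have "\<dots> \<le> max \<bar>B\<bar> 2 * exp (pi * sqrt (norm z))"
          using abs_Im_le_cmod[of l] nl by (intro mult_mono) (auto simp: mult.commute)
        finally show ?thesis .
      qed
    qed
  qed
  have pr: "l \<noteq> 0" "2 * potential_norm q \<le> norm l" "1 \<le> norm l" if "norm l \<ge> R" for l :: complex
    using that R potential_norm_nonneg by (auto simp: R_def)
  show "\<exists>C. \<forall>z. norm (phi q pi z) \<le> C * exp (pi * sqrt (norm z))"
  proof (rule gen)
    show "continuous_on UNIV (phi q pi)" using ivp_holomorphic[OF q, of pi] holomorphic_on_imp_continuous_on by auto
    fix l :: complex assume l: "R \<le> norm l"
    have "norm (phi q pi (l\<^sup>2)) \<le> 2 / norm l * exp (\<bar>Im l\<bar> * pi)"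
      using phi_near_free(1)[OF pr(1,2)[OF l], of pi] by simp
    also have "\<dots> \<le> 2 * exp (\<bar>Im l\<bar> * pi)"
      using pr(3)[OF l] by (intro mult_right_mono) (auto simp: divide_le_eq)
    finally show "norm (phi q pi (l\<^sup>2)) \<le> 2 * exp (\<bar>Im l\<bar> * pi)" .
  qed
  show "\<exists>C. \<forall>z. norm (theta q pi z) \<le> C * exp (pi * sqrt (norm z))"
  proof (rule gen)
    show "continuous_on UNIV (theta q pi)" using ivp_holomorphic[OF q, of pi] holomorphic_on_imp_continuous_on by auto
    fix l :: complex assume l: "R \<le> norm l"
    show "norm (theta q pi (l\<^sup>2)) \<le> 2 * exp (\<bar>Im l\<bar> * pi)"
      using theta_near_free(1)[OF pr(1,2)[OF l], of pi] by simp
  qed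
qed

end

text \<open>The square is \<open>exp (- pi) / 4\<close>: the 4 is the denominator in the formulas
  for the squared moduli of sine and cosine, and \<open>exp (- pi)\<close> brings
  \<open>exp (2 * (\<bar>Im l\<bar> * pi))\<close> below 1 when
  \<open>\<bar>Im l\<bar> < 1 / 2\<close>, where exponential growth gives no help.\<close>

definition circle_const :: real where "circle_const = exp (- pi / 2) / 2"

lemma circle_const_pos: "circle_const > 0"
  by (simp add: circle_const_def)

text \<open>The radius \<open>N + 1/4\<close> stays away from the zeros of both \<open>sin (\<pi> l)\<close> and \<open>cos (\<pi> l)\<close>.\<close>

lemma sin_cos_lower_bound_circle:
  fixes l :: complex
  assumes l: "norm l = real N + 1 / 4" and N: "N \<ge> 4"
  shows "circle_const * exp (\<bar>Im l\<bar> * pi) \<le> norm (sin (l * of_real pi))"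
    and "circle_const * exp (\<bar>Im l\<bar> * pi) \<le> norm (cos (l * of_real pi))"
proof -
  define Y where "Y = \<bar>Im l\<bar>"
  define E where "E = exp (2 * (Y * pi))"
  define C where "C = cos (2 * (Re l * pi))"
  have ee: "exp (2 * (Im l * pi)) + inverse (exp (2 * (Im l * pi))) = E + inverse E"
    by (cases "Im l \<ge> 0") (auto simp: E_def Y_def exp_minus)
  have E0: "E > 0" by (simp add: E_def)
  have E1: "E \<ge> 1" by (simp add: E_def Y_def)
  have s: "(norm (sin (l * of_real pi)))\<^sup>2 = (E + inverse E - 2 * C) / 4"
    using norm_sin_squared[of "l * of_real pi"] ee by (simp add: C_def)
  have c: "(norm (cos (l * of_real pi)))\<^sup>2 = (E + inverse E + 2 * C) / 4"
  proof -
    have "(norm (cos (l * of_real pi)))\<^sup>2 = (cos (Re l * pi))\<^sup>2 + (exp (Im l * pi) - inverse (exp (Im l * pi)))\<^sup>2 / 4"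
      using norm_cos_squared[of "l * of_real pi"] by simp
    also have "(exp (Im l * pi) - inverse (exp (Im l * pi)))\<^sup>2 = exp (2 * (Im l * pi)) + inverse (exp (2 * (Im l * pi))) - 2"
      by (simp add: power2_diff exp_double power_inverse)
    also have "(cos (Re l * pi))\<^sup>2 = (1 + C) / 2"
      using cos_double_cos[of "Re l * pi"] by (simp add: C_def)
    finally show ?thesis using ee by (simp add: add_divide_distrib diff_divide_distrib)
  qed
  have pi3: "3 < pi" "pi < 4" using pi_gt3 pi_less_4 by auto
  \<comment> \<open>Away from the real axis \<open>E \<ge> 4\<close> outweighs
    \<open>2 * \<bar>C\<bar>\<close>. Near it the circle is almost vertical:
    \<open>\<bar>Re l\<bar>\<close> lies within 1/16 of \<open>N + 1 / 4\<close>, so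
    \<open>C\<close> is the cosine of an angle within \<open>pi / 8\<close> of \<open>pi / 2\<close>
    modulo \<open>2 * pi\<close>, and hence small.\<close>
  have ineq: "exp (- pi) * E \<le> E + inverse E - 2 * \<bar>C\<bar>"
  proof (cases "Y \<ge> 1 / 2")
    case True
    have "4 \<le> 1 + pi" using pi3 by simp
    also have "\<dots> \<le> exp pi" by (rule exp_ge_add_one_self)
    also have "exp pi \<le> E" using True by (simp add: E_def)
    finally have E4: "E \<ge> 4" .
    have pe: "4 \<le> exp pi" using exp_ge_add_one_self[of pi] pi3 by linarith
    have "exp (- pi) \<le> 1 / 2" using pe
      by (simp add: exp_minus inverse_eq_divide divide_le_eq)
    then have "exp (- pi) * E \<le> 1 / 2 * E" using E0 by (intro mult_right_mono) auto
    moreover have "\<bar>C\<bar> \<le> 1" by (simp add: C_def)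
    moreover have "inverse E \<ge> 0" using E0 by simp
    ultimately show ?thesis using E4 by linarith
  next
    case False
    define X where "X = \<bar>Re l\<bar>"
    define r where "r = real N + 1 / 4"
    define d where "d = r - X"
    have r: "r \<ge> 4" using N by (simp add: r_def)
    have sq: "X\<^sup>2 + Y\<^sup>2 = r\<^sup>2" using l cmod_power2[of l] by (simp add: X_def Y_def r_def)
    have X0: "X \<ge> 0" "Y \<ge> 0" by (simp_all add: X_def Y_def)
    have d0: "d \<ge> 0" using abs_Re_le_cmod[of l] l by (simp add: d_def X_def r_def)
    have "d * (r + X) = Y\<^sup>2" using sq by (simp add: d_def algebra_simps power2_eq_square)
    also have "\<dots> \<le> (1 / 2)\<^sup>2" using False X0 by (intro power_mono) auto
    finally have "d * (r + X) \<le> 1 / 4" by (simp add: power2_eq_square)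
    moreover have "d * 4 \<le> d * (r + X)" using r X0 d0 by (intro mult_left_mono) auto
    ultimately have d: "d \<le> 1 / 16" by simp
    have "C = cos (2 * (X * pi))"
      by (cases "Re l \<ge> 0") (auto simp: C_def X_def)
    also have "2 * (X * pi) = (pi / 2 - 2 * d * pi) + 2 * real N * pi"
      by (simp add: d_def r_def algebra_simps)
    also have "cos \<dots> = cos (pi / 2 - 2 * d * pi)"
      by (simp add: cos_add cos_2npi sin_2npi)
    also have "\<dots> = sin (2 * d * pi)" by (simp add: cos_diff)
    finally have "\<bar>C\<bar> \<le> \<bar>2 * d * pi\<bar>" using abs_sin_le_one abs_sin_x_le_abs_x by metis
    also have "\<dots> = 2 * (d * pi)" using d0 by (simp add: abs_mult)
    also have "d * pi \<le> 1 / 16 * 4" using d d0 pi3 by (intro mult_mono) auto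
    finally have C: "\<bar>C\<bar> \<le> 1 / 2" by simp
    have "E \<le> exp pi" using False by (simp add: E_def)
    then have "exp (- pi) * E \<le> 1" by (simp add: exp_minus field_simps)
    moreover have "E + inverse E \<ge> 2"
    proof -
      have "0 \<le> (E - 1)\<^sup>2 / E" using E0 by simp
      then show ?thesis using E0 by (simp add: field_simps power2_eq_square)
    qed
    ultimately show ?thesis using C by linarith
  qed
  have sq: "(circle_const * exp (\<bar>Im l\<bar> * pi))\<^sup>2 = exp (- pi) * E / 4"
    by (simp add: circle_const_def E_def Y_def power_mult_distrib power_divide exp_double[symmetric])
  have "(circle_const * exp (\<bar>Im l\<bar> * pi))\<^sup>2 \<le> (norm (sin (l * of_real pi)))\<^sup>2"
    unfolding sq s using ineq by (intro divide_right_mono) auto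
  then show "circle_const * exp (\<bar>Im l\<bar> * pi) \<le> norm (sin (l * of_real pi))"
    by (rule power2_le_imp_le) simp
  have "(circle_const * exp (\<bar>Im l\<bar> * pi))\<^sup>2 \<le> (norm (cos (l * of_real pi)))\<^sup>2"
    unfolding sq c using ineq by (intro divide_right_mono) auto
  then show "circle_const * exp (\<bar>Im l\<bar> * pi) \<le> norm (cos (l * of_real pi))"
    by (rule power2_le_imp_le) simp
qed

context
  fixes q :: "real \<Rightarrow> real"
  assumes q: "q absolutely_integrable_on {0..pi}"
begin

lemma circle_bounds:
  "\<forall>\<^sub>F N in sequentially. \<forall>l. norm l = real N + 1 / 4 \<longrightarrow>
     (l \<noteq> 0 \<and> 2 * potential_norm q \<le> norm l) \<and>
     circle_const / 2 * exp (\<bar>Im l\<bar> * pi) / norm l \<le> norm (phi q pi (l\<^sup>2)) \<and>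
     circle_const / 2 * exp (\<bar>Im l\<bar> * pi) \<le> norm (theta q pi (l\<^sup>2))"
proof -
  \<comment> \<open>Beyond the second threshold the deviation from the free solution is at most half
    of the lower bound for sine and cosine, which leaves \<open>circle_const / 2\<close>.\<close>
  obtain M :: nat where M: "real M > max (2 * potential_norm q) (4 * potential_norm q / circle_const)"
    using reals_Archimedean2 by blast
  show ?thesis
    unfolding eventually_sequentially
  proof (intro exI[of _ "max 4 M"] allI impI)
    fix N and l :: complex
    assume N: "max 4 M \<le> N" and nl: "norm l = real N + 1 / 4"
    define e where "e = exp (\<bar>Im l\<bar> * pi)"
    have MN: "real M \<le> real N" using N by simp
    have l: "l \<noteq> 0" "2 * potential_norm q \<le> norm l" "norm l > 0"
      using MN M nl potential_norm_nonneg[OF q] by auto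
    have "4 * potential_norm q / circle_const \<le> norm l"
      using MN M nl by simp
    then have "2 * potential_norm q / norm l \<le> circle_const / 2"
      using circle_const_pos l(3) by (simp add: field_simps)
    then have k: "2 * potential_norm q / norm l * e \<le> circle_const / 2 * e"
      by (intro mult_right_mono) (auto simp: e_def)
    have N4: "N \<ge> 4" using N by simp
    have "circle_const / 2 * e \<le> norm (theta q pi (l\<^sup>2))"
      using sin_cos_lower_bound_circle(2)[OF nl N4] theta_near_free(2)[OF q l(1,2), of pi] k
        norm_triangle_sub[of "cos (l * of_real pi)" "theta q pi (l\<^sup>2)"]
        norm_minus_commute[of "cos (l * of_real pi)" "theta q pi (l\<^sup>2)"]
      unfolding e_def[symmetric] by simp
    moreover have "circle_const / 2 * e / norm l \<le> norm (phi q pi (l\<^sup>2))"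
    proof -
      have "circle_const * e / norm l \<le> norm (sin (l * of_real pi) / l)"
        unfolding norm_divide using sin_cos_lower_bound_circle(1)[OF nl N4] by (intro divide_right_mono) (auto simp: e_def)
      moreover have "norm (phi q pi (l\<^sup>2) - sin (l * of_real pi) / l) \<le> 2 * potential_norm q / (norm l)\<^sup>2 * e"
        using phi_near_free(2)[OF q l(1,2), of pi] by (simp add: e_def)
      moreover have "2 * potential_norm q / (norm l)\<^sup>2 * e = 2 * potential_norm q / norm l * e / norm l"
        by (simp add: power2_eq_square)
      moreover have "2 * potential_norm q / norm l * e / norm l \<le> circle_const / 2 * e / norm l"
        using k by (intro divide_right_mono) auto
      moreover have "circle_const * e / norm l = 2 * (circle_const / 2 * e / norm l)" by simp
      ultimately show ?thesis
        using norm_triangle_sub[of "sin (l * of_real pi) / l" "phi q pi (l\<^sup>2)"]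
          norm_minus_commute[of "sin (l * of_real pi) / l" "phi q pi (l\<^sup>2)"] by linarith
    qed
    ultimately show "(l \<noteq> 0 \<and> 2 * potential_norm q \<le> norm l) \<and>
     circle_const / 2 * exp (\<bar>Im l\<bar> * pi) / norm l \<le> norm (phi q pi (l\<^sup>2)) \<and>
     circle_const / 2 * exp (\<bar>Im l\<bar> * pi) \<le> norm (theta q pi (l\<^sup>2))"
      using l unfolding e_def by blast
  qed
qed

text \<open>At \<open>l = \<i> * k\<close> the free solutions become
  \<open>sinh (k * pi) / k\<close> and \<open>cosh (k * pi)\<close>, and the prefactors normalise
  their leading exponentials to 1. Being the same for every potential, the prefactors cancel in the
  ratio of two Weyl functions.\<close>

lemma negative_axis_asymptotics:
  "((\<lambda>k. of_real (2 * k * exp (- (k * pi))) * phi q pi (of_real (- k\<^sup>2))) \<longlongrightarrow> 1) at_top"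
  "((\<lambda>k. of_real (2 * exp (- (k * pi))) * theta q pi (of_real (- k\<^sup>2))) \<longlongrightarrow> 1) at_top"
proof -
  define K where "K = potential_norm q"
  have ev: "\<forall>\<^sub>F k in at_top. k > 0 \<and> 2 * K \<le> k" for K :: real
    using eventually_gt_at_top[of 0] eventually_ge_at_top[of "2 * K"] by eventually_elim auto
  have lim: "((\<lambda>k. exp (- 2 * (k * pi)) + 4 * K / k) \<longlongrightarrow> 0) at_top" by real_asymp
  have sq: "(\<i> * complex_of_real k)\<^sup>2 = of_real (- k\<^sup>2)" for k by (simp add: power_mult_distrib)
  have ex: "exp (- (k * pi)) * exp (k * pi) = 1" for k :: real by (simp add: exp_minus)
  show "((\<lambda>k. of_real (2 * k * exp (- (k * pi))) * phi q pi (of_real (- k\<^sup>2))) \<longlongrightarrow> 1) at_top"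
    unfolding LIM_zero_iff[symmetric, of _ 1]
  proof (rule Lim_null_comparison[OF _ lim])
    show "\<forall>\<^sub>F k in at_top. norm (of_real (2 * k * exp (- (k * pi))) * phi q pi (of_real (- k\<^sup>2)) - 1) \<le> exp (- 2 * (k * pi)) + 4 * K / k"
      using ev[of K]
    proof eventually_elim
      case (elim k)
      define l where "l = \<i> * complex_of_real k"
      have l: "l \<noteq> 0" "2 * potential_norm q \<le> norm l" "norm l = k" "\<bar>Im l\<bar> = k" "l\<^sup>2 = of_real (- k\<^sup>2)"
        using elim sq by (auto simp: l_def K_def norm_mult)
      have iz: "\<i> * (l * of_real pi) = of_real (- (k * pi))" "- (of_real (- (k * pi))) = complex_of_real (k * pi)"
        by (simp_all add: l_def complex_eq_iff)
      have 1: "of_real (2 * k * exp (- (k * pi))) * (sin (l * of_real pi) / l) = 1 - of_real (exp (- 2 * (k * pi)))"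
      proof -
        have "sin (l * of_real pi) / l = of_real ((exp (k * pi) - exp (- (k * pi))) / (2 * k))"
          unfolding sin_exp_eq iz exp_of_real using elim by (simp add: l_def field_simps)
        then have "of_real (2 * k * exp (- (k * pi))) * (sin (l * of_real pi) / l)
          = complex_of_real (2 * k * exp (- (k * pi)) * ((exp (k * pi) - exp (- (k * pi))) / (2 * k)))"
          by simp
        also have "2 * k * exp (- (k * pi)) * ((exp (k * pi) - exp (- (k * pi))) / (2 * k))
          = exp (- (k * pi)) * exp (k * pi) - exp (- (k * pi)) * exp (- (k * pi))"
          using elim by (simp add: field_simps)
        also have "complex_of_real \<dots> = 1 - of_real (exp (- 2 * (k * pi)))"
          unfolding ex by (simp flip: exp_add)
        finally show ?thesis .
      qed
      have 2: "norm (of_real (2 * k * exp (- (k * pi))) * (phi q pi (l\<^sup>2) - sin (l * of_real pi) / l)) \<le> 4 * K / k"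
      proof -
        have "norm (of_real (2 * k * exp (- (k * pi))) * (phi q pi (l\<^sup>2) - sin (l * of_real pi) / l))
           \<le> (2 * k * exp (- (k * pi))) * (2 * K / k\<^sup>2 * exp (k * pi))"
          using phi_near_free(2)[OF q l(1,2), of pi] elim unfolding norm_mult[of "of_real _"] norm_of_real
          by (intro mult_mono) (auto simp: l K_def)
        also have "\<dots> = 4 * K / k * (exp (- (k * pi)) * exp (k * pi))"
          using elim by (simp add: power2_eq_square field_simps)
        finally show ?thesis unfolding ex by simp
      qed
      have "of_real (2 * k * exp (- (k * pi))) * phi q pi (of_real (- k\<^sup>2)) - 1
         = of_real (2 * k * exp (- (k * pi))) * (phi q pi (l\<^sup>2) - sin (l * of_real pi) / l) - of_real (exp (- 2 * (k * pi)))"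
        using 1 by (simp add: l(5) right_diff_distrib)
      also have "norm \<dots> \<le> 4 * K / k + norm (complex_of_real (exp (- 2 * (k * pi))))"
        using norm_triangle_ineq4 2 by (rule order_trans[OF _ add_right_mono])
      finally show ?case by simp
    qed
  qed
  show "((\<lambda>k. of_real (2 * exp (- (k * pi))) * theta q pi (of_real (- k\<^sup>2))) \<longlongrightarrow> 1) at_top"
    unfolding LIM_zero_iff[symmetric, of _ 1]
  proof (rule Lim_null_comparison[OF _ lim])
    show "\<forall>\<^sub>F k in at_top. norm (of_real (2 * exp (- (k * pi))) * theta q pi (of_real (- k\<^sup>2)) - 1) \<le> exp (- 2 * (k * pi)) + 4 * K / k"
      using ev[of K]
    proof eventually_elim
      case (elim k)
      define l where "l = \<i> * complex_of_real k"
      have l: "l \<noteq> 0" "2 * potential_norm q \<le> norm l" "norm l = k" "\<bar>Im l\<bar> = k" "l\<^sup>2 = of_real (- k\<^sup>2)"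
        using elim sq by (auto simp: l_def K_def norm_mult)
      have iz: "\<i> * (l * of_real pi) = of_real (- (k * pi))" "- (of_real (- (k * pi))) = complex_of_real (k * pi)"
        by (simp_all add: l_def complex_eq_iff)
      have 1: "of_real (2 * exp (- (k * pi))) * cos (l * of_real pi) = 1 + of_real (exp (- 2 * (k * pi)))"
      proof -
        have "cos (l * of_real pi) = of_real ((exp (- (k * pi)) + exp (k * pi)) / 2)"
          unfolding cos_exp_eq iz exp_of_real by simp
        then have "of_real (2 * exp (- (k * pi))) * cos (l * of_real pi)
          = complex_of_real (2 * exp (- (k * pi)) * ((exp (- (k * pi)) + exp (k * pi)) / 2))"
          by (simp only: of_real_mult)
        also have "2 * exp (- (k * pi)) * ((exp (- (k * pi)) + exp (k * pi)) / 2)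
          = exp (- (k * pi)) * exp (k * pi) + exp (- (k * pi)) * exp (- (k * pi))"
          by (simp add: field_simps)
        also have "complex_of_real \<dots> = 1 + of_real (exp (- 2 * (k * pi)))"
          unfolding ex by (simp flip: exp_add)
        finally show ?thesis .
      qed
      have 2: "norm (of_real (2 * exp (- (k * pi))) * (theta q pi (l\<^sup>2) - cos (l * of_real pi))) \<le> 4 * K / k"
      proof -
        have "norm (of_real (2 * exp (- (k * pi))) * (theta q pi (l\<^sup>2) - cos (l * of_real pi)))
           \<le> (2 * exp (- (k * pi))) * (2 * K / k * exp (k * pi))"
          using theta_near_free(2)[OF q l(1,2), of pi] elim unfolding norm_mult[of "of_real _"] norm_of_real
          by (intro mult_mono) (auto simp: l K_def)
        also have "\<dots> = 4 * K / k * (exp (- (k * pi)) * exp (k * pi))"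
          using elim by (simp add: field_simps)
        finally show ?thesis unfolding ex by simp
      qed
      have "of_real (2 * exp (- (k * pi))) * theta q pi (of_real (- k\<^sup>2)) - 1
         = of_real (2 * exp (- (k * pi))) * (theta q pi (l\<^sup>2) - cos (l * of_real pi)) + of_real (exp (- 2 * (k * pi)))"
        using 1 by (simp add: l(5) right_diff_distrib)
      also have "norm \<dots> \<le> 4 * K / k + norm (complex_of_real (exp (- 2 * (k * pi))))"
        using norm_triangle_ineq 2 by (rule order_trans[OF _ add_right_mono])
      finally show ?case by simp
    qed
  qed
qed

end

section \<open>Entire functions with prescribed zeros\<close>

text \<open>At a simple zero of \<open>D\<close> the removable value is
  \<open>deriv N z / deriv D z\<close>, by l'Hopital's rule. Every division below, and with it the
  construction of H, is an instance of this lemma.\<close>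

lemma entire_quotient:
  fixes N D :: "complex \<Rightarrow> complex"
  assumes N: "N holomorphic_on UNIV" and D: "D holomorphic_on UNIV"
    and zeros: "\<And>z. D z = 0 \<Longrightarrow> N z = 0 \<and> deriv D z \<noteq> 0"
  obtains K where "K holomorphic_on UNIV" "\<And>z. N z = K z * D z"
proof -
  define K where "K = (\<lambda>z. if D z = 0 then deriv N z / deriv D z else N z / D z)"
  have "\<exists>r>0. K holomorphic_on ball z r" for z
  proof (cases "D z = 0")
    case False
    have "continuous_on UNIV D" using D holomorphic_on_imp_continuous_on by blast
    then have op: "open {w. D w \<noteq> 0}"
      using open_Collect_neq[of D "\<lambda>_. 0"] by simp
    then obtain r where r: "r > 0" "ball z r \<subseteq> {w. D w \<noteq> 0}"
      using False open_contains_ball by blast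
    have "(\<lambda>w. N w / D w) holomorphic_on ball z r"
      using r by (intro holomorphic_on_divide holomorphic_on_subset[OF N] holomorphic_on_subset[OF D]) auto
    then have "K holomorphic_on ball z r"
      by (rule holomorphic_transform) (use r in \<open>auto simp: K_def\<close>)
    with r(1) show ?thesis by blast
  next
    case True
    \<comment> \<open>An identically vanishing \<open>D\<close> would have vanishing derivative,
      contrary to the assumption on its zeros; hence the zeros are isolated.\<close>
    have "\<exists>\<beta>. D \<beta> \<noteq> 0"
    proof (rule ccontr)
      assume "\<not> ?thesis"
      then have "D = (\<lambda>_. 0)" by auto
      then show False using zeros[of z] by simp
    qed
    then obtain r where r: "r > 0" "\<And>w. w \<in> ball z r - {z} \<Longrightarrow> D w \<noteq> 0"
      using isolated_zeros[OF D open_UNIV connected_UNIV, of z] True by (metis UNIV_I)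
    have "K holomorphic_on ball z r"
    proof (rule no_isolated_singularity'[where K = "{z}"])
      have "(\<lambda>w. N w / D w) holomorphic_on ball z r - {z}"
        using r by (intro holomorphic_on_divide holomorphic_on_subset[OF N] holomorphic_on_subset[OF D]) auto
      then show "K holomorphic_on ball z r - {z}"
        by (rule holomorphic_transform) (use r in \<open>auto simp: K_def\<close>)
      fix w assume "w \<in> {z}"
      then have w: "w = z" by simp
      have dN: "(N has_field_derivative deriv N z) (at z)" and dD: "(D has_field_derivative deriv D z) (at z)"
        using holomorphic_derivI[OF N open_UNIV] holomorphic_derivI[OF D open_UNIV] by auto
      have "((\<lambda>w. N w / D w) \<longlongrightarrow> K z) (at z)"
        using True zeros[OF True] by (intro lhopital_complex_simple[OF dN dD]) (auto simp: K_def)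
      moreover have "\<forall>\<^sub>F w in at z. N w / D w = K w"
        unfolding eventually_at using r by (intro exI[of _ r]) (auto simp: K_def dist_commute)
      ultimately have "(K \<longlongrightarrow> K z) (at z)" by (rule Lim_transform_eventually)
      then show "(K \<longlongrightarrow> K w) (at w within ball z r)" using w by (simp add: Lim_at_imp_Lim_at_within)
    qed auto
    with r(1) show ?thesis by blast
  qed
  then have "K holomorphic_on UNIV"
    unfolding holomorphic_on_def
    by (metis (no_types) UNIV_I at_within_open centre_in_ball field_differentiable_at_within holomorphic_on_def open_ball)
  moreover have "N z = K z * D z" for z
    using zeros[of z] by (auto simp: K_def)
  ultimately show thesis by (rule that)
qed

section \<open>Zero counting, canonical products and partial fractions\<close>

lemma entire_norm_le_on_circle:
  assumes f: "f holomorphic_on UNIV" and B: "\<And>z. norm z = R \<Longrightarrow> norm (f z) \<le> B" and z: "norm z < R"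
  shows "norm (f z) \<le> B"
proof (rule maximum_modulus_frontier[where S = "ball 0 R" and f = f])
  have R: "R > 0" using z norm_ge_zero[of z] by linarith
  show "f holomorphic_on interior (ball 0 R)" using f holomorphic_on_subset by blast
  show "continuous_on (closure (ball 0 R)) f"
    using holomorphic_on_imp_continuous_on[OF f] continuous_on_subset by blast
  show "norm (f w) \<le> B" if "w \<in> frontier (ball 0 R)" for w
    using that R B[of w] by simp
qed (use z in auto)

text \<open>After dividing out the zeros, each factor \<open>1 - z / \<alpha> j\<close> has modulus at least \<open>2\<close> on the circle of radius \<open>3 r\<close>.\<close>

lemma zero_count_bound:
  fixes f :: "complex \<Rightarrow> complex" and \<alpha> :: "nat \<Rightarrow> complex"
  assumes f: "f holomorphic_on UNIV"
    and \<alpha>: "\<And>j. j < n \<Longrightarrow> f (\<alpha> j) = 0" "\<And>j. j < n \<Longrightarrow> \<alpha> j \<noteq> 0" "\<And>j. j < n \<Longrightarrow> norm (\<alpha> j) \<le> r" "inj_on \<alpha> {..<n}"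
    and B: "\<And>z. norm z = 3 * r \<Longrightarrow> norm (f z) \<le> B" and r: "r > 0"
  shows "2 ^ n * norm (f 0) \<le> B"
proof -
  have "\<exists>g. g holomorphic_on UNIV \<and> (\<forall>z. f z = g z * (\<Prod>j<m. 1 - z / \<alpha> j))" if "m \<le> n" for m
    using that
  proof (induction m)
    case 0
    then show ?case using f by auto
  next
    case (Suc m)
    then obtain g where g: "g holomorphic_on UNIV" "\<And>z. f z = g z * (\<Prod>j<m. 1 - z / \<alpha> j)" by auto
    have am: "\<alpha> m \<noteq> 0" using \<alpha>(2) Suc by simp
    have "\<alpha> m / \<alpha> j \<noteq> 1" if "j < m" for j
    proof -
      have "\<alpha> m \<noteq> \<alpha> j" using that inj_on_eq_iff[OF \<alpha>(4), of m j] Suc.prems by auto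
      then show ?thesis by auto
    qed
    then have "(\<Prod>j<m. 1 - \<alpha> m / \<alpha> j) \<noteq> 0" by (auto simp: prod_zero_iff)
    then have gm: "g (\<alpha> m) = 0" using g(2)[of "\<alpha> m"] \<alpha>(1)[of m] Suc.prems by (simp del: prod_zero_iff)
    have dD: "deriv (\<lambda>z. 1 - z / \<alpha> m) z = - 1 / \<alpha> m" for z
      using am by (intro DERIV_imp_deriv) (auto intro!: derivative_eq_intros)
    obtain K where K: "K holomorphic_on UNIV" "\<And>z. g z = K z * (1 - z / \<alpha> m)"
    proof (rule entire_quotient[OF g(1), of "\<lambda>z. 1 - z / \<alpha> m"])
      show "(\<lambda>z. 1 - z / \<alpha> m) holomorphic_on UNIV" using am by (intro holomorphic_intros)
      fix z assume "1 - z / \<alpha> m = 0"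
      then have "z = \<alpha> m" using am by simp
      then show "g z = 0 \<and> deriv (\<lambda>z. 1 - z / \<alpha> m) z \<noteq> 0" using gm dD am by simp
    qed (use that in blast)
    have "f z = K z * (\<Prod>j<Suc m. 1 - z / \<alpha> j)" for z
      using g(2)[of z] K(2)[of z] by simp
    with K(1) show ?case by blast
  qed
  then obtain g where g: "g holomorphic_on UNIV" "\<And>z. f z = g z * (\<Prod>j<n. 1 - z / \<alpha> j)" by blast
  have "norm (g 0) \<le> B / 2 ^ n"
  proof (rule entire_norm_le_on_circle[OF g(1)])
    fix z :: complex assume z: "norm z = 3 * r"
    have "2 \<le> norm (1 - z / \<alpha> j)" if "j < n" for j
    proof -
      have "3 \<le> norm z / norm (\<alpha> j)" using z \<alpha>(2,3)[OF that] by (simp add: le_divide_eq)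
      then show ?thesis using norm_triangle_ineq2[of "z / \<alpha> j" 1] by (simp add: norm_divide norm_minus_commute)
    qed
    then have "(\<Prod>j<n. 2) \<le> (\<Prod>j<n. norm (1 - z / \<alpha> j))" by (intro prod_mono) auto
    then have "norm (g z) * 2 ^ n \<le> norm (g z) * norm (\<Prod>j<n. 1 - z / \<alpha> j)"
      by (intro mult_left_mono) (auto simp: prod_norm)
    also have "\<dots> \<le> B" using g(2)[of z] B[OF z] by (simp add: norm_mult)
    finally show "norm (g z) \<le> B / 2 ^ n" by (simp add: field_simps)
  qed (use r in simp)
  then show ?thesis using g(2)[of 0] by (simp add: field_simps)
qed

text \<open>The closed disc of radius \<open>\<alpha> n\<close> holds at least \<open>n + 1\<close>
  zeros, so after taking logarithms the counting bound gives
  \<open>n = O(sqrt (\<alpha> n))\<close>. The reciprocals are therefore dominated by a multiple of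
  \<open>1 / n^2\<close>.\<close>

lemma summable_inverse_zeros:
  fixes f :: "complex \<Rightarrow> complex" and \<alpha> :: "nat \<Rightarrow> real"
  assumes f: "f holomorphic_on UNIV" "f 0 \<noteq> 0"
    and growth: "\<And>z. norm (f z) \<le> C * exp (c * sqrt (norm z))" and c: "c > 0"
    and \<alpha>: "strict_mono \<alpha>" "\<And>n. \<alpha> n > 0" "\<And>n. f (of_real (\<alpha> n)) = 0"
  shows "summable (\<lambda>n. 1 / \<alpha> n)"
proof -
  have C: "C > 0"
    using growth[of 0] f(2) by (auto intro: less_le_trans[of 0 "norm (f 0)"])
  define L where "L = ln (C / norm (f 0))"
  \<comment> \<open>Half of \<open>Suc n * ln 2\<close> absorbs the constant \<open>L\<close> for
    large \<open>n\<close>; comparing the other half with \<open>c * sqrt (3 * \<alpha> n)\<close>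
    leaves this slope.\<close>
  define e where "e = ln 2 / (2 * c * sqrt 3)"
  have e: "e > 0" using c by (simp add: e_def)
  have count: "real (Suc n) * ln 2 \<le> L + c * sqrt (3 * \<alpha> n)" for n
  proof -
    have "2 ^ Suc n * norm (f 0) \<le> C * exp (c * sqrt (3 * \<alpha> n))"
    proof (rule zero_count_bound[OF f(1), where \<alpha> = "\<lambda>n. of_real (\<alpha> n)" and r = "\<alpha> n"])
      show "norm (complex_of_real (\<alpha> j)) \<le> \<alpha> n" if "j < Suc n" for j
        using that strict_mono_less_eq[OF \<alpha>(1), of j n] \<alpha>(2)[of j] by simp
      show "inj_on (\<lambda>n. complex_of_real (\<alpha> n)) {..<Suc n}"
        using \<alpha>(1) by (auto simp: inj_on_def strict_mono_eq)
      show "norm (f z) \<le> C * exp (c * sqrt (3 * \<alpha> n))" if "norm z = 3 * \<alpha> n" for z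
        using growth[of z] that by simp
      show "complex_of_real (\<alpha> j) \<noteq> 0" for j using \<alpha>(2)[of j] by simp
    qed (use \<alpha>(2,3) in auto)
    then have "2 ^ Suc n \<le> C / norm (f 0) * exp (c * sqrt (3 * \<alpha> n))"
      using f(2) by (simp add: field_simps)
    then have "ln (2 ^ Suc n) \<le> ln (C / norm (f 0) * exp (c * sqrt (3 * \<alpha> n)))"
      using C f(2) by (subst ln_le_cancel_iff) (auto intro!: mult_pos_pos)
    also have "\<dots> = L + c * sqrt (3 * \<alpha> n)"
      using C f(2) by (subst ln_mult) (auto simp: L_def)
    finally show ?thesis by (simp only: ln_realpow)
  qed
  obtain M :: nat where M: "real M > 2 * L / ln 2" using reals_Archimedean2 by blast
  have bound: "norm (1 / \<alpha> n) \<le> 1 / e\<^sup>2 * inverse (real (Suc n) ^ 2)" if "n \<ge> M" for n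
  proof -
    have "2 * L / ln 2 \<le> real (Suc n)" using that M by simp
    then have "L \<le> real (Suc n) * ln 2 / 2" by (simp add: field_simps)
    then have "real (Suc n) * ln 2 / 2 \<le> c * sqrt (3 * \<alpha> n)" using count[of n] by simp
    then have "real (Suc n) * (ln 2 / 2) \<le> (c * sqrt 3) * sqrt (\<alpha> n)" by (simp add: real_sqrt_mult)
    moreover have "c * sqrt 3 > 0" using c by simp
    ultimately have "real (Suc n) * (ln 2 / 2) / (c * sqrt 3) \<le> sqrt (\<alpha> n)"
      by (simp only: pos_divide_le_eq mult.commute)
    then have "e * real (Suc n) \<le> sqrt (\<alpha> n)" by (simp add: e_def field_simps)
    then have "(e * real (Suc n))\<^sup>2 \<le> (sqrt (\<alpha> n))\<^sup>2" using e by (intro power_mono) auto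
    then have le: "e\<^sup>2 * (real (Suc n))\<^sup>2 \<le> \<alpha> n" using \<alpha>(2)[of n] by (simp add: power_mult_distrib del: of_nat_Suc)
    have "1 / \<alpha> n \<le> 1 / (e\<^sup>2 * (real (Suc n))\<^sup>2)"
      using le e \<alpha>(2)[of n] by (intro divide_left_mono) (auto simp del: of_nat_Suc)
    then show ?thesis using \<alpha>(2)[of n] by (simp add: divide_inverse del: of_nat_Suc)
  qed
  have "summable (\<lambda>n. 1 / e\<^sup>2 * inverse (real (Suc n) ^ 2))"
    using inverse_power_summable[of 2, where 'a = real] summable_Suc_iff[of "\<lambda>n. inverse (real n ^ 2)"]
    by (intro summable_mult) simp
  then show ?thesis
    by (rule summable_comparison_test') (rule bound)
qed

text \<open>Summable reciprocals allow genus 0, so the factors are plain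
  \<open>1 - z / \<alpha> n\<close>, as in G, and bounds on finite products carry over to the limit.
  Injectivity makes every zero simple, whence the statement on derivatives.\<close>

lemma entire_canonical_product:
  fixes \<alpha> :: "nat \<Rightarrow> real"
  assumes \<alpha>: "inj \<alpha>" "\<And>n. \<alpha> n > 0" and s: "summable (\<lambda>n. 1 / \<alpha> n)"
  obtains f :: "complex \<Rightarrow> complex" where "f holomorphic_on UNIV"
    "\<And>z. f z = 0 \<longleftrightarrow> z \<in> range (\<lambda>n. of_real (\<alpha> n))"
    "\<And>z. (\<lambda>m. \<Prod>n<m. 1 - z / of_real (\<alpha> n)) \<longlonglongrightarrow> f z"
    "\<And>n. deriv f (of_real (\<alpha> n)) \<noteq> 0"
proof -
  define A where "A = (\<lambda>n. complex_of_real (\<alpha> n))"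
  have "filterlim (\<lambda>n. inverse (1 / \<alpha> n)) at_top sequentially"
    using summable_LIMSEQ_zero[OF s] \<alpha>(2) by (intro filterlim_inverse_at_top) auto
  then have top: "filterlim \<alpha> at_top sequentially" by simp
  interpret W: weierstrass_product A "\<lambda>_. 0"
  proof
    show "A n \<noteq> 0" for n using \<alpha>(2)[of n] by (simp add: A_def)
    have "(\<lambda>n. norm (A n)) = \<alpha>" using \<alpha>(2) by (auto simp: A_def fun_eq_iff abs_of_pos)
    then show "filterlim A at_infinity sequentially"
      using top filterlim_norm_at_top_imp_at_infinity by metis
    show "summable (\<lambda>n. (r / norm (A n)) ^ Suc 0)" if "r > 0" for r
      using summable_mult[OF s, of r] \<alpha>(2) by (simp add: A_def abs_of_pos)
  qed
  have lim: "(\<lambda>m. \<Prod>n<m. 1 - z / A n) \<longlonglongrightarrow> W.f z" for z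
  proof -
    have "(\<lambda>m. \<Prod>n<m. weierstrass_factor 0 (z / A n)) \<longlonglongrightarrow> W.f z"
      by (rule tendsto_uniform_limitI[OF W.uniform_limit[of "norm z + 1"]]) (auto intro: add_nonneg_pos)
    then show ?thesis by (simp add: weierstrass_factor_def)
  qed
  have der: "deriv W.f (A n) \<noteq> 0" for n
  proof -
    have "A -` {A n} = {n}" using \<alpha>(1) by (auto simp: A_def inj_def)
    then have zo: "zorder W.f (A n) = 1" using W.zorder[of "A n"] by simp
    have "W.f 0 \<noteq> 0" using W.zero[of 0] W.a_nonzero by auto
    then have nc: "\<exists>w\<in>UNIV. W.f w \<noteq> 0" by blast
    from zorder_exist_zero[OF W.holomorphic open_UNIV connected_UNIV UNIV_I nc, of "A n"]
    obtain r where r: "r > 0" "zor_poly W.f (A n) holomorphic_on cball (A n) r"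
      "\<And>w. w \<in> cball (A n) r \<Longrightarrow> W.f w = zor_poly W.f (A n) w * (w - A n) \<and> zor_poly W.f (A n) w \<noteq> 0"
      by (auto simp: zo)
    have "zor_poly W.f (A n) holomorphic_on ball (A n) r"
      using r(2) by (rule holomorphic_on_subset) auto
    then have "(zor_poly W.f (A n) has_field_derivative deriv (zor_poly W.f (A n)) (A n)) (at (A n))"
      using r(1) by (intro holomorphic_derivI[of _ "ball (A n) r"]) auto
    then have "((\<lambda>w. zor_poly W.f (A n) w * (w - A n)) has_field_derivative zor_poly W.f (A n) (A n)) (at (A n))"
      by (auto intro!: derivative_eq_intros)
    then have "(W.f has_field_derivative zor_poly W.f (A n) (A n)) (at (A n))"
      by (rule has_field_derivative_transform_within_open[of _ _ _ "ball (A n) r"]) (use r in auto)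
    then show ?thesis using r(3)[of "A n"] r(1) by (simp add: DERIV_imp_deriv)
  qed
  show thesis
    using that[OF W.holomorphic] W.zero lim der by (simp add: A_def)
qed

text \<open>Induction on the number of factors. Multiplication by a further factor splits each old
  fraction into one at its own pole, whose residue gains the new factor, and one at the new pole.
  The latter, together with the share of the constant term, add up to the old product evaluated at
  the new pole, which is what its residue requires.\<close>

lemma partial_fractions:
  fixes \<alpha> \<beta> :: "nat \<Rightarrow> 'a :: field"
  defines "res \<equiv> \<lambda>m n. \<alpha> n / \<beta> n * (\<alpha> n - \<beta> n) * (\<Prod>j\<in>{..<m} - {n}. \<alpha> j / \<beta> j * ((\<alpha> n - \<beta> j) / (\<alpha> n - \<alpha> j)))"
  assumes \<alpha>: "inj_on \<alpha> {..<m}" "\<And>n. n < m \<Longrightarrow> \<alpha> n \<noteq> 0" and \<beta>: "\<And>n. n < m \<Longrightarrow> \<beta> n \<noteq> 0"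
    and z: "\<And>n. n < m \<Longrightarrow> z \<noteq> \<alpha> n"
  shows "(\<Prod>n<m. (z / \<beta> n - 1) / (z / \<alpha> n - 1)) = (\<Prod>n<m. \<alpha> n / \<beta> n) + (\<Sum>n<m. res m n / (z - \<alpha> n))"
  using \<alpha> \<beta> z
proof (induction m arbitrary: z)
  case 0
  then show ?case by simp
next
  case (Suc m)
  define G where "G = (\<lambda>z. \<Prod>n<m. (z / \<beta> n - 1) / (z / \<alpha> n - 1))"
  define P where "P = (\<Prod>n<m. \<alpha> n / \<beta> n)"
  define a b where "a = \<alpha> m" and "b = \<beta> m"
  have ab: "a \<noteq> 0" "b \<noteq> 0" "z \<noteq> a" using Suc.prems by (auto simp: a_def b_def)
  have ne: "\<alpha> n \<noteq> a" if "n < m" for n using Suc.prems(1) that by (auto simp: a_def inj_on_def)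
  have IH: "G w = P + (\<Sum>n<m. res m n / (w - \<alpha> n))" if "\<And>n. n < m \<Longrightarrow> w \<noteq> \<alpha> n" for w
    unfolding G_def P_def using Suc.prems that by (intro Suc.IH) (auto simp: inj_on_def)
  have fac: "(w / \<beta> n - 1) / (w / \<alpha> n - 1) = \<alpha> n / \<beta> n * ((w - \<beta> n) / (w - \<alpha> n))" if "n < Suc m" for w n
  proof -
    have "w / \<beta> n - 1 = (w - \<beta> n) / \<beta> n" "w / \<alpha> n - 1 = (w - \<alpha> n) / \<alpha> n"
      using Suc.prems that by (auto simp: diff_divide_distrib)
    then show ?thesis by simp
  qed
  have resm: "res (Suc m) m = a / b * (a - b) * G a"
  proof -
    have "{..<Suc m} - {m} = {..<m}" by auto
    then show ?thesis using fac by (auto simp: res_def G_def a_def b_def intro!: prod.cong)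
  qed
  have resn: "res (Suc m) n = res m n * (a / b * ((\<alpha> n - b) / (\<alpha> n - a)))" if "n < m" for n
  proof -
    have "{..<Suc m} - {n} = insert m ({..<m} - {n})" using that by auto
    then show ?thesis by (simp add: res_def a_def b_def mult_ac)
  qed
  have split: "res m n / (z - \<alpha> n) * (a / b * ((z - b) / (z - a)))
     = res (Suc m) n / (z - \<alpha> n) + a / b * (a - b) * (res m n / (a - \<alpha> n)) / (z - a)" if "n < m" for n
  proof -
    have nz: "z - \<alpha> n \<noteq> 0" "z - a \<noteq> 0" "\<alpha> n - a \<noteq> 0" "a - \<alpha> n \<noteq> 0" using Suc.prems(4) that ab ne[OF that] by auto
    have "(z - b) / ((z - \<alpha> n) * (z - a)) = (\<alpha> n - b) / ((\<alpha> n - a) * (z - \<alpha> n)) + (a - b) / ((a - \<alpha> n) * (z - a))"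
      using nz by (simp add: divide_simps) (simp add: algebra_simps)
    then have "res m n * (a / b) * ((z - b) / ((z - \<alpha> n) * (z - a)))
      = res m n * (a / b) * ((\<alpha> n - b) / ((\<alpha> n - a) * (z - \<alpha> n)) + (a - b) / ((a - \<alpha> n) * (z - a)))" by simp
    then show ?thesis using resn[OF that] by (simp add: distrib_left mult_ac)
  qed
  have "(\<Sum>n<m. res m n / (z - \<alpha> n)) * (a / b * ((z - b) / (z - a)))
     = (\<Sum>n<m. res (Suc m) n / (z - \<alpha> n)) + a / b * (a - b) * (\<Sum>n<m. res m n / (a - \<alpha> n)) / (z - a)"
    unfolding sum_distrib_right sum_distrib_left sum_divide_distrib sum.distrib[symmetric]
    by (rule sum.cong[OF refl], rule split) simp
  then have eq2: "(P + (\<Sum>n<m. res m n / (z - \<alpha> n))) * (a / b * ((z - b) / (z - a)))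
     = P * (a / b * ((z - b) / (z - a))) + (\<Sum>n<m. res (Suc m) n / (z - \<alpha> n))
       + a / b * (a - b) * (\<Sum>n<m. res m n / (a - \<alpha> n)) / (z - a)"
    unfolding distrib_right by (simp only: add.assoc)
  have "(\<Prod>n<Suc m. (z / \<beta> n - 1) / (z / \<alpha> n - 1)) = G z * (a / b * ((z - b) / (z - a)))"
    using fac[of m] by (simp add: G_def a_def b_def)
  also have "G z = P + (\<Sum>n<m. res m n / (z - \<alpha> n))" using Suc.prems(4) by (intro IH) auto
  also note eq2
  also have "P * (a / b * ((z - b) / (z - a))) = P * (a / b) + a / b * (a - b) * P / (z - a)"
    using ab by (simp add: divide_simps) algebra
  also have "P * (a / b) + a / b * (a - b) * P / (z - a) + (\<Sum>n<m. res (Suc m) n / (z - \<alpha> n))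
       + a / b * (a - b) * (\<Sum>n<m. res m n / (a - \<alpha> n)) / (z - a)
     = P * (a / b) + ((\<Sum>n<m. res (Suc m) n / (z - \<alpha> n)) + a / b * (a - b) * (P + (\<Sum>n<m. res m n / (a - \<alpha> n))) / (z - a))"
    by (simp add: distrib_left add_divide_distrib)
  also have "P + (\<Sum>n<m. res m n / (a - \<alpha> n)) = G a" using ne by (intro IH[symmetric]) auto
  also have "a / b * (a - b) * G a / (z - a) = res (Suc m) m / (z - \<alpha> m)" by (simp add: resm a_def)
  finally show ?case by (simp add: P_def a_def b_def)
qed

section \<open>Growth of entire functions from bounds on circles\<close>

lemma entire_eq_0_of_circles:
  fixes F :: "complex \<Rightarrow> complex"
  assumes F: "F holomorphic_on UNIV" and R: "filterlim R at_top sequentially" and e: "e \<longlonglongrightarrow> 0"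
    and le: "\<forall>\<^sub>F N in sequentially. \<forall>z. norm z = R N \<longrightarrow> norm (F z) \<le> e N"
  shows "F z = 0"
proof -
  have "\<forall>\<^sub>F N in sequentially. norm z < R N"
    using R by (simp add: filterlim_at_top_dense)
  with le have "\<forall>\<^sub>F N in sequentially. norm (F z) \<le> e N"
    by eventually_elim (rule entire_norm_le_on_circle[OF F], auto)
  then have "norm (F z) \<le> 0" by (intro tendsto_lowerbound[OF e]) auto
  then show ?thesis by simp
qed

text \<open>The factor \<open>z\<^sup>2 - R\<^sup>2\<close> has modulus \<open>2 R \<bar>Im z\<bar>\<close> on the circle \<open>norm z = R\<close>, so it
  absorbs the singularity of the bound at the real axis.\<close>

lemma entire_norm_le_in_disc:
  fixes H :: "complex \<Rightarrow> complex"
  assumes H: "H holomorphic_on UNIV" and R: "R > 0" and C: "C \<ge> 0"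
    and le: "\<And>z. norm z = R \<Longrightarrow> Im z \<noteq> 0 \<Longrightarrow> norm (H z) * \<bar>Im z\<bar> \<le> C * R\<^sup>2"
    and z: "norm z \<le> R / 2"
  shows "norm (H z) \<le> 4 * C * R"
proof -
  have "norm (H z * (z\<^sup>2 - of_real (R\<^sup>2))) \<le> 2 * C * R ^ 3"
  proof (rule entire_norm_le_on_circle[where R = R and f = "\<lambda>z. H z * (z\<^sup>2 - of_real (R\<^sup>2))"])
    show "(\<lambda>z. H z * (z\<^sup>2 - of_real (R\<^sup>2))) holomorphic_on UNIV"
      by (intro holomorphic_intros H)
    show "norm z < R" using z R by simp
    fix w :: complex assume w: "norm w = R"
    have "w\<^sup>2 - of_real (R\<^sup>2) = w * (w - cnj w)"
      using complex_norm_square[of w] w by (simp add: algebra_simps power2_eq_square)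
    also have "norm \<dots> = R * (2 * \<bar>Im w\<bar>)"
      by (simp add: norm_mult w complex_diff_cnj)
    finally have n: "norm (w\<^sup>2 - of_real (R\<^sup>2)) = R * (2 * \<bar>Im w\<bar>)" .
    show "norm (H w * (w\<^sup>2 - of_real (R\<^sup>2))) \<le> 2 * C * R ^ 3"
    proof (cases "Im w = 0")
      case True
      then show ?thesis unfolding norm_mult n using C R by simp
    next
      case False
      have "norm (H w * (w\<^sup>2 - of_real (R\<^sup>2))) = 2 * R * (norm (H w) * \<bar>Im w\<bar>)"
        unfolding norm_mult n by simp
      also have "\<dots> \<le> 2 * R * (C * R\<^sup>2)" using le[OF w False] R by (intro mult_left_mono) auto
      finally show ?thesis by (simp add: power2_eq_square power3_eq_cube mult_ac)
    qed
  qed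
  moreover have "R\<^sup>2 / 2 \<le> norm (z\<^sup>2 - of_real (R\<^sup>2))"
  proof -
    have "(norm z)\<^sup>2 \<le> (R / 2)\<^sup>2" using z by (intro power_mono) auto
    then have "(norm z)\<^sup>2 \<le> R\<^sup>2 / 4" by (simp add: power_divide)
    moreover have "R\<^sup>2 - (norm z)\<^sup>2 \<le> norm (z\<^sup>2 - of_real (R\<^sup>2))"
      using norm_triangle_ineq2[of "complex_of_real (R\<^sup>2)" "z\<^sup>2"]
      by (simp add: norm_power norm_minus_commute)
    moreover have "R\<^sup>2 \<ge> 0" by simp
    ultimately show ?thesis by linarith
  qed
  then have "norm (H z) * (R\<^sup>2 / 2) \<le> norm (H z) * norm (z\<^sup>2 - of_real (R\<^sup>2))" by (intro mult_left_mono) auto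
  ultimately have "norm (H z) * (R\<^sup>2 / 2) \<le> 2 * C * R ^ 3" by (simp add: norm_mult)
  then have "norm (H z) * (R\<^sup>2 / 2) \<le> (4 * C * R) * (R\<^sup>2 / 2)" by (simp add: power2_eq_square power3_eq_cube)
  moreover have "R\<^sup>2 / 2 > 0" using R by simp
  ultimately show ?thesis by (simp only: mult_le_cancel_right_pos)
qed

text \<open>Every large point lies in half the disc of an admissible circle of comparable radius, so
  the bounds on circles become linear growth everywhere and \<open>H\<close> is affine. The limit
  along the negative axis then forces the slope to vanish.\<close>

lemma entire_constant_of_circle_bound:
  fixes H :: "complex \<Rightarrow> complex"
  assumes H: "H holomorphic_on UNIV" and C: "C \<ge> 0"
    and le: "\<forall>\<^sub>F N in sequentially. \<forall>z. norm z = (real N + 1 / 4)\<^sup>2 \<longrightarrow> Im z \<noteq> 0 \<longrightarrow> norm (H z) * \<bar>Im z\<bar> \<le> C * (norm z)\<^sup>2"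
    and lim: "((\<lambda>k. H (of_real (- k\<^sup>2)) / of_real (k\<^sup>2)) \<longlongrightarrow> 0) at_top"
  shows "H z = H 0"
proof -
  obtain N0 where N0: "\<And>N z. \<lbrakk>N \<ge> N0; norm z = (real N + 1 / 4)\<^sup>2; Im z \<noteq> 0\<rbrakk> \<Longrightarrow> norm (H z) * \<bar>Im z\<bar> \<le> C * (norm z)\<^sup>2"
    using le unfolding eventually_sequentially by blast
  have growth: "norm (H z) \<le> 36 * C * norm z ^ 1" if z: "max 1 ((real N0)\<^sup>2) \<le> norm z" for z :: complex
  proof -
    define s where "s = sqrt (norm z)"
    have s: "s \<ge> 1" "s \<ge> real N0" "s\<^sup>2 = norm z"
      using z real_le_rsqrt[of "real N0" "norm z"] by (auto simp: s_def)
    \<comment> \<open>The factor \<open>3 / 2\<close> yields \<open>R \<ge> 9 / 4 * norm z\<close>,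
      enough for \<open>norm z \<le> R / 2\<close>. As \<open>s \<ge> 1\<close>, the radius
      \<open>N + 1 / 4\<close> stays below \<open>3 * s\<close> despite rounding, so
      \<open>R \<le> 9 * norm z\<close>; this explains 36 as \<open>4 * 9\<close>.\<close>
    define N where "N = nat \<lceil>3 / 2 * s\<rceil>"
    have N: "3 / 2 * s \<le> real N" "real N \<le> 3 / 2 * s + 1"
      using s(1) by (auto simp: N_def)
    have "N \<ge> N0" using N s by linarith
    define R where "R = (real N + 1 / 4)\<^sup>2"
    have "(3 / 2 * s)\<^sup>2 \<le> R" unfolding R_def using N s by (intro power_mono) auto
    moreover have "(3 / 2 * s)\<^sup>2 = 9 / 4 * norm z" using s by (simp add: power_mult_distrib power_divide)
    ultimately have R1: "norm z \<le> R / 2" using norm_ge_zero[of z] by linarith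
    have "R \<le> (3 * s)\<^sup>2" unfolding R_def using N s by (intro power_mono) auto
    then have R2: "R \<le> 9 * norm z" using s by (simp add: power_mult_distrib)
    have "norm (H z) \<le> 4 * C * R"
    proof (rule entire_norm_le_in_disc[OF H _ C _ R1])
      show "R > 0" using R1 z by linarith
      show "norm (H w) * \<bar>Im w\<bar> \<le> C * R\<^sup>2" if "norm w = R" "Im w \<noteq> 0" for w
        using N0[OF \<open>N \<ge> N0\<close>, of w] that by (simp add: R_def)
    qed
    also have "\<dots> \<le> 4 * C * (9 * norm z)" using R2 C by (intro mult_left_mono) auto
    finally show ?thesis by simp
  qed
  define c where "c = deriv H 0"
  have lin: "H w = H 0 + c * w" for w :: complex
    using Liouville_polynomial[OF H, where A = "max 1 ((real N0)\<^sup>2)" and B = "36 * C" and n = 1 and \<xi> = w, OF growth] by (simp add: c_def)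
  have "((\<lambda>k. H 0 / of_real (k\<^sup>2) - c) \<longlongrightarrow> H 0 * 0 - c) at_top"
  proof -
    have "((\<lambda>k::real. inverse (k\<^sup>2)) \<longlongrightarrow> 0) at_top"
      by (intro tendsto_inverse_0_at_top filterlim_pow_at_top) (auto simp: filterlim_ident)
    then have "((\<lambda>k::real. H 0 * complex_of_real (inverse (k\<^sup>2)) - c) \<longlongrightarrow> H 0 * of_real 0 - c) at_top"
      by (intro tendsto_diff tendsto_mult tendsto_const tendsto_of_real)
    then show ?thesis by (simp add: divide_inverse)
  qed
  moreover have "\<forall>\<^sub>F k in at_top. H 0 / of_real (k\<^sup>2) - c = H (of_real (- k\<^sup>2)) / of_real (k\<^sup>2)"
    using eventually_gt_at_top[of 0]
  proof eventually_elim
    case (elim k)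
    then show ?case
      unfolding lin[of "of_real (- k\<^sup>2)"] by (simp add: add_divide_distrib diff_divide_distrib)
  qed
  ultimately have "((\<lambda>k. H (of_real (- k\<^sup>2)) / of_real (k\<^sup>2)) \<longlongrightarrow> H 0 * 0 - c) at_top"
    by (rule Lim_transform_eventually)
  from tendsto_unique[OF _ this lim] have "c = 0" by simp
  then show ?thesis using lin by simp
qed

section \<open>The Borg-Marchenko theorem\<close>

text \<open>Absolutely continuous functions determine derivatives only up to null sets; continuity
  upgrades this to every point, in particular to the endpoint 0, where initial values are
  compared.\<close>

lemma has_ac_derivative_unique:
  assumes fg: "has_ac_derivative f g" and hk: "has_ac_derivative h k"
    and cont: "continuous_on {0..pi} g" "continuous_on {0..pi} k"
    and eq: "\<And>x. x \<in> {0..pi} \<Longrightarrow> f x = h x" and x: "x \<in> {0..pi}"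
  shows "g x = k x"
proof -
  have int: "integral {0..x} g = integral {0..x} k" if "x \<in> {0..pi}" for x
  proof -
    have "(g has_integral f x - f 0) {0..x}" "(k has_integral h x - h 0) {0..x}"
      using fg hk that by (auto simp: has_ac_derivative_def)
    then show ?thesis using eq[OF that] eq[of 0] by (simp add: integral_unique)
  qed
  have "((\<lambda>x. integral {0..x} g) has_vector_derivative g x) (at x within {0..pi})"
    by (rule integral_has_vector_derivative[OF cont(1) x])
  moreover have "((\<lambda>x. integral {0..x} k) has_vector_derivative k x) (at x within {0..pi})"
    by (rule integral_has_vector_derivative[OF cont(2) x])
  then have "((\<lambda>x. integral {0..x} g) has_vector_derivative k x) (at x within {0..pi})"
    using int by (rule has_vector_derivative_transform[OF x, rotated]) auto
  ultimately show ?thesis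
    using x by (intro vector_derivative_unique_within[of x "{0..pi}"]) (auto simp: trivial_limit_within islimpt_Icc)
qed

text \<open>Lebesgue differentiation: at almost every point \<open>h\<close> is the limit of its
  averages over shrinking intervals to the right, and these averages are zero.\<close>

lemma integrals_zero_imp_AE_zero:
  fixes h :: "real \<Rightarrow> complex"
  assumes h: "h absolutely_integrable_on {0..pi}" and 0: "\<And>x. x \<in> {0..pi} \<Longrightarrow> integral {0..x} h = 0"
  shows "AE x in lebesgue. x \<in> {0<..<pi} \<longrightarrow> h x = 0"
proof -
  define h0 where "h0 = (\<lambda>x. if x \<in> {0..pi} then h x else 0)"
  have hi: "h integrable_on {c..d}" if "0 \<le> c" "d \<le> pi" for c d
    using absolutely_integrable_imp_integrable_on_subinterval[OF h that] .
  have "h0 integrable_on UNIV"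
    unfolding h0_def integrable_restrict_UNIV using hi by auto
  then have h0: "h0 integrable_on cbox a b" for a b
    using integrable_on_subcbox by blast
  have int0: "integral {c..d} h0 = 0" if "0 \<le> c" "c \<le> d" "d \<le> pi" for c d
  proof -
    have "integral {c..d} h0 = integral {c..d} h"
      using that by (intro integral_cong) (auto simp: h0_def)
    moreover have "integral {0..c} h + integral {c..d} h = integral {0..d} h"
      using that by (intro Henstock_Kurzweil_Integration.integral_combine hi) auto
    ultimately show ?thesis using 0[of c] 0[of d] that by simp
  qed
  obtain N where N: "negligible N"
    "\<And>x e. \<lbrakk>x \<notin> N; 0 < e\<rbrakk> \<Longrightarrow> \<exists>d>0. \<forall>t. 0 < t \<and> t < d \<longrightarrow>
        norm (integral (cbox x (x + t *\<^sub>R One)) h0 /\<^sub>R t ^ DIM(real) - h0 x) < e"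
    using integrable_ccontinuous_explicit[of h0] h0 by blast
  have "h x = 0" if x: "x \<in> {0<..<pi}" "x \<notin> N" for x
  proof (rule ccontr)
    assume "h x \<noteq> 0"
    then obtain d where d: "d > 0" "\<And>t. 0 < t \<Longrightarrow> t < d \<Longrightarrow>
        norm (integral (cbox x (x + t *\<^sub>R One)) h0 /\<^sub>R t ^ DIM(real) - h0 x) < norm (h x)"
      using N(2)[OF x(2), of "norm (h x)"] by auto
    define t where "t = min (d / 2) (pi - x)"
    have t: "0 < t" "t < d" "x + t \<le> pi" using d(1) x by (auto simp: t_def min_def)
    have "integral (cbox x (x + t *\<^sub>R One)) h0 = 0"
      using int0[of x "x + t"] t x by simp
    then have "norm (h0 x) < norm (h x)" using d(2)[OF t(1,2)] by simp
    then show False using x by (simp add: h0_def)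
  qed
  then have "{x \<in> space lebesgue. \<not> (x \<in> {0<..<pi} \<longrightarrow> h x = 0)} \<subseteq> N" by auto
  with N(1) show ?thesis
    by (intro AE_I'[of N]) (auto simp: negligible_iff_null_sets)
qed

lemma circle_radius_at_top: "filterlim (\<lambda>N. (real N + 1 / 4)\<^sup>2) at_top sequentially"
  by real_asymp

lemma csqrt_circle:
  assumes "norm z = (real N + 1 / 4)\<^sup>2"
  shows "norm (csqrt z) = real N + 1 / 4"
proof -
  have "(norm (csqrt z))\<^sup>2 = (real N + 1 / 4)\<^sup>2"
    using assms by (simp flip: norm_power)
  then show ?thesis by (simp add: power2_eq_iff_nonneg)
qed

context
  fixes q r :: "real \<Rightarrow> real"
  assumes q: "q absolutely_integrable_on {0..pi}" and r: "r absolutely_integrable_on {0..pi}"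
begin

text \<open>Equality of the Weyl functions lets the expression be rewritten through the solutions
  that vanish at \<open>pi\<close>. The growth \<open>exp (\<bar>Im l\<bar> * x)\<close> of
  \<open>phi\<close> and the growth \<open>exp (\<bar>Im l\<bar> * (pi - x))\<close> of those
  solutions together match the lower bound for the denominators, and a factor
  \<open>1 / norm l\<close> remains.\<close>

lemma cross_solution_zero:
  assumes eq: "\<And>z. theta q pi z * phi r pi z = theta r pi z * phi q pi z" and x: "x \<in> {0..pi}"
  shows "phi r x z * theta q x z - phi q x z * theta r x z = 0"
proof (rule entire_eq_0_of_circles[where R = "\<lambda>N. (real N + 1 / 4)\<^sup>2"
      and F = "\<lambda>z. phi r x z * theta q x z - phi q x z * theta r x z"])
  show "(\<lambda>z. phi r x z * theta q x z - phi q x z * theta r x z) holomorphic_on UNIV"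
    by (intro holomorphic_intros ivp_holomorphic q r x)
  show "filterlim (\<lambda>N. (real N + 1 / 4)\<^sup>2) at_top sequentially" by (rule circle_radius_at_top)
  show "(\<lambda>N. 16 / circle_const / (real N + 1 / 4)) \<longlonglongrightarrow> 0" by real_asymp
  show "\<forall>\<^sub>F N in sequentially. \<forall>z. norm z = (real N + 1 / 4)\<^sup>2 \<longrightarrow>
      norm (phi r x z * theta q x z - phi q x z * theta r x z) \<le> 16 / circle_const / (real N + 1 / 4)"
    using circle_bounds[OF q] circle_bounds[OF r]
  proof eventually_elim
    case (elim N)
    show ?case
    proof (intro allI impI)
      fix z :: complex assume z: "norm z = (real N + 1 / 4)\<^sup>2"
      define l where "l = csqrt z"
      define e where "e = exp (\<bar>Im l\<bar> * pi)"
      have nl: "norm l = real N + 1 / 4" using csqrt_circle[OF z] by (simp add: l_def)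
      have l2: "l\<^sup>2 = z" by (simp add: l_def)
      have lq: "l \<noteq> 0" "2 * potential_norm q \<le> norm l" and lr: "2 * potential_norm r \<le> norm l"
        and Pq: "circle_const / 2 * e / norm l \<le> norm (phi q pi z)" and Pr: "circle_const / 2 * e / norm l \<le> norm (phi r pi z)"
        using elim nl l2 by (auto simp: e_def)
      define V where "V = (\<lambda>q. phi q pi z * theta q x z - theta q pi z * phi q x z)"
      have ee: "exp (\<bar>Im l\<bar> * x) * exp (\<bar>Im l\<bar> * (pi - x)) = e"
        by (simp add: e_def algebra_simps flip: exp_add)
      have term_le: "norm (f * v / P) \<le> 8 / circle_const / norm l"
        if "norm f \<le> 2 / norm l * exp (\<bar>Im l\<bar> * x)" "norm v \<le> 2 / norm l * exp (\<bar>Im l\<bar> * (pi - x))"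
          "circle_const / 2 * e / norm l \<le> norm P" for f v P :: complex
      proof -
        have "norm f * norm v \<le> (2 / norm l * exp (\<bar>Im l\<bar> * x)) * (2 / norm l * exp (\<bar>Im l\<bar> * (pi - x)))"
          using that by (intro mult_mono) auto
        also have "\<dots> = 4 / (norm l)\<^sup>2 * e" by (simp add: power2_eq_square flip: ee)
        finally have "norm f * norm v \<le> 4 / (norm l)\<^sup>2 * e" .
        then have "norm (f * v / P) \<le> (4 / (norm l)\<^sup>2 * e) / (circle_const / 2 * e / norm l)"
          unfolding norm_divide norm_mult using that circle_const_pos lq(1)
          by (intro frac_le) (auto simp: e_def)
        also have "\<dots> = 8 / circle_const / norm l"
          using circle_const_pos lq(1) by (simp add: e_def power2_eq_square field_simps)
        finally show ?thesis .
      qed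
      have "circle_const / 2 * e / norm l > 0" using circle_const_pos lq(1) by (simp add: e_def)
      then have nz: "phi q pi z \<noteq> 0" "phi r pi z \<noteq> 0" using Pq Pr by auto
      have "phi r x z * theta q x z - phi q x z * theta r x z = phi r x z * V q / phi q pi z - phi q x z * V r / phi r pi z"
        using nz eq[of z] by (simp add: V_def field_simps)
      also have "norm \<dots> \<le> norm (phi r x z * V q / phi q pi z) + norm (phi q x z * V r / phi r pi z)"
        by (rule norm_triangle_ineq4)
      also have "\<dots> \<le> 8 / circle_const / norm l + 8 / circle_const / norm l"
        using phi_near_free(1)[OF r lq(1) lr x] phi_near_free(1)[OF q lq x]
          weyl_solution_bound[OF q lq x] weyl_solution_bound[OF r lq(1) lr x] Pq Pr
        by (intro add_mono term_le) (auto simp: V_def l2)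
      finally show "norm (phi r x z * theta q x z - phi q x z * theta r x z) \<le> 16 / circle_const / (real N + 1 / 4)"
        by (simp add: nl)
    qed
  qed
qed

theorem borg_marchenko:
  assumes eq: "\<And>z. theta q pi z * phi r pi z = theta r pi z * phi q pi z"
  shows "AE x in lebesgue. x \<in> {0<..<pi} \<longrightarrow> r x = q x"
proof -
  \<comment> \<open>A single parameter suffices from here on. Since \<open>\<i>\<close> is not real,
    \<open>f\<close> and \<open>F\<close> have no zeros on \<open>{0<..pi}\<close>.\<close>
  define f f' g g' where "f = (\<lambda>x. phi q x \<i>)" "f' = (\<lambda>x. phi' q x \<i>)" "g = (\<lambda>x. theta q x \<i>)" "g' = (\<lambda>x. theta' q x \<i>)"
  define F F' G G' where "F = (\<lambda>x. phi r x \<i>)" "F' = (\<lambda>x. phi' r x \<i>)" "G = (\<lambda>x. theta r x \<i>)" "G' = (\<lambda>x. theta' r x \<i>)"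
  note defs = f_f'_g_g'_def F_F'_G_G'_def
  have ac: "has_ac_derivative f f'" "has_ac_derivative f' (\<lambda>t. (of_real (q t) - \<i>) * f t)"
    "has_ac_derivative g g'" "has_ac_derivative g' (\<lambda>t. (of_real (q t) - \<i>) * g t)"
    "has_ac_derivative F F'" "has_ac_derivative F' (\<lambda>t. (of_real (r t) - \<i>) * F t)"
    "has_ac_derivative G G'" "has_ac_derivative G' (\<lambda>t. (of_real (r t) - \<i>) * G t)"
    using ivp_solution[OF q, of \<i>] ivp_solution[OF r, of \<i>]
    unfolding defs schrodinger_solution_iff[OF q] schrodinger_solution_iff[OF r] by auto
  note cont = ac[THEN has_ac_derivative_continuous]
  have cross: "F x * g x = f x * G x" if "x \<in> {0..pi}" for x
    using cross_solution_zero[OF eq that, of \<i>] by (simp add: defs)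
  have cross': "F' x * g x + F x * g' x = f' x * G x + f x * G' x" if "x \<in> {0..pi}" for x
    using that
    by (intro has_ac_derivative_unique[OF has_ac_derivative_mult[OF ac(5,3)] has_ac_derivative_mult[OF ac(1,7)]])
       (auto intro!: continuous_intros cont cross)
  \<comment> \<open>Multiplying the differentiated relation \<open>cross'\<close> by
    \<open>F x * f x\<close> and substituting \<open>cross\<close> turns it into \<open>f^2\<close>
    times one Wronskian equal to \<open>F^2\<close> times the other, and both Wronskians are
    1.\<close>
  have sq: "F x ^ 2 = f x ^ 2" if x: "x \<in> {0..pi}" for x
  proof -
    have "g x * f' x - g' x * f x = 1" "G x * F' x - G' x * F x = 1"
      using wronskian_phi_theta[OF q x] wronskian_phi_theta[OF r x] by (auto simp: defs)
    with cross[OF x] cross'[OF x] show ?thesis by algebra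
  qed
  have nz: "f x \<noteq> 0" "F x \<noteq> 0" if "x \<in> {0<..pi}" for x
    using phi_nonzero_nonreal[OF q, of x \<i>] phi_nonzero_nonreal[OF r, of x \<i>] that by (auto simp: defs)
  \<comment> \<open>A continuous function on a connected set with finitely many values is constant.
    The point 0 is excluded because \<open>f\<close> vanishes there; the common slope 1 of
    \<open>f\<close> and \<open>F\<close> at 0 fixes the sign afterwards.\<close>
  have "(\<lambda>x. F x / f x) constant_on {0<..pi}"
  proof (rule continuous_finite_range_constant)
    show "continuous_on {0<..pi} (\<lambda>x. F x / f x)"
      using nz by (intro continuous_intros continuous_on_subset[OF cont(1)] continuous_on_subset[OF cont(5)]) auto
    have "F x / f x \<in> {1, - 1}" if "x \<in> {0<..pi}" for x
      using sq[of x] nz[OF that] that by (auto simp: power2_eq_iff)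
    then have "(\<lambda>x. F x / f x) ` {0<..pi} \<subseteq> {1, - 1}" by blast
    then show "finite ((\<lambda>x. F x / f x) ` {0<..pi})" by (rule finite_subset) simp
  qed auto
  then obtain c where c: "\<And>x. x \<in> {0<..pi} \<Longrightarrow> F x / f x = c" unfolding constant_on_def by blast
  have f0: "f 0 = 0" "F 0 = 0" "f' 0 = 1" "F' 0 = 1" by (simp_all add: defs ivp_0[OF q] ivp_0[OF r])
  have Fc: "F x = c * f x" if "x \<in> {0..pi}" for x
    using c[of x] nz[of x] f0 that by (cases "x = 0") (auto simp: field_simps)
  have acc: "has_ac_derivative (\<lambda>x. c * f x) (\<lambda>x. c * f' x)"
    using has_ac_derivative_lincomb[OF ac(1) ac(1), of c 0] by simp
  have "F' 0 = c * f' 0"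
    by (rule has_ac_derivative_unique[OF ac(5) acc]) (auto intro!: continuous_intros cont Fc)
  then have c1: "c = 1" using f0 by simp
  have Ff: "F x = f x" if "x \<in> {0..pi}" for x using Fc[OF that] c1 by simp
  have F'f': "F' x = f' x" if "x \<in> {0..pi}" for x
    using that by (intro has_ac_derivative_unique[OF ac(5) ac(1)]) (auto intro!: cont Ff)
  define h where "h = (\<lambda>t. (of_real (r t) - \<i>) * F t - (of_real (q t) - \<i>) * f t)"
  have hac: "has_ac_derivative (\<lambda>x. F' x - f' x) h"
    using has_ac_derivative_lincomb[OF ac(6) ac(2), of 1 "- 1"] by (simp add: h_def)
  have "AE x in lebesgue. x \<in> {0<..<pi} \<longrightarrow> h x = 0"
  proof (rule integrals_zero_imp_AE_zero)
    show "h absolutely_integrable_on {0..pi}" using hac by (rule has_ac_derivative_integrable)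
    fix x assume x: "x \<in> {0..pi}"
    then have "(h has_integral (F' x - f' x) - (F' 0 - f' 0)) {0..x}"
      using hac by (auto simp: has_ac_derivative_def)
    then show "integral {0..x} h = 0" using F'f'[OF x] F'f'[of 0] by (simp add: integral_unique)
  qed
  then show ?thesis
  proof (rule AE_mp, intro AE_I2 impI)
    fix x assume h0: "x \<in> {0<..<pi} \<longrightarrow> h x = 0" and x: "x \<in> {0<..<pi}"
    have "(of_real (r x) - of_real (q x)) * f x = 0"
      using h0 x Ff[of x] by (simp add: h_def algebra_simps)
    then show "r x = q x" using nz(1)[of x] x by simp
  qed
qed

end

section \<open>Equality of the Weyl functions\<close>

text \<open>The value 1 at 0 expresses the constant term of the partial fractions through the
  residues. The two contributions of a pole then combine by \<open>1 / \<alpha> + 1 / (z - \<alpha>)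
  = (z^2 / (z - \<alpha>) - z) / \<alpha>^2\<close>, which is the origin of the weight in the
  residue conditions.\<close>

lemma partial_product_bound:
  fixes \<alpha> \<beta> :: "nat \<Rightarrow> real" and z :: complex
  defines "res \<equiv> \<lambda>m n. \<alpha> n / \<beta> n * (\<alpha> n - \<beta> n) * (\<Prod>j\<in>{..<m} - {n}. \<alpha> j / \<beta> j * ((\<alpha> n - \<beta> j) / (\<alpha> n - \<alpha> j)))"
  assumes \<alpha>: "inj \<alpha>" "\<And>n. \<alpha> n > 0" and \<beta>: "\<And>n. \<beta> n > 0"
    and B: "(\<Sum>n<m. \<bar>res m n\<bar> / (\<alpha> n)\<^sup>2) \<le> B"
    and d: "d > 0" "\<And>n. d \<le> norm (z - of_real (\<alpha> n))"
  shows "norm (\<Prod>n<m. (1 - z / of_real (\<beta> n)) / (1 - z / of_real (\<alpha> n))) \<le> 1 + B * (norm z + (norm z)\<^sup>2 / d)"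
proof -
  define r where "r = (\<lambda>n. complex_of_real (res m n))"
  define P where "P = (\<Prod>n<m. complex_of_real (\<alpha> n) / of_real (\<beta> n))"
  have r_eq: "r n = complex_of_real (\<alpha> n) / of_real (\<beta> n) * (of_real (\<alpha> n) - of_real (\<beta> n)) *
      (\<Prod>j\<in>{..<m} - {n}. of_real (\<alpha> j) / of_real (\<beta> j) * ((of_real (\<alpha> n) - of_real (\<beta> j)) / (of_real (\<alpha> n) - of_real (\<alpha> j))))" for n
    by (simp add: r_def res_def)
  have nz: "complex_of_real (\<alpha> n) \<noteq> 0" "complex_of_real (\<beta> n) \<noteq> 0" "z \<noteq> of_real (\<alpha> n)" for n
    using \<alpha>(2)[of n] \<beta>[of n] d(1) d(2)[of n] by auto
  have inj: "inj_on (\<lambda>n. complex_of_real (\<alpha> n)) {..<m}"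
    using \<alpha>(1) by (auto simp: inj_on_def inj_def)
  have pf: "(\<Prod>n<m. (w / of_real (\<beta> n) - 1) / (w / of_real (\<alpha> n) - 1)) = P + (\<Sum>n<m. r n / (w - of_real (\<alpha> n)))"
    if "\<And>n. w \<noteq> of_real (\<alpha> n)" for w
    unfolding P_def r_eq using partial_fractions[OF inj] nz that by simp
    have "P + (\<Sum>n<m. r n / (0 - of_real (\<alpha> n))) = (\<Prod>n<m. (0 / of_real (\<beta> n) - 1) / (0 / of_real (\<alpha> n) - 1))"
    by (rule pf[symmetric]) (use nz(1) in metis)
  also have "\<dots> = 1" by simp
  finally have P: "P = 1 + (\<Sum>n<m. r n / of_real (\<alpha> n))"
    by (simp add: sum_negf algebra_simps)
  have "(1 - z / of_real (\<beta> n)) / (1 - z / of_real (\<alpha> n)) = (z / of_real (\<beta> n) - 1) / (z / of_real (\<alpha> n) - 1)" for n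
    using minus_divide_divide[of "z / of_real (\<beta> n) - 1" "z / of_real (\<alpha> n) - 1"] by simp
  then have "(\<Prod>n<m. (1 - z / of_real (\<beta> n)) / (1 - z / of_real (\<alpha> n))) = P + (\<Sum>n<m. r n / (z - of_real (\<alpha> n)))"
    using pf[of z] nz by simp
  also have "\<dots> = 1 + (\<Sum>n<m. r n / (of_real (\<alpha> n))\<^sup>2 * (z\<^sup>2 / (z - of_real (\<alpha> n)) - z))"
  proof -
    have "r n / of_real (\<alpha> n) + r n / (z - of_real (\<alpha> n)) = r n / (of_real (\<alpha> n))\<^sup>2 * (z\<^sup>2 / (z - of_real (\<alpha> n)) - z)" for n
      using nz[of n] by (simp add: field_simps power2_eq_square)
    then show ?thesis unfolding P add.assoc sum.distrib[symmetric] by simp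
  qed
  also have "norm \<dots> \<le> 1 + norm (\<Sum>n<m. r n / (of_real (\<alpha> n))\<^sup>2 * (z\<^sup>2 / (z - of_real (\<alpha> n)) - z))"
    by (rule order_trans[OF norm_triangle_ineq]) simp
  also have "norm (\<Sum>n<m. r n / (of_real (\<alpha> n))\<^sup>2 * (z\<^sup>2 / (z - of_real (\<alpha> n)) - z))
      \<le> (\<Sum>n<m. \<bar>res m n\<bar> / (\<alpha> n)\<^sup>2 * (norm z + (norm z)\<^sup>2 / d))"
  proof (rule sum_norm_le)
    fix n
    have "norm (z\<^sup>2 / (z - of_real (\<alpha> n)) - z) \<le> norm (z\<^sup>2 / (z - of_real (\<alpha> n))) + norm z"
      by (rule norm_triangle_ineq4)
    also have "norm (z\<^sup>2 / (z - of_real (\<alpha> n))) \<le> (norm z)\<^sup>2 / d"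
      unfolding norm_divide norm_power using d(1) d(2)[of n] by (intro frac_le) auto
    finally have le: "norm (z\<^sup>2 / (z - of_real (\<alpha> n)) - z) \<le> norm z + (norm z)\<^sup>2 / d" by simp
    have "norm (r n / (of_real (\<alpha> n))\<^sup>2 * (z\<^sup>2 / (z - of_real (\<alpha> n)) - z))
      = \<bar>res m n\<bar> / (\<alpha> n)\<^sup>2 * norm (z\<^sup>2 / (z - of_real (\<alpha> n)) - z)"
      by (simp add: r_def norm_mult norm_divide norm_power)
    also have "\<dots> \<le> \<bar>res m n\<bar> / (\<alpha> n)\<^sup>2 * (norm z + (norm z)\<^sup>2 / d)"
      using le by (intro mult_left_mono) auto
    finally show "norm (r n / (of_real (\<alpha> n))\<^sup>2 * (z\<^sup>2 / (z - of_real (\<alpha> n)) - z))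
      \<le> \<bar>res m n\<bar> / (\<alpha> n)\<^sup>2 * (norm z + (norm z)\<^sup>2 / d)" .
  qed
  also have "\<dots> = (\<Sum>n<m. \<bar>res m n\<bar> / (\<alpha> n)\<^sup>2) * (norm z + (norm z)\<^sup>2 / d)"
    by (simp add: sum_distrib_right)
  also have "\<dots> \<le> B * (norm z + (norm z)\<^sup>2 / d)"
    using B d(1) by (intro mult_right_mono) auto
  finally show ?thesis by simp
qed

section \<open>Consequences of the spectral data and of the residue conditions\<close>

lemma summable_subsequence:
  fixes f :: "nat \<Rightarrow> real"
  assumes "summable f" "\<And>n. f n \<ge> 0" "strict_mono k"
  shows "summable (\<lambda>n. f (k n))"
  using summable_reindex[OF assms(1) strict_mono_imp_inj_on[OF assms(3)] assms(2)] by (simp add: o_def)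

lemma spectral_data_characterization:
  assumes "spectral_data q a b g"
  shows "q absolutely_integrable_on {0..pi}" "strict_mono a" "strict_mono b"
    "phi q pi z = 0 \<longleftrightarrow> z \<in> range (\<lambda>n. of_real (a n))"
    "theta q pi z = 0 \<longleftrightarrow> z \<in> range (\<lambda>n. of_real (b n))"
    "point_mass q (a n) (g n)"
proof -
  show q: "q absolutely_integrable_on {0..pi}"
    using assms by (simp add: spectral_data_def absolutely_integrable_on_Icc_iff_Ioo)
  show "strict_mono a" "strict_mono b" "point_mass q (a n) (g n)"
    using assms by (auto simp: spectral_data_def increasing_enumeration_def)
  show "phi q pi z = 0 \<longleftrightarrow> z \<in> range (\<lambda>n. of_real (a n))"
    "theta q pi z = 0 \<longleftrightarrow> z \<in> range (\<lambda>n. of_real (b n))"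
    using assms dirichlet_dirichlet_spectrum_iff[OF q, of z] neumann_dirichlet_spectrum_iff[OF q, of z]
    by (auto simp: spectral_data_def increasing_enumeration_def)
qed

text \<open>Zero counting is normalised by the value at 0, which is nonzero because both spectra are
  positive.\<close>

lemma summable_inverse_spectrum:
  assumes S: "spectral_data q a b g" and pos: "\<And>n. a n > 0" "\<And>n. b n > 0"
  shows "summable (\<lambda>n. 1 / a n)" "summable (\<lambda>n. 1 / b n)"
proof -
  note c = spectral_data_characterization[OF S]
  have "0 \<notin> range (\<lambda>n. complex_of_real (a n))" "0 \<notin> range (\<lambda>n. complex_of_real (b n))"
    using pos by (auto simp: image_iff) (metis less_irrefl of_real_eq_0_iff)+
  then have nz: "phi q pi 0 \<noteq> 0" "theta q pi 0 \<noteq> 0" using c(4,5) by auto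
  obtain C where C: "\<And>z. norm (phi q pi z) \<le> C * exp (pi * sqrt (norm z))"
    using phi_theta_square_root_growth(1)[OF c(1)] by blast
  show "summable (\<lambda>n. 1 / a n)"
    by (rule summable_inverse_zeros[OF ivp_holomorphic[OF c(1)] nz(1) C pi_gt_zero c(2) pos(1)]) (auto simp: c(4))
  obtain D where D: "\<And>z. norm (theta q pi z) \<le> D * exp (pi * sqrt (norm z))"
    using phi_theta_square_root_growth(2)[OF c(1)] by blast
  show "summable (\<lambda>n. 1 / b n)"
    by (rule summable_inverse_zeros[OF ivp_holomorphic[OF c(1)] nz(2) D pi_gt_zero c(3) pos(2)]) (auto simp: c(5))
qed

text \<open>The bound has to be uniform in \<open>m\<close> in order to survive the passage to the
  infinite product. The triangle inequality splits it: condition (1) bounds the differences,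
  condition (2) the limiting residues.\<close>

lemma partial_residue_sum_bounded:
  assumes "convergent (\<lambda>m. \<Sum>n<m. \<bar>partial_residue a b k l m n - full_residue a b k l n\<bar> / (a (k n))\<^sup>2)"
    and s: "summable (\<lambda>n. \<bar>full_residue a b k l n / (a (k n))\<^sup>2\<bar>)"
  obtains B where "B \<ge> 0" "\<And>m. (\<Sum>n<m. \<bar>partial_residue a b k l m n\<bar> / (a (k n))\<^sup>2) \<le> B"
proof -
  define S where "S = (\<lambda>m. \<Sum>n<m. \<bar>partial_residue a b k l m n - full_residue a b k l n\<bar> / (a (k n))\<^sup>2)"
  have "Bseq S" using assms(1) convergent_imp_Bseq by (simp add: S_def)
  then obtain B1 where B1: "B1 > 0" "\<And>m. norm (S m) \<le> B1" by (auto simp: Bseq_def)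
  define B2 where "B2 = (\<Sum>n. \<bar>full_residue a b k l n / (a (k n))\<^sup>2\<bar>)"
  have "(\<Sum>n<m. \<bar>partial_residue a b k l m n\<bar> / (a (k n))\<^sup>2) \<le> B1 + B2" for m
  proof -
    have "(\<Sum>n<m. \<bar>partial_residue a b k l m n\<bar> / (a (k n))\<^sup>2)
      \<le> (\<Sum>n<m. \<bar>partial_residue a b k l m n - full_residue a b k l n\<bar> / (a (k n))\<^sup>2 + \<bar>full_residue a b k l n / (a (k n))\<^sup>2\<bar>)"
    proof (rule sum_mono)
      fix n
      have "\<bar>partial_residue a b k l m n\<bar> \<le> \<bar>partial_residue a b k l m n - full_residue a b k l n\<bar> + \<bar>full_residue a b k l n\<bar>"
        by simp
      then have "\<bar>partial_residue a b k l m n\<bar> / (a (k n))\<^sup>2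
          \<le> (\<bar>partial_residue a b k l m n - full_residue a b k l n\<bar> + \<bar>full_residue a b k l n\<bar>) / (a (k n))\<^sup>2"
        by (rule divide_right_mono) simp
      then show "\<bar>partial_residue a b k l m n\<bar> / (a (k n))\<^sup>2
          \<le> \<bar>partial_residue a b k l m n - full_residue a b k l n\<bar> / (a (k n))\<^sup>2 + \<bar>full_residue a b k l n / (a (k n))\<^sup>2\<bar>"
        by (simp add: add_divide_distrib)
    qed
    also have "\<dots> = S m + (\<Sum>n<m. \<bar>full_residue a b k l n / (a (k n))\<^sup>2\<bar>)"
      by (simp add: S_def sum.distrib)
    also have "\<dots> \<le> B1 + B2"
      using B1(2)[of m] sum_le_suminf[OF s, of "{..<m}"] by (intro add_mono) (auto simp: B2_def)
    finally show ?thesis .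
  qed
  moreover have "B2 \<ge> 0" unfolding B2_def by (intro suminf_nonneg s) auto
  ultimately show thesis using that[of "B1 + B2"] B1(1) by simp
qed

text \<open>Numerator and denominator each contain one \<open>phi\<close> and one
  \<open>theta\<close>, so the exponentials and the factor \<open>1 / norm l\<close> cancel. The 16
  is \<open>2 * 2\<close> from the upper bounds over \<open>1 / 2 * 1 / 2\<close> from the lower
  ones.\<close>

lemma circle_ratio_bound:
  assumes q: "q absolutely_integrable_on {0..pi}" and r: "r absolutely_integrable_on {0..pi}"
  shows "\<forall>\<^sub>F N in sequentially. \<forall>z. norm z = (real N + 1 / 4)\<^sup>2 \<longrightarrow>
    norm (theta r pi z * phi q pi z / (theta q pi z * phi r pi z)) \<le> 16 / circle_const\<^sup>2"
  using circle_bounds[OF q] circle_bounds[OF r]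
proof eventually_elim
  case (elim N)
  show ?case
  proof (intro allI impI)
    fix z :: complex assume z: "norm z = (real N + 1 / 4)\<^sup>2"
    define l where "l = csqrt z"
    define e where "e = exp (\<bar>Im l\<bar> * pi)"
    have nl: "norm l = real N + 1 / 4" using csqrt_circle[OF z] by (simp add: l_def)
    have l2: "l\<^sup>2 = z" by (simp add: l_def)
    have lq: "l \<noteq> 0" "2 * potential_norm q \<le> norm l" and lr: "2 * potential_norm r \<le> norm l"
      and Tq: "circle_const / 2 * e \<le> norm (theta q pi z)" and Pr: "circle_const / 2 * e / norm l \<le> norm (phi r pi z)"
      using elim nl l2 by (auto simp: e_def)
    have Pq: "norm (phi q pi z) \<le> 2 / norm l * e" and Tr: "norm (theta r pi z) \<le> 2 * e"
      using phi_near_free(1)[OF q lq, of pi] theta_near_free(1)[OF r lq(1) lr, of pi] by (auto simp: l2 e_def)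
    have pos: "circle_const / 2 * e / norm l > 0" "circle_const / 2 * e > 0"
      using circle_const_pos lq(1) by (auto simp: e_def)
    have "norm (theta r pi z * phi q pi z / (theta q pi z * phi r pi z))
       \<le> ((2 * e) * (2 / norm l * e)) / ((circle_const / 2 * e) * (circle_const / 2 * e / norm l))"
      unfolding norm_divide norm_mult using Tq Pr Pq Tr pos circle_const_pos
      by (intro frac_le mult_mono mult_pos_pos) (auto simp: e_def)
    also have "\<dots> = 16 / circle_const\<^sup>2"
      using circle_const_pos lq(1) by (simp add: e_def power2_eq_square field_simps)
    finally show "norm (theta r pi z * phi q pi z / (theta q pi z * phi r pi z)) \<le> 16 / circle_const\<^sup>2" .
  qed
qed

lemma negative_axis_ratio_limit:
  assumes q: "q absolutely_integrable_on {0..pi}" and r: "r absolutely_integrable_on {0..pi}"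
  shows "((\<lambda>k. theta r pi (of_real (- k\<^sup>2)) * phi q pi (of_real (- k\<^sup>2))
      / (theta q pi (of_real (- k\<^sup>2)) * phi r pi (of_real (- k\<^sup>2)))) \<longlongrightarrow> 1) at_top"
proof -
  define s t where "s = (\<lambda>k. complex_of_real (2 * k * exp (- (k * pi))))" "t = (\<lambda>k. complex_of_real (2 * exp (- (k * pi))))"
  note lq = negative_axis_asymptotics[OF q, folded s_t_def] and lr = negative_axis_asymptotics[OF r, folded s_t_def]
  have "((\<lambda>k. ((t k * theta r pi (of_real (- k\<^sup>2))) * (s k * phi q pi (of_real (- k\<^sup>2))))
      / ((t k * theta q pi (of_real (- k\<^sup>2))) * (s k * phi r pi (of_real (- k\<^sup>2))))) \<longlongrightarrow> (1 * 1) / (1 * 1)) at_top"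
    using lq lr by (intro tendsto_divide tendsto_mult) (simp_all add: s_t_def)
  moreover have "\<forall>\<^sub>F k in at_top. ((t k * theta r pi (of_real (- k\<^sup>2))) * (s k * phi q pi (of_real (- k\<^sup>2))))
      / ((t k * theta q pi (of_real (- k\<^sup>2))) * (s k * phi r pi (of_real (- k\<^sup>2))))
      = theta r pi (of_real (- k\<^sup>2)) * phi q pi (of_real (- k\<^sup>2))
      / (theta q pi (of_real (- k\<^sup>2)) * phi r pi (of_real (- k\<^sup>2)))"
    using eventually_gt_at_top[of 0]
  proof eventually_elim
    case (elim k)
    have "s k \<noteq> 0" "t k \<noteq> 0" using elim by (auto simp: s_t_def)
    moreover have "(t k * w1) * (s k * w2) / ((t k * w3) * (s k * w4)) = ((t k * s k) * (w1 * w2)) / ((t k * s k) * (w3 * w4))" for w1 w2 w3 w4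
      by (simp add: mult_ac)
    ultimately show ?case by simp
  qed
  ultimately show ?thesis using Lim_transform_eventually by fastforce
qed

section \<open>The entire function H and the equality of the Weyl functions\<close>

lemma phi_nonzero_on_neumann_spectrum:
  assumes "spectral_data q a b g"
  shows "phi q pi (of_real (b n)) \<noteq> 0"
proof -
  note C = spectral_data_characterization[OF assms]
  have "theta q pi (of_real (b n)) = 0" using C(5)[of "of_real (b n)"] by blast
  then show ?thesis using wronskian_phi_theta[OF C(1), of pi "of_real (b n)"] by auto
qed

lemma weyl_functions_eq:
  fixes q q' :: "real \<Rightarrow> real" and a b g a' b' g' :: "nat \<Rightarrow> real" and k l :: "nat \<Rightarrow> nat" and s :: nat
  assumes S: "spectral_data q a b g"
    and apos: "\<And>n. a n > 0" and bpos: "\<And>n. b n > 0"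
    and k: "strict_mono k" and l: "strict_mono l"
    and res1: "convergent (\<lambda>m. \<Sum>n<m. \<bar>partial_residue a b k l m n - full_residue a b k l n\<bar> / (a (k n))\<^sup>2)"
    and res2: "summable (\<lambda>n. \<bar>full_residue a b k l n / (a (k n))\<^sup>2\<bar>)"
    and S': "spectral_data q' a' b' g'"
    and aa: "\<And>n. a' n = a n" and bb: "\<And>j. j \<notin> {l n | n. n \<noteq> s} \<Longrightarrow> b' j = b j"
    and gg: "\<And>n. g' (k n) = g (k n)"
  shows "theta q pi z * phi q' pi z = theta q' pi z * phi q pi z"
proof -
  note C = spectral_data_characterization[OF S] and C' = spectral_data_characterization[OF S']
  note q = C(1) and q' = C'(1)
  define P Q P' Q' where "P = phi q pi" "Q = theta q pi" "P' = phi q' pi" "Q' = theta q' pi"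
  note defs = P_Q_P'_Q'_def
  have hol: "P holomorphic_on UNIV" "Q holomorphic_on UNIV" "P' holomorphic_on UNIV" "Q' holomorphic_on UNIV"
    unfolding defs by (auto intro: ivp_holomorphic q q')
  note der = hol[THEN holomorphic_derivI[OF _ open_UNIV UNIV_I]]
  have "a' = a" using aa by auto
  have P0: "P z = 0 \<longleftrightarrow> z \<in> range (\<lambda>n. of_real (a n))" "P' z = 0 \<longleftrightarrow> z \<in> range (\<lambda>n. of_real (a n))"
    and Q0: "Q z = 0 \<longleftrightarrow> z \<in> range (\<lambda>n. of_real (b n))" "Q' z = 0 \<longleftrightarrow> z \<in> range (\<lambda>n. of_real (b' n))" for z
    using C(4,5)[of z] C'(4,5)[of z] by (simp_all add: defs \<open>a' = a\<close>)
  have Pa: "P (of_real (a n)) = 0" "P' (of_real (a n)) = 0" for n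
    using P0[of "of_real (a n)"] by auto
  have dP: "deriv P (of_real (a n)) \<noteq> 0" "Q (of_real (a n)) = of_real (g n) * deriv P (of_real (a n))"
    "deriv P' (of_real (a n)) \<noteq> 0" "Q' (of_real (a n)) = of_real (g' n) * deriv P' (of_real (a n))" for n
    using theta_eq_point_mass_mult_deriv_phi[OF q _ C(6), of n] theta_eq_point_mass_mult_deriv_phi[OF q' _ C'(6), of n] Pa[of n]
    by (simp_all add: defs \<open>a' = a\<close>)
  have dQ: "deriv Q (of_real (b n)) \<noteq> 0" for n
    using deriv_theta_nonzero[OF q, of "b n"] Q0(1)[of "of_real (b n)"] by (auto simp: defs)
  define \<alpha> \<beta> where "\<alpha> = (\<lambda>n. a (k n))" "\<beta> = (\<lambda>n. b (l n))"
  note ab_def = \<alpha>_\<beta>_def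
  have "strict_mono \<alpha>" "strict_mono \<beta>"
    using strict_mono_o[OF C(2) k] strict_mono_o[OF C(3) l] by (simp_all add: ab_def o_def)
  then have inj: "inj \<alpha>" "inj \<beta>" by (auto intro: strict_mono_imp_inj_on)
  have pos: "\<And>n. \<alpha> n > 0" "\<And>n. \<beta> n > 0" using apos bpos by (simp_all add: ab_def)
  have sum: "summable (\<lambda>n. 1 / \<alpha> n)" "summable (\<lambda>n. 1 / \<beta> n)"
    unfolding ab_def using apos bpos
    by (intro summable_subsequence[OF summable_inverse_spectrum(1)[OF S apos bpos] _ k]
        summable_subsequence[OF summable_inverse_spectrum(2)[OF S apos bpos] _ l]; simp add: less_imp_le)+
  obtain f where f: "f holomorphic_on UNIV" "\<And>z. f z = 0 \<longleftrightarrow> z \<in> range (\<lambda>n. of_real (\<alpha> n))"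
      "\<And>z. (\<lambda>m. \<Prod>n<m. 1 - z / of_real (\<alpha> n)) \<longlonglongrightarrow> f z" "\<And>n. deriv f (of_real (\<alpha> n)) \<noteq> 0"
    by (rule entire_canonical_product[OF inj(1) pos(1) sum(1)]) blast
  obtain h where h: "h holomorphic_on UNIV" "\<And>z. h z = 0 \<longleftrightarrow> z \<in> range (\<lambda>n. of_real (\<beta> n))"
      "\<And>z. (\<lambda>m. \<Prod>n<m. 1 - z / of_real (\<beta> n)) \<longlonglongrightarrow> h z"
    by (rule entire_canonical_product[OF inj(2) pos(2) sum(2)]) blast
  obtain B where B: "B \<ge> 0" "\<And>m. (\<Sum>n<m. \<bar>partial_residue a b k l m n\<bar> / (a (k n))\<^sup>2) \<le> B"
    using partial_residue_sum_bounded[OF res1 res2] by blast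
  \<comment> \<open>\<open>h / f\<close> is G, and the bound passes from its partial products to the
    limit. Here \<open>d\<close> is any lower bound for the distance to the poles: below it is
    \<open>\<bar>Im z\<bar>\<close> off the real axis and \<open>t^2\<close> at the point
    \<open>- t^2\<close>.\<close>
  have G_bound: "norm (h z / f z) \<le> 1 + B * (norm z + (norm z)\<^sup>2 / d)"
    if d: "d > 0" "\<And>n. d \<le> norm (z - of_real (\<alpha> n))" for z d
  proof (rule tendsto_upperbound)
    have "z \<noteq> of_real (\<alpha> n)" for n using d(1) d(2)[of n] by auto
    then have "f z \<noteq> 0" using f(2)[of z] by blast
    then show "(\<lambda>m. norm ((\<Prod>n<m. 1 - z / of_real (\<beta> n)) / (\<Prod>n<m. 1 - z / of_real (\<alpha> n)))) \<longlonglongrightarrow> norm (h z / f z)"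
      by (intro tendsto_norm tendsto_divide f h)
    show "\<forall>\<^sub>F m in sequentially. norm ((\<Prod>n<m. 1 - z / of_real (\<beta> n)) / (\<Prod>n<m. 1 - z / of_real (\<alpha> n))) \<le> 1 + B * (norm z + (norm z)\<^sup>2 / d)"
      unfolding prod_dividef[symmetric]
      by (intro always_eventually allI partial_product_bound inj pos d)
         (use B(2) in \<open>simp add: ab_def partial_residue_def\<close>)
  qed simp

  \<comment> \<open>\<open>N / (P * P')\<close> is the difference of the two Weyl functions, so the
    claim is that \<open>N\<close> vanishes identically.\<close>
  define N where "N = (\<lambda>z. Q z * P' z - Q' z * P z)"
  have N: "N holomorphic_on UNIV" unfolding N_def by (intro holomorphic_intros hol)
  obtain K1 where K1: "K1 holomorphic_on UNIV" "\<And>z. N z = K1 z * P' z"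
  proof (rule entire_quotient[OF N hol(3)])
    fix z assume "P' z = 0"
    then obtain n where "z = of_real (a n)" using P0 by auto
    then show "N z = 0 \<and> deriv P' z \<noteq> 0" using Pa dP by (simp add: N_def)
  qed (use that in blast)
  \<comment> \<open>Equal masses make \<open>a (k n)\<close> a double zero of \<open>N\<close>:
    there \<open>Q\<close> and \<open>Q'\<close> are the same multiple of \<open>deriv P\<close> and
    \<open>deriv P'\<close>, so the two terms of the derivative
    \<open>Q * deriv P' - Q' * deriv P\<close> cancel.\<close>
  have K1k: "K1 (of_real (\<alpha> n)) = 0" for n
  proof -
    define w where "w = complex_of_real (\<alpha> n)"
    have w: "P w = 0" "P' w = 0" using Pa by (auto simp: w_def ab_def)
    have "(N has_field_derivative (Q w * deriv P' w + deriv Q w * P' w - (Q' w * deriv P w + deriv Q' w * P w))) (at w)"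
      unfolding N_def by (intro DERIV_diff DERIV_mult' der)
    moreover have "(N has_field_derivative (K1 w * deriv P' w + deriv K1 w * P' w)) (at w)"
      unfolding K1(2) by (intro DERIV_mult' der holomorphic_derivI[OF K1(1) open_UNIV UNIV_I])
    ultimately have "K1 w * deriv P' w = Q w * deriv P' w - Q' w * deriv P w"
      using DERIV_unique w by fastforce
    also have "\<dots> = 0" using dP[of "k n"] gg[of n] by (simp add: w_def ab_def)
    finally show ?thesis using dP(3)[of "k n"] by (simp add: w_def ab_def)
  qed
  define \<beta>s where "\<beta>s = complex_of_real (\<beta> s)"
  have \<beta>s: "\<beta>s \<noteq> 0" using pos(2)[of s] by (simp add: \<beta>s_def)
  have dlin: "deriv (\<lambda>z. 1 - z / \<beta>s) z = - 1 / \<beta>s" for z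
    using \<beta>s by (intro DERIV_imp_deriv) (auto intro!: derivative_eq_intros)
  \<comment> \<open>The factor of \<open>h\<close> at \<open>b (l s)\<close> is set aside here and
    returned in the definition of \<open>H\<close>, so that \<open>H\<close> vanishes at this point
    by construction.\<close>
  obtain hs where hs: "hs holomorphic_on UNIV" "\<And>z. h z = hs z * (1 - z / \<beta>s)"
  proof (rule entire_quotient[OF h(1), of "\<lambda>z. 1 - z / \<beta>s"])
    show "(\<lambda>z. 1 - z / \<beta>s) holomorphic_on UNIV" using \<beta>s by (intro holomorphic_intros)
    fix z assume "1 - z / \<beta>s = 0"
    then have "z = \<beta>s" using \<beta>s by simp
    then show "h z = 0 \<and> deriv (\<lambda>z. 1 - z / \<beta>s) z \<noteq> 0" using h(2)[of z] dlin \<beta>s by (auto simp: \<beta>s_def)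
  qed (use that in blast)
  obtain K2 where K2: "K2 holomorphic_on UNIV" "\<And>z. hs z * K1 z = K2 z * f z"
  proof (rule entire_quotient[OF _ f(1), of "\<lambda>z. hs z * K1 z"])
    show "(\<lambda>z. hs z * K1 z) holomorphic_on UNIV" by (intro holomorphic_intros hs K1)
    fix z assume "f z = 0"
    then show "hs z * K1 z = 0 \<and> deriv f z \<noteq> 0" using f(2)[of z] f(4) K1k by auto
  qed (use that in blast)
  have "K2 (of_real (b j)) = 0" for j
  proof -
    define w where "w = complex_of_real (b j)"
    have Pw: "P w \<noteq> 0" using phi_nonzero_on_neumann_spectrum[OF S, of j] by (simp add: w_def defs)
    then have P'w: "P' w \<noteq> 0" and fw: "f w \<noteq> 0" using P0[of w] f(2)[of w] by (auto simp: ab_def)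
    \<comment> \<open>At an eigenvalue known to be shared, both \<open>Q\<close> and
      \<open>Q'\<close> vanish, and so does \<open>N\<close>; this case includes
      \<open>b (l s)\<close>. Every other \<open>b j\<close> is a zero of \<open>h\<close> different
      from \<open>\<beta>s\<close>, hence a zero of \<open>hs\<close>.\<close>
    have "hs w * N w = 0"
    proof (cases "j \<in> {l n | n. n \<noteq> s}")
      case False
      then have "w = of_real (b' j)" using bb by (simp add: w_def)
      then have "Q' w = 0" using Q0(2)[of w] by blast
      moreover have "Q w = 0" using Q0(1)[of w] by (auto simp: w_def)
      ultimately show ?thesis by (simp add: N_def)
    next
      case True
      then obtain n where n: "j = l n" "n \<noteq> s" by blast
      have "h w = 0" using h(2)[of w] n by (auto simp: w_def ab_def)
      moreover have "w \<noteq> \<beta>s" using n inj(2) by (auto simp: w_def \<beta>s_def ab_def inj_def)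
      ultimately show ?thesis using hs(2)[of w] \<beta>s by simp
    qed
    then have "K2 w * f w * P' w = 0" using K1(2)[of w] K2(2)[of w] by (simp flip: mult.assoc)
    then show ?thesis using P'w fw by (simp add: w_def)
  qed
  then obtain K3 where K3: "K3 holomorphic_on UNIV" "\<And>z. K2 z = K3 z * Q z"
  proof -
    assume K2b: "\<And>j. K2 (of_real (b j)) = 0"
    show thesis
    proof (rule entire_quotient[OF K2(1) hol(2)])
      fix z assume "Q z = 0"
      then show "K2 z = 0 \<and> deriv Q z \<noteq> 0" using Q0(1)[of z] K2b dQ by auto
    qed (use that in blast)
  qed
  define H where "H = (\<lambda>z. K3 z * (1 - z / \<beta>s))"
  have H: "H holomorphic_on UNIV" unfolding H_def using \<beta>s by (intro holomorphic_intros K3)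
  have HN: "H z * (f z * P' z * Q z) = h z * N z" for z
    using K1(2)[of z] K2(2)[of z] K3(2)[of z] hs(2)[of z] by (simp add: H_def)
  have off_axis: "z \<notin> range (\<lambda>n. complex_of_real (x n))" if "Im z \<noteq> 0 \<or> Re z < 0" "\<And>n. x n > 0"
    for z and x :: "nat \<Rightarrow> real"
  proof
    assume "z \<in> range (\<lambda>n. complex_of_real (x n))"
    then obtain n where "z = of_real (x n)" by blast
    then show False using that(1) that(2)[of n] by simp
  qed
  have nonzero: "f z \<noteq> 0" "P z \<noteq> 0" "P' z \<noteq> 0" "Q z \<noteq> 0" if "Im z \<noteq> 0 \<or> Re z < 0" for z
    using f(2)[of z] P0[of z] Q0(1)[of z] off_axis[OF that pos(1)] off_axis[OF that apos] off_axis[OF that bpos] by auto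
  have H_eq: "H z = h z / f z * (1 - Q' z * P z / (Q z * P' z))" if "Im z \<noteq> 0 \<or> Re z < 0" for z
    using HN[of z] nonzero[OF that] by (simp add: N_def field_simps)
  define c where "c = 16 / circle_const\<^sup>2"
  have c: "c \<ge> 0" by (simp add: c_def)
  have "H z = H 0" for z
  proof (rule entire_constant_of_circle_bound[OF H, of "(1 + 2 * B) * (1 + c)"])
    show "0 \<le> (1 + 2 * B) * (1 + c)" using B c by simp
    show "\<forall>\<^sub>F N in sequentially. \<forall>z. norm z = (real N + 1 / 4)\<^sup>2 \<longrightarrow> Im z \<noteq> 0 \<longrightarrow>
        norm (H z) * \<bar>Im z\<bar> \<le> (1 + 2 * B) * (1 + c) * (norm z)\<^sup>2"
      using circle_ratio_bound[OF q q'] eventually_ge_at_top[of 1]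
    proof eventually_elim
      case (elim N)
      show ?case
      proof (intro allI impI)
        fix z assume z: "norm z = (real N + 1 / 4)\<^sup>2" and im: "Im z \<noteq> 0"
        have z1: "norm z \<ge> 1" unfolding z using elim(2) by (simp add: one_le_power)
        have ratio: "norm (Q' z * P z / (Q z * P' z)) \<le> c" using elim(1) z by (simp add: defs c_def)
        have "norm (h z / f z) \<le> 1 + B * (norm z + (norm z)\<^sup>2 / \<bar>Im z\<bar>)"
        proof (rule G_bound)
          show "\<bar>Im z\<bar> \<le> norm (z - of_real (\<alpha> n))" for n using abs_Im_le_cmod[of "z - of_real (\<alpha> n)"] by simp
        qed (use im in simp)
        then have "norm (h z / f z) * \<bar>Im z\<bar> \<le> (1 + B * (norm z + (norm z)\<^sup>2 / \<bar>Im z\<bar>)) * \<bar>Im z\<bar>"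
          by (rule mult_right_mono) simp
        also have "\<dots> = \<bar>Im z\<bar> + B * (norm z * \<bar>Im z\<bar>) + B * (norm z)\<^sup>2" using im by (simp add: field_simps)
        also have "\<dots> \<le> (norm z)\<^sup>2 + B * (norm z)\<^sup>2 + B * (norm z)\<^sup>2"
        proof -
          have "\<bar>Im z\<bar> \<le> norm z" by (rule abs_Im_le_cmod)
          moreover have "norm z \<le> (norm z)\<^sup>2" using z1 by (simp add: power2_eq_square mult_le_cancel_left1)
          moreover have "B * (norm z * \<bar>Im z\<bar>) \<le> B * (norm z)\<^sup>2"
            unfolding power2_eq_square using B(1) by (intro mult_left_mono abs_Im_le_cmod) auto
          ultimately show ?thesis by linarith
        qed
        finally have G: "norm (h z / f z) * \<bar>Im z\<bar> \<le> (1 + 2 * B) * (norm z)\<^sup>2" by (simp add: algebra_simps)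
        have R: "norm (1 - Q' z * P z / (Q z * P' z)) \<le> 1 + c"
          using norm_triangle_ineq4[of 1 "Q' z * P z / (Q z * P' z)"] ratio by simp
        have "(norm (h z / f z) * \<bar>Im z\<bar>) * norm (1 - Q' z * P z / (Q z * P' z)) \<le> ((1 + 2 * B) * (norm z)\<^sup>2) * (1 + c)"
          by (rule mult_mono[OF G R]) (use B(1) in auto)
        moreover have "norm (H z) = norm (h z / f z) * norm (1 - Q' z * P z / (Q z * P' z))"
          unfolding H_eq[OF disjI1[OF im]] norm_mult by (rule refl)
        ultimately show "norm (H z) * \<bar>Im z\<bar> \<le> (1 + 2 * B) * (1 + c) * (norm z)\<^sup>2"
          by (simp only: mult_ac)
      qed
    qed
    show "((\<lambda>t. H (of_real (- t\<^sup>2)) / of_real (t\<^sup>2)) \<longlongrightarrow> 0) at_top"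
    proof -
      \<comment> \<open>On the negative axis G is only known to be \<open>O(t^2)\<close>, so after
        division by \<open>t^2\<close> the smallness has to come from the ratio of the Weyl
        functions tending to 1.\<close>
      define \<rho> where "\<rho> = (\<lambda>t::real. 1 - Q' (of_real (- t\<^sup>2)) * P (of_real (- t\<^sup>2)) / (Q (of_real (- t\<^sup>2)) * P' (of_real (- t\<^sup>2))))"
      have "(\<rho> \<longlongrightarrow> 1 - 1) at_top"
        unfolding \<rho>_def defs by (intro tendsto_diff tendsto_const negative_axis_ratio_limit q q')
      then have \<rho>0: "((\<lambda>t. (1 + 2 * B) * norm (\<rho> t)) \<longlongrightarrow> 0) at_top"
        by (auto intro!: tendsto_mult_right_zero tendsto_norm_zero)
      show ?thesis
      proof (rule Lim_null_comparison[OF _ \<rho>0])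
        show "\<forall>\<^sub>F t in at_top. norm (H (of_real (- t\<^sup>2)) / of_real (t\<^sup>2)) \<le> (1 + 2 * B) * norm (\<rho> t)"
          using eventually_ge_at_top[of 1]
        proof eventually_elim
          case (elim t)
          define z where "z = complex_of_real (- t\<^sup>2)"
          have t1: "t\<^sup>2 \<ge> 1" using elim by (simp add: one_le_power)
          have t: "t \<noteq> 0" using elim by simp
          have nz: "norm z = t\<^sup>2" by (simp add: z_def norm_power)
          have "norm (h z / f z) \<le> 1 + B * (norm z + (norm z)\<^sup>2 / t\<^sup>2)"
          proof (rule G_bound)
            show "t\<^sup>2 > 0" using t by simp
            show "t\<^sup>2 \<le> norm (z - of_real (\<alpha> n))" for n
            proof -
              have "z - of_real (\<alpha> n) = of_real (- t\<^sup>2 - \<alpha> n)" by (simp add: z_def)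
              moreover have "t\<^sup>2 \<le> \<bar>- t\<^sup>2 - \<alpha> n\<bar>" using pos(1)[of n] t1 by linarith
              ultimately show ?thesis by (simp only: norm_of_real)
            qed
          qed
          also have "\<dots> = 1 + 2 * B * t\<^sup>2" using t by (simp add: nz power2_eq_square)
          also have "\<dots> \<le> (1 + 2 * B) * t\<^sup>2" using t1 by (simp add: algebra_simps)
          finally have G: "norm (h z / f z) \<le> (1 + 2 * B) * t\<^sup>2" .
          have re: "Re z < 0" using t by (simp add: z_def)
          have "norm (H z) = norm (h z / f z) * norm (\<rho> t)"
            unfolding \<rho>_def z_def[symmetric] H_eq[OF disjI2[OF re]] norm_mult by (rule refl)
          also have "\<dots> \<le> (1 + 2 * B) * t\<^sup>2 * norm (\<rho> t)" using G by (rule mult_right_mono) simp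
          finally have "norm (H z) \<le> (1 + 2 * B) * norm (\<rho> t) * t\<^sup>2" by (simp only: mult_ac)
          moreover have "norm (H z / of_real (t\<^sup>2)) = norm (H z) / t\<^sup>2" by (simp add: norm_divide norm_power)
          ultimately show ?case
            using t unfolding z_def[symmetric] by (simp add: pos_divide_le_eq)
        qed
      qed
    qed
  qed
  note const = this
  have "H \<beta>s = 0" using \<beta>s by (simp add: H_def)
  then have "H z = 0" for z using const[of z] const[of \<beta>s] by simp
  then have hN: "h z * N z = 0" for z using HN[of z] by simp
  \<comment> \<open>All zeros of \<open>h\<close> are real, so \<open>N\<close> vanishes on the
    upper half plane, and the identity theorem extends this to the whole plane.\<close>
  have "N z = 0"
  proof (rule analytic_continuation_open[of "{z. 0 < Im z}" UNIV N "\<lambda>_. 0"])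
    show "open {z. 0 < Im z}" by (rule open_halfspace_Im_gt)
    have "\<i> \<in> {z. 0 < Im z}" by simp
    then show "{z. 0 < Im z} \<noteq> {}" by blast
    show "N z = 0" if "z \<in> {z. 0 < Im z}" for z
    proof -
      have "h z \<noteq> 0" using h(2)[of z] that by auto
      then show ?thesis using hN[of z] by simp
    qed
  qed (use N in auto)
  then show ?thesis by (simp add: N_def defs)
qed

theorem theorem4p6:
  fixes q q' :: "real \<Rightarrow> real"
    and a b g a' b' g' :: "nat \<Rightarrow> real"
    and k l :: "nat \<Rightarrow> nat"
    and s :: nat
  assumes "spectral_data q a b g"
    and "\<And>n. a n > 0" and "\<And>n. b n > 0"
    and "strict_mono k" and "strict_mono l"
    and "convergent (\<lambda>m. \<Sum>n<m.
           \<bar>partial_residue a b k l m n - full_residue a b k l n\<bar> / (a (k n))\<^sup>2)"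
    and "summable (\<lambda>n. \<bar>full_residue a b k l n / (a (k n))\<^sup>2\<bar>)"
    and "spectral_data q' a' b' g'"
    and "\<And>n. a' n = a n"
    and "\<And>j. j \<notin> {l n | n. n \<noteq> s} \<Longrightarrow> b' j = b j"
    and "\<And>n. g' (k n) = g (k n)"
  shows "AE x in lebesgue. x \<in> {0<..<pi} \<longrightarrow> q' x = q x"
  using borg_marchenko[OF spectral_data_characterization(1)[OF assms(1)]
      spectral_data_characterization(1)[OF assms(8)] weyl_functions_eq[OF assms]] .

end
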